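(* Let $\mathcal{C}=\mathrm{Vect}_\Gamma\oplus\mathrm{Vect}_{\Gamma/2\Gamma}$ be the $\mathbb{Z}_2$-crossed ribbon fusion category described in the context, attached to a discriminant form $(\Gamma,Q)$ and data $(\sigma,\omega,\bar\delta,\varepsilon,q,\alpha,\beta)$, and let $X_{a,s}$, $Y_{\{b,-b\}}$, $Z_{\bar x,r}$ be the simple objects of the equivariantisation $\mathcal{C}/\!/\mathbb{Z}_2$ described in the context. The modular data of $\mathcal{C}/\!/\mathbb{Z}_2$ are given by the $\mathcal{T}$-matrix with entries $$\mathcal{T}_{X_{a,s},X_{a,s}}=Q(a)^{-1},\quad\mathcal{T}_{Y_{\{a,-a\}},Y_{\{a,-a\}}}=Q(a)^{-1},\quad\mathcal{T}_{Z_{\bar x,s},Z_{\bar x,s}}=s\beta^{-1}$$ and the $\mathcal{S}$-matrix with entries $$\mathcal{S}_{X_{a,s},X_{b,t}}=B_Q(a,b),\qquad \mathcal{S}_{X_{a,s},Y_{\{b,-b\}}}=2B_Q(a,b),$$ $$\mathcal{S}_{X_{a,s},Z_{\bar x,r}}=s\,|2\Gamma|^{1/2}B_Q(\bar x,a)Q(a),\qquad \mathcal{S}_{Y_{\{a,-a\}},Z_{\bar x,r}}=0,$$ $$\mathcal{S}_{Y_{\{b,-b\}},Y_{\{c,-c\}}}=2\bigl(B_Q(b,c)+B_Q(b,c)^{-1}\bigr),$$ $$\mathcal{S}_{Z_{\bar x,r},Z_{\bar y,s}}=\varepsilon\,rs\,|2\Gamma|^{1/2}\,G_{\bar\delta}(\Gamma,q^{-1})\,G_{\bar\delta+\bar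 x+\bar y}(\Gamma,Q),$$ with the Gauss sums $G_{\bar\delta+\bar z}(\Gamma,Q)=|2\Gamma|^{-1/2}\sum_{a\in\bar\delta+\bar z}Q(a)$ for $\bar z\in\Gamma/2\Gamma$ and $G_{\bar\delta}(\Gamma,q^{-1})=|2\Gamma|^{-1/2}\sum_{a\in\bar\delta}q(a)^{-1}$.
   Context: All categories are $\mathbb{C}$-linear. **Input data.** A discriminant form $(\Gamma,Q)$ is a finite abelian group $\Gamma$ (written additively) with a nondegenerate quadratic form $Q\colon\Gamma\to\mathbb{C}^\times$: $Q(na)=Q(a)^{n^2}$ for $n\in\mathbb{Z}$, and $B_Q(a,b)=Q(a+b)Q(a)^{-1}Q(b)^{-1}$ is bimultiplicative and nondegenerate. Fix functions $\sigma\colon\Gamma^2\to\mathbb{C}^\times$, $\omega\colon\Gamma^3\to\{\pm1\}$ with: $\sigma(a,a)=Q(a)$; $\sigma(a,0)=\sigma(0,a)=1$; $\sigma(a,b)=\sigma(b,a)$; $\omega(a,b,c)=\sigma(a,b+c)\sigma(a,b)^{-1}\sigma(a,c)^{-1}$; and for fixed $b,c$ the map $\omega(\cdot,b,c)\colon\Gamma\to\{\pm1\}$ is a group homomorphism (so it factors through $\Gamma/2\Gamma$, and we allow the first argument of $\omega$ to lie in $\Gamma/2\Gamma$). For $x\in\Gamma$, $\bar x$ denotes its class in $\Gamma/2\Gamma$. Put $\Gamma_2=\{a\in\Gamma\mid 2a=0\}$; for $a\in\Gamma_2$ the map $B_Q(\cdot,a)$ takes values in $\{\pm1\}$ and factors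 through $\Gamma/2\Gamma$, which gives meaning to $B_Q(\bar x,a)$. Fix $\bar\delta\in\Gamma/2\Gamma$ and $q\colon\Gamma\to\mathbb{C}^\times$ with $q(a)^2=Q(a)$ and $q(a+b)q(a)^{-1}q(b)^{-1}=\sigma(a,b)\,\omega(a+b,a,b)\,\omega(\bar\delta,a,b)$ for all $a,b\in\Gamma$. Fix $\varepsilon\in\{\pm1\}$, a square root $\alpha$ of $\varepsilon\,G_{\bar\delta}(\Gamma,q^{-1})$, and a choice $\beta=\pm\alpha^{-1}$, so that $\beta$ is a square root of $\beta^2=1/\alpha^2=\varepsilon/G_{\bar\delta}(\Gamma,q^{-1})$. (The choice $\beta=\varepsilon/\alpha$ results in positive quantum dimensions.) **The category $\mathcal{C}=\mathcal{C}_1\oplus\mathcal{C}_g$** (with $G=\langle g\rangle\cong\mathbb{Z}_2$). It is semisimple, with simple objects $\mathbb{C}_a$ ($a\in\Gamma$) in $\mathcal{C}_1$ and $\mathsf{X}^{\bar x}$ ($\bar x\in\Gamma/2\Gamma$) in $\mathcal{C}_g$. Tensor product: $\mathbb{C}_a\otimes\mathbb{C}_b=\mathbb{C}_{a+b}$, $\mathbb{C}_a\otimes\mathsf{X}^{\bar x}=\mathsf{X}^{\bar a+\bar x}=\mathsf{X}^{\bar x}\otimes\mathbb{C}_a$, $\mathsf{X}^{\bar x}\otimes\mathsf{X}^{\bar y}=\bigoplus_{t\in\bar\delta+\bar x+\bar y}\mathbb{C}_t$. Associator $(A\otimes B)\otimes C\to A\otimes(B\otimes C)$ (with $e_t$ the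 basis vector of the summand $\mathbb{C}_t$ of a product of two $\mathsf{X}$'s): - $(\mathbb{C}_a,\mathbb{C}_b,\mathbb{C}_c)$: $\omega(a,b,c)$; - $(\mathsf{X}^{\bar x},\mathbb{C}_a,\mathbb{C}_b)$: $\omega(\bar x+\bar\delta,a,b)$; - $(\mathbb{C}_a,\mathsf{X}^{\bar x},\mathbb{C}_b)$: $\sigma(a,b)$; - $(\mathbb{C}_a,\mathbb{C}_b,\mathsf{X}^{\bar x})$: $\omega(\bar a+\bar b+\bar x,a,b)$; - $(\mathbb{C}_a,\mathsf{X}^{\bar x},\mathsf{X}^{\bar y})$: $e_{a+t}\mapsto\omega(\bar a+\bar x,a,t)\,e_a\otimes e_t$; - $(\mathsf{X}^{\bar x},\mathsf{X}^{\bar y},\mathbb{C}_a)$: $e_t\otimes e_a\mapsto\omega(\bar x,t,a)\,e_{t+a}$; - $(\mathsf{X}^{\bar x},\mathbb{C}_a,\mathsf{X}^{\bar y})$: $e_t\mapsto\sigma(a,t)\,e_t$; - $(\mathsf{X}^{\bar x},\mathsf{X}^{\bar y},\mathsf{X}^{\bar z})$: the map $\bigoplus_{t\in\bar\delta+\bar x+\bar y}\mathsf{X}^{\bar t+\bar z}\to\bigoplus_{r\in\bar\delta+\bar y+\bar z}\mathsf{X}^{\bar x+\bar r}$ whose component from the $t$-summand to the $r$-summand is $\varepsilon|2\Gamma|^{-1/2}\sigma(t,r)^{-1}$. $\mathbb{Z}_2$-action: $g_*\mathbb{C}_a=\mathbb{C}_{-a}$, $g_*\mathsf{X}^{\bar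 x}=\mathsf{X}^{\bar x}$, strict composition ($g_*g_*=\mathrm{id}$), tensor structure $\tau^g\colon g_*(A\otimes B)\to g_*A\otimes g_*B$: $\omega(a,b,-b)$ on $(\mathbb{C}_a,\mathbb{C}_b)$; $\omega(\bar a+\bar x,a,-a)$ on $(\mathbb{C}_a,\mathsf{X}^{\bar x})$; $\omega(\bar x+\bar\delta,a,-a)$ on $(\mathsf{X}^{\bar x},\mathbb{C}_a)$; $\omega(\bar x,t,-t)$ on the summand $t$ of $(\mathsf{X}^{\bar x},\mathsf{X}^{\bar y})$. $\mathbb{Z}_2$-braiding $c_{A,B}\colon A\otimes B\to h_*(B)\otimes A$ for $A\in\mathcal{C}_h$: $\sigma(a,b)$ on $\mathbb{C}_a\otimes\mathbb{C}_b$; $q(a)^{-1}$ on $\mathbb{C}_a\otimes\mathsf{X}^{\bar x}$; $q(a)^{-1}\omega(\bar x+\bar a,a,-a)$ on $\mathsf{X}^{\bar x}\otimes\mathbb{C}_a\to\mathbb{C}_{-a}\otimes\mathsf{X}^{\bar x}$; $\alpha q(t)$ on the summand $\mathbb{C}_t$ of $\mathsf{X}^{\bar x}\otimes\mathsf{X}^{\bar y}\to\mathsf{X}^{\bar y}\otimes\mathsf{X}^{\bar x}$. $\mathbb{Z}_2$-ribbon twist $\theta_A\colon A\to h_*A$ for $A\in\mathcal{C}_h$: $\theta_{\mathbb{C}_a}=\sigma(a,a)$, $\theta_{\mathsf{X}^{\bar x}}=\beta$. These data define a braided $\mathbb{Z}_2$-crossed fusion category with a $\mathbb{Z}_2$-ribbon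 structure (this may be taken as given). **Equivariantisation.** Objects of $\mathcal{C}/\!/\mathbb{Z}_2$ are pairs $(X,\varphi)$ with $X\in\mathcal{C}$ and an isomorphism $\varphi_g\colon g_*X\to X$ with $\varphi_g\circ g_*(\varphi_g)=\mathrm{id}_X$ (and $\varphi_1=\mathrm{id}$); morphisms are those commuting with the $\varphi_g$; $(X,\varphi)\otimes(Y,\varphi')=(X\otimes Y,(\varphi_g\otimes\varphi'_g)\circ\tau^g_{X,Y})$. Its braiding is, on the component $X_h\in\mathcal{C}_h$ of $X$, $(\varphi'_h\otimes\mathrm{id})\circ c_{X_h,Y}$, and its ribbon twist on $(X,\varphi)$ is $\bigoplus_h\varphi_h\circ\theta_{X_h}$. It is a modular tensor category. **Simple objects.** $X_{a,s}=\mathbb{C}_a$ with $\varphi_g=s\,\mathrm{id}$ ($a\in\Gamma_2$, $s\in\{\pm1\}$); $Y_{\{b,-b\}}=\mathbb{C}_b\oplus\mathbb{C}_{-b}$ with $\varphi_g$ interchanging the summands ($b\in\Gamma\setminus\Gamma_2$); $Z_{\bar x,r}=\mathsf{X}^{\bar x}$ with $\varphi_g=r\,\mathrm{id}$ ($\bar x\in\Gamma/2\Gamma$, $r\in\{\pm1\}$). **Modular data.** For a ribbon fusion category with braiding $c$ and twist $\theta$: $\mathcal{S}_{X,Y}=\mathrm{tr}(c_{Y,X}\circ c_{X,Y})$ and $\mathcal{T}_{X,Y}=\delta_{X,Y}\theta_X^{-1}$ for simple $X,Y$. The matrix $\mathcal{S}$ is symmetric, so the remaining entries follow.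
   Formalization: The entry S_{X_{a,s},Z_{x,r}} is stated as printed for β=ε/α and with the opposite sign for β=−ε/α, where the printed formula fails (e.g. Γ=0, ε=α=1, β=−1 gives dim Z=−1). *)

theory Defs
  imports Complex_Main
begin

declare [[typedef_overloaded]]

text \<open>A finite abelian group \<open>\<Gamma>\<close> is a type of class \<open>{finite, ab_group_add}\<close>. The type
  \<open>'a mod2\<close> is the quotient \<open>\<Gamma>/2\<Gamma>\<close>, with projection \<open>cls\<close>.\<close>

definition mod2_rel :: "'a::ab_group_add \<Rightarrow> 'a \<Rightarrow> bool" where
  "mod2_rel a b \<longleftrightarrow> (\<exists>c. a - b = c + c)"

lemma equivp_mod2_rel: "equivp (mod2_rel :: 'a::ab_group_add \<Rightarrow> 'a \<Rightarrow> bool)"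
proof (rule equivpI)
  show "reflp (mod2_rel :: 'a \<Rightarrow> 'a \<Rightarrow> bool)"
    by (rule reflpI) (auto simp: mod2_rel_def intro: exI[of _ 0])
  show "symp (mod2_rel :: 'a \<Rightarrow> 'a \<Rightarrow> bool)"
  proof (rule sympI)
    fix a b :: 'a
    assume "mod2_rel a b"
    then obtain c where "a - b = c + c" by (auto simp: mod2_rel_def)
    then have "b - a = (-c) + (-c)" by (metis minus_add_distrib minus_diff_eq)
    then show "mod2_rel b a" unfolding mod2_rel_def by blast
  qed
  show "transp (mod2_rel :: 'a \<Rightarrow> 'a \<Rightarrow> bool)"
  proof (rule transpI)
    fix a b c :: 'a
    assume "mod2_rel a b" "mod2_rel b c"
    then obtain u v where "a - b = u + u" "b - c = v + v" by (auto simp: mod2_rel_def)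
    then have "(a - b) + (b - c) = (u + v) + (u + v)"
      by (simp only: ac_simps)
    then have "a - c = (u + v) + (u + v)"
      by simp
    then show "mod2_rel a c" unfolding mod2_rel_def by blast
  qed
qed

quotient_type 'a mod2 = "'a::ab_group_add" / mod2_rel
  by (rule equivp_mod2_rel)

lift_definition cls :: "'a::ab_group_add \<Rightarrow> 'a mod2" is "\<lambda>a. a" .

instantiation mod2 :: (ab_group_add) ab_group_add
begin

lift_definition zero_mod2 :: "'a mod2" is "0" .

lift_definition plus_mod2 :: "'a mod2 \<Rightarrow> 'a mod2 \<Rightarrow> 'a mod2" is "(+)"
proof -
  fix a b c d :: 'a
  assume "mod2_rel a b" "mod2_rel c d"
  then obtain u v where "a - b = u + u" "c - d = v + v" by (auto simp: mod2_rel_def)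
  then have "(a + c) - (b + d) = (u + v) + (u + v)"
    by (simp add: add_diff_add add.assoc add.left_commute)
  then show "mod2_rel (a + c) (b + d)" unfolding mod2_rel_def by blast
qed

lift_definition uminus_mod2 :: "'a mod2 \<Rightarrow> 'a mod2" is "uminus"
proof -
  fix a b :: 'a
  assume "mod2_rel a b"
  then obtain u where "a - b = u + u" by (auto simp: mod2_rel_def)
  then have "(- a) - (- b) = (- u) + (- u)"
    by (metis minus_add_distrib minus_diff_eq minus_diff_minus)
  then show "mod2_rel (- a) (- b)" unfolding mod2_rel_def by blast
qed

definition minus_mod2 :: "'a mod2 \<Rightarrow> 'a mod2 \<Rightarrow> 'a mod2" where
  "minus_mod2 x y = x + (- y)"

instance
proof
  fix a b c :: "'a mod2"
  show "a + b + c = a + (b + c)"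
    by transfer (simp add: add.assoc equivp_reflp[OF equivp_mod2_rel])
  show "a + b = b + a"
    by transfer (simp add: add.commute equivp_reflp[OF equivp_mod2_rel])
  show "0 + a = a"
    by transfer (simp add: equivp_reflp[OF equivp_mod2_rel])
  show "- a + a = 0"
    by transfer (simp add: equivp_reflp[OF equivp_mod2_rel])
  show "a - b = a + - b"
    by (simp add: minus_mod2_def)
qed

end

text \<open>A representative; only used where the value is independent of the choice.\<close>

definition rep :: "'a::ab_group_add mod2 \<Rightarrow> 'a" where
  "rep x = (SOME a. cls a = x)"


section \<open>Input data\<close>

record 'a crossed_data =
  Qf  :: "'a \<Rightarrow> complex"                    \<comment> \<open>\<open>Q\<close>\<close>
  sgf :: "'a \<Rightarrow> 'a \<Rightarrow> complex"              \<comment> \<open>\<open>\<sigma>\<close>\<close>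
  omf :: "'a \<Rightarrow> 'a \<Rightarrow> 'a \<Rightarrow> complex"        \<comment> \<open>\<open>\<omega>\<close>\<close>
  dlt :: "'a mod2"                            \<comment> \<open>\<open>\<delta>\<close>\<close>
  qf  :: "'a \<Rightarrow> complex"                    \<comment> \<open>\<open>q\<close>\<close>
  eps :: complex
  alp :: complex
  bet :: complex

definition zmult :: "int \<Rightarrow> 'a::ab_group_add \<Rightarrow> 'a" where
  "zmult n a = (if 0 \<le> n then ((+) a ^^ nat n) 0 else - (((+) a ^^ nat (- n)) 0))"

definition bilin :: "('a::ab_group_add \<Rightarrow> complex) \<Rightarrow> 'a \<Rightarrow> 'a \<Rightarrow> complex" where
  "bilin Q a b = Q (a + b) * inverse (Q a) * inverse (Q b)"

definition discriminant_form :: "('a::ab_group_add \<Rightarrow> complex) \<Rightarrow> bool" where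
  "discriminant_form Q \<longleftrightarrow>
     (\<forall>a. Q a \<noteq> 0) \<and>
     (\<forall>n a. Q (zmult n a) = Q a ^ nat (n ^ 2)) \<and>
     (\<forall>a b c. bilin Q (a + b) c = bilin Q a c * bilin Q b c) \<and>
     (\<forall>a b c. bilin Q a (b + c) = bilin Q a b * bilin Q a c) \<and>
     (\<forall>a. (\<forall>b. bilin Q a b = 1) \<longrightarrow> a = 0)"

text \<open>\<open>\<omega>\<close> with first argument in \<open>\<Gamma>/2\<Gamma>\<close>, and \<open>B\<^sub>Q(x, a)\<close> for \<open>x \<in> \<Gamma>/2\<Gamma>\<close>, \<open>2a = 0\<close>.\<close>

definition omb :: "'a::ab_group_add crossed_data \<Rightarrow> 'a mod2 \<Rightarrow> 'a \<Rightarrow> 'a \<Rightarrow> complex" where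
  "omb D x b c = omf D (rep x) b c"

definition bilin2 :: "('a::ab_group_add \<Rightarrow> complex) \<Rightarrow> 'a mod2 \<Rightarrow> 'a \<Rightarrow> complex" where
  "bilin2 Q x a = bilin Q (rep x) a"

text \<open>\<open>|2\<Gamma>|\<^sup>1\<^sup>/\<^sup>2\<close>\<close>

definition root2 :: "'a::ab_group_add itself \<Rightarrow> complex" where
  "root2 _ = complex_of_real (sqrt (real (card (range (\<lambda>a::'a. a + a)))))"

definition gauss :: "'a::{finite,ab_group_add} mod2 \<Rightarrow> ('a \<Rightarrow> complex) \<Rightarrow> complex" where
  "gauss z f = inverse (root2 TYPE('a)) * (\<Sum>a | cls a = z. f a)"

definition is_crossed_data :: "'a::{finite,ab_group_add} crossed_data \<Rightarrow> bool" where
  "is_crossed_data D \<longleftrightarrow>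
     discriminant_form (Qf D) \<and>
     (\<forall>a b. sgf D a b \<noteq> 0) \<and>
     (\<forall>a b c. omf D a b c \<in> {1, -1}) \<and>
     (\<forall>a. sgf D a a = Qf D a) \<and>
     (\<forall>a. sgf D a 0 = 1 \<and> sgf D 0 a = 1) \<and>
     (\<forall>a b. sgf D a b = sgf D b a) \<and>
     (\<forall>a b c. omf D a b c = sgf D a (b + c) * inverse (sgf D a b) * inverse (sgf D a c)) \<and>
     (\<forall>a a' b c. omf D (a + a') b c = omf D a b c * omf D a' b c) \<and>
     (\<forall>a. qf D a \<noteq> 0) \<and>
     (\<forall>a. qf D a ^ 2 = Qf D a) \<and>
     (\<forall>a b. qf D (a + b) * inverse (qf D a) * inverse (qf D b)
            = sgf D a b * omf D (a + b) a b * omb D (dlt D) a b) \<and>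
     eps D \<in> {1, -1} \<and>
     alp D ^ 2 = eps D * gauss (dlt D) (\<lambda>a. inverse (qf D a)) \<and>
     (bet D = inverse (alp D) \<or> bet D = - inverse (alp D))"


section \<open>The category C: objects, morphisms\<close>

datatype 'a simple = Cs (grp: 'a) | Xs "'a mod2"

datatype z2 = Z2_one | Z2_gen

fun grade :: "'a::ab_group_add simple \<Rightarrow> z2" where
  "grade (Cs a) = Z2_one"
| "grade (Xs x) = Z2_gen"

text \<open>An object is a finite direct sum of simple objects, i.e. a finite set of labels, each carrying
  a simple object (a finite map from labels to simple objects). The label \<open>Node i j t\<close> stands for
  the summand \<open>t\<close> of the product of the summands labelled \<open>i\<close> and \<open>j\<close>; all
  products of simple objects are multiplicity free.
  Since the simple objects have endomorphism ring \<open>\<complex>\<close>, a morphism is a matrix, whose entry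
  \<open>mat f j i\<close> is the component from summand \<open>i\<close> to summand \<open>j\<close>; it vanishes
  unless these summands are the same simple object.\<close>

datatype 'a lab = Leaf "'a simple" | Node "'a lab" "'a lab" "'a simple"

type_synonym 'a obj = "'a lab \<Rightarrow> 'a simple option"

datatype 'a mor = Mor (src: "'a obj") (tgt: "'a obj") (mat: "'a lab \<Rightarrow> 'a lab \<Rightarrow> complex")

definition hom :: "'a::ab_group_add obj \<Rightarrow> 'a obj \<Rightarrow> 'a mor set" where
  "hom A B = {f. src f = A \<and> tgt f = B \<and>
                 (\<forall>i j. mat f j i \<noteq> 0 \<longrightarrow> i \<in> dom A \<and> B j = A i)}"

definition morph ::
  "'a::ab_group_add obj \<Rightarrow> 'a obj \<Rightarrow> ('a lab \<Rightarrow> 'a lab \<Rightarrow> complex) \<Rightarrow> 'a mor" where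
  "morph A B h = Mor A B (\<lambda>j i. if i \<in> dom A \<and> B j = A i then h j i else 0)"

definition idm :: "'a::ab_group_add obj \<Rightarrow> 'a mor" where
  "idm A = morph A A (\<lambda>j i. if j = i then 1 else 0)"

definition comp :: "'a::ab_group_add mor \<Rightarrow> 'a mor \<Rightarrow> 'a mor"  (infixr "\<cdot>" 70) where
  "g \<cdot> f = Mor (src f) (tgt g) (\<lambda>k i. \<Sum>j\<in>dom (tgt f). mat g k j * mat f j i)"

definition madd :: "'a::ab_group_add mor \<Rightarrow> 'a mor \<Rightarrow> 'a mor" where
  "madd f g = Mor (src f) (tgt f) (\<lambda>j i. mat f j i + mat g j i)"

definition mscale :: "complex \<Rightarrow> 'a::ab_group_add mor \<Rightarrow> 'a mor" where
  "mscale z f = Mor (src f) (tgt f) (\<lambda>j i. z * mat f j i)"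

definition minv :: "'a::ab_group_add mor \<Rightarrow> 'a mor" where
  "minv f = (THE h. h \<in> hom (tgt f) (src f) \<and> h \<cdot> f = idm (src f) \<and> f \<cdot> h = idm (tgt f))"

definition osum :: "'a::ab_group_add simple set \<Rightarrow> 'a obj" where
  "osum S = (\<lambda>l. case l of Leaf c \<Rightarrow> if c \<in> S then Some c else None | Node _ _ _ \<Rightarrow> None)"

definition part :: "z2 \<Rightarrow> 'a::ab_group_add obj \<Rightarrow> 'a obj" where
  "part h A = (\<lambda>i. case A i of None \<Rightarrow> None | Some c \<Rightarrow> if grade c = h then Some c else None)"

definition proj :: "z2 \<Rightarrow> 'a::ab_group_add obj \<Rightarrow> 'a mor" where
  "proj h A = morph A (part h A) (\<lambda>j i. if j = i then 1 else 0)"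

definition incl :: "z2 \<Rightarrow> 'a::ab_group_add obj \<Rightarrow> 'a mor" where
  "incl h A = morph (part h A) A (\<lambda>j i. if j = i then 1 else 0)"


section \<open>Tensor product and associator\<close>

fun fuse :: "'a::ab_group_add crossed_data \<Rightarrow> 'a simple \<Rightarrow> 'a simple \<Rightarrow> 'a simple set" where
  "fuse D (Cs a) (Cs b) = {Cs (a + b)}"
| "fuse D (Cs a) (Xs x) = {Xs (cls a + x)}"
| "fuse D (Xs x) (Cs a) = {Xs (cls a + x)}"
| "fuse D (Xs x) (Xs y) = {Cs t | t. cls t = dlt D + x + y}"

definition otens ::
  "'a::ab_group_add obj \<Rightarrow> 'a crossed_data \<Rightarrow> 'a obj \<Rightarrow> 'a obj"
  ("_ \<boxtimes>\<^bsub>_\<^esub> _" [76, 0, 75] 75) where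
  "A \<boxtimes>\<^bsub>D\<^esub> B = (\<lambda>l. case l of
       Leaf _ \<Rightarrow> None
     | Node i j t \<Rightarrow> (case (A i, B j) of
           (Some a, Some b) \<Rightarrow> if t \<in> fuse D a b then Some t else None
         | _ \<Rightarrow> None))"

definition mtens ::
  "'a::ab_group_add mor \<Rightarrow> 'a crossed_data \<Rightarrow> 'a mor \<Rightarrow> 'a mor"
  ("_ \<otimes>\<^bsub>_\<^esub> _" [76, 0, 75] 75) where
  "f \<otimes>\<^bsub>D\<^esub> g = morph (src f \<boxtimes>\<^bsub>D\<^esub> src g) (tgt f \<boxtimes>\<^bsub>D\<^esub> tgt g)
     (\<lambda>l' l. case (l', l) of
        (Node i' j' t', Node i j t) \<Rightarrow> mat f i' i * mat g j' j
      | _ \<Rightarrow> 0)"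

definition unit_obj :: "'a::ab_group_add obj" where
  "unit_obj = osum {Cs 0}"

definition lunit :: "'a::ab_group_add crossed_data \<Rightarrow> 'a obj \<Rightarrow> 'a mor" where
  "lunit D A = morph (unit_obj \<boxtimes>\<^bsub>D\<^esub> A) A
     (\<lambda>l' l. case l of Node i j t \<Rightarrow> if l' = j then 1 else 0 | _ \<Rightarrow> 0)"

definition runit :: "'a::ab_group_add crossed_data \<Rightarrow> 'a obj \<Rightarrow> 'a mor" where
  "runit D A = morph (A \<boxtimes>\<^bsub>D\<^esub> unit_obj) A
     (\<lambda>l' l. case l of Node i j t \<Rightarrow> if l' = i then 1 else 0 | _ \<Rightarrow> 0)"

text \<open>\<open>assoc_coeff D A B C t r u\<close> is the component of the associator of simple objects
  from \<open>u \<subseteq> t \<otimes> C\<close>, \<open>t \<subseteq> A \<otimes> B\<close>, to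
  \<open>u \<subseteq> A \<otimes> r\<close>, \<open>r \<subseteq> B \<otimes> C\<close>.
  Wherever \<open>grp\<close> is applied below, its argument is of the form \<open>Cs a\<close>.\<close>

fun assoc_coeff :: "'a::ab_group_add crossed_data \<Rightarrow>
    'a simple \<Rightarrow> 'a simple \<Rightarrow> 'a simple \<Rightarrow> 'a simple \<Rightarrow> 'a simple \<Rightarrow> 'a simple \<Rightarrow> complex" where
  "assoc_coeff D (Cs a) (Cs b) (Cs c) t r u = omf D a b c"
| "assoc_coeff D (Xs x) (Cs a) (Cs b) t r u = omb D (x + dlt D) a b"
| "assoc_coeff D (Cs a) (Xs x) (Cs b) t r u = sgf D a b"
| "assoc_coeff D (Cs a) (Cs b) (Xs x) t r u = omb D (cls a + cls b + x) a b"
| "assoc_coeff D (Cs a) (Xs x) (Xs y) t r u = omb D (cls a + x) a (grp r)"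
| "assoc_coeff D (Xs x) (Xs y) (Cs a) t r u = omb D x (grp t) a"
| "assoc_coeff D (Xs x) (Cs a) (Xs y) t r u = sgf D a (grp u)"
| "assoc_coeff D (Xs x) (Xs y) (Xs z) t r u =
     eps D * inverse (root2 TYPE('a)) * inverse (sgf D (grp t) (grp r))"

definition assoc :: "'a::ab_group_add crossed_data \<Rightarrow>
    'a obj \<Rightarrow> 'a obj \<Rightarrow> 'a obj \<Rightarrow> 'a mor" where
  "assoc D A B C = morph ((A \<boxtimes>\<^bsub>D\<^esub> B) \<boxtimes>\<^bsub>D\<^esub> C) (A \<boxtimes>\<^bsub>D\<^esub> (B \<boxtimes>\<^bsub>D\<^esub> C))
     (\<lambda>l' l. case (l', l) of
        (Node i' (Node j' k' r) u', Node (Node i j t) k u) \<Rightarrow>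
           if i' = i \<and> j' = j \<and> k' = k
           then assoc_coeff D (the (A i)) (the (B j)) (the (C k)) t r u else 0
      | _ \<Rightarrow> 0)"


section \<open>Action, crossed braiding and twist\<close>

fun gsim :: "'a::ab_group_add simple \<Rightarrow> 'a simple" where
  "gsim (Cs a) = Cs (- a)"
| "gsim (Xs x) = Xs x"

definition gobj :: "'a::ab_group_add obj \<Rightarrow> 'a obj" where
  "gobj A = (\<lambda>i. map_option gsim (A i))"

definition gmor :: "'a::ab_group_add mor \<Rightarrow> 'a mor" where
  "gmor f = Mor (gobj (src f)) (gobj (tgt f)) (mat f)"

fun hobj :: "z2 \<Rightarrow> 'a::ab_group_add obj \<Rightarrow> 'a obj" where
  "hobj Z2_one A = A"
| "hobj Z2_gen A = gobj A"

fun hmor :: "z2 \<Rightarrow> 'a::ab_group_add mor \<Rightarrow> 'a mor" where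
  "hmor Z2_one f = f"
| "hmor Z2_gen f = gmor f"

fun tau_coeff :: "'a::ab_group_add crossed_data \<Rightarrow>
    'a simple \<Rightarrow> 'a simple \<Rightarrow> 'a simple \<Rightarrow> complex" where
  "tau_coeff D (Cs a) (Cs b) _ = omf D a b (- b)"
| "tau_coeff D (Cs a) (Xs x) _ = omb D (cls a + x) a (- a)"
| "tau_coeff D (Xs x) (Cs a) _ = omb D (x + dlt D) a (- a)"
| "tau_coeff D (Xs x) (Xs y) t = omb D x (grp t) (- grp t)"

text \<open>The summand \<open>g\<^sub>*t\<close> of the source has label \<open>Node i j t\<close>, whereas it
  has label \<open>Node i j (g\<^sub>*t)\<close> in the target; \<open>morph\<close> keeps only these entries.\<close>

definition tau :: "'a::ab_group_add crossed_data \<Rightarrow> 'a obj \<Rightarrow> 'a obj \<Rightarrow> 'a mor" where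
  "tau D A B = morph (gobj (A \<boxtimes>\<^bsub>D\<^esub> B)) (gobj A \<boxtimes>\<^bsub>D\<^esub> gobj B)
     (\<lambda>l' l. case (l', l) of
        (Node i' j' t', Node i j t) \<Rightarrow>
           if i' = i \<and> j' = j then tau_coeff D (the (A i)) (the (B j)) t else 0
      | _ \<Rightarrow> 0)"

fun braid_coeff :: "'a::ab_group_add crossed_data \<Rightarrow>
    'a simple \<Rightarrow> 'a simple \<Rightarrow> 'a simple \<Rightarrow> complex" where
  "braid_coeff D (Cs a) (Cs b) _ = sgf D a b"
| "braid_coeff D (Cs a) (Xs x) _ = inverse (qf D a)"
| "braid_coeff D (Xs x) (Cs a) _ = inverse (qf D a) * omb D (x + cls a) a (- a)"
| "braid_coeff D (Xs x) (Xs y) t = alp D * qf D (grp t)"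

text \<open>\<open>A \<otimes> B \<rightarrow> h\<^sub>*B \<otimes> A\<close> for \<open>A\<close> in the component of degree \<open>h\<close>\<close>

definition braid :: "'a::ab_group_add crossed_data \<Rightarrow>
    z2 \<Rightarrow> 'a obj \<Rightarrow> 'a obj \<Rightarrow> 'a mor" where
  "braid D h A B = morph (A \<boxtimes>\<^bsub>D\<^esub> B) (hobj h B \<boxtimes>\<^bsub>D\<^esub> A)
     (\<lambda>l' l. case (l', l) of
        (Node j' i' t', Node i j t) \<Rightarrow>
           if i' = i \<and> j' = j then braid_coeff D (the (A i)) (the (B j)) t else 0
      | _ \<Rightarrow> 0)"

fun twist_coeff :: "'a::ab_group_add crossed_data \<Rightarrow> 'a simple \<Rightarrow> complex" where
  "twist_coeff D (Cs a) = sgf D a a"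
| "twist_coeff D (Xs x) = bet D"

text \<open>\<open>A \<rightarrow> h\<^sub>*A\<close> for \<open>A\<close> in the component of degree \<open>h\<close>\<close>

definition twist :: "'a::ab_group_add crossed_data \<Rightarrow> z2 \<Rightarrow> 'a obj \<Rightarrow> 'a mor" where
  "twist D h A = morph A (hobj h A) (\<lambda>j i. if j = i then twist_coeff D (the (A i)) else 0)"


section \<open>Equivariantisation\<close>

datatype 'a eobj = EObj (und: "'a obj") (phi: "'a mor")

definition is_eobj :: "'a::ab_group_add eobj \<Rightarrow> bool" where
  "is_eobj U \<longleftrightarrow> finite (dom (und U)) \<and> phi U \<in> hom (gobj (und U)) (und U) \<and>
     phi U \<cdot> gmor (phi U) = idm (und U)"

fun phi_at :: "z2 \<Rightarrow> 'a::ab_group_add eobj \<Rightarrow> 'a mor" where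
  "phi_at Z2_one U = idm (und U)"
| "phi_at Z2_gen U = phi U"

definition ehom :: "'a::ab_group_add eobj \<Rightarrow> 'a eobj \<Rightarrow> 'a mor set" where
  "ehom U V = {f \<in> hom (und U) (und V). f \<cdot> phi U = phi V \<cdot> gmor f}"

definition eiso :: "'a::ab_group_add eobj \<Rightarrow> 'a eobj \<Rightarrow> bool" where
  "eiso U V \<longleftrightarrow> (\<exists>f\<in>ehom U V. \<exists>h\<in>ehom V U. h \<cdot> f = idm (und U) \<and> f \<cdot> h = idm (und V))"

definition etens :: "'a::ab_group_add crossed_data \<Rightarrow> 'a eobj \<Rightarrow> 'a eobj \<Rightarrow> 'a eobj" where
  "etens D U V = EObj (und U \<boxtimes>\<^bsub>D\<^esub> und V) ((phi U \<otimes>\<^bsub>D\<^esub> phi V) \<cdot> tau D (und U) (und V))"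

definition eunit :: "'a::ab_group_add eobj" where
  "eunit = EObj unit_obj (morph (gobj unit_obj) unit_obj (\<lambda>j i. if j = i then 1 else 0))"

definition ebraid :: "'a::ab_group_add crossed_data \<Rightarrow> 'a eobj \<Rightarrow> 'a eobj \<Rightarrow> 'a mor" where
  "ebraid D U V =
     (let c = \<lambda>h. (idm (und V) \<otimes>\<^bsub>D\<^esub> incl h (und U)) \<cdot>
                  (phi_at h V \<otimes>\<^bsub>D\<^esub> idm (part h (und U))) \<cdot>
                  braid D h (part h (und U)) (und V) \<cdot>
                  (proj h (und U) \<otimes>\<^bsub>D\<^esub> idm (und V))
      in madd (c Z2_one) (c Z2_gen))"

definition etwist :: "'a::ab_group_add crossed_data \<Rightarrow> 'a eobj \<Rightarrow> 'a mor" where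
  "etwist D U =
     (let th = \<lambda>h. phi_at h U \<cdot> hmor h (incl h (und U)) \<cdot>
                   twist D h (part h (und U)) \<cdot> proj h (und U)
      in madd (th Z2_one) (th Z2_gen))"

text \<open>\<open>W\<close> is a left dual of \<open>U\<close> with evaluation \<open>ev: W \<otimes> U \<rightarrow> 1\<close> and
  coevaluation \<open>coev: 1 \<rightarrow> U \<otimes> W\<close>. Associators and unitors of the equivariantisation are
  those of the underlying category.\<close>

definition is_dual :: "'a::ab_group_add crossed_data \<Rightarrow>
    'a eobj \<Rightarrow> 'a eobj \<Rightarrow> 'a mor \<Rightarrow> 'a mor \<Rightarrow> bool" where
  "is_dual D U W ev coev \<longleftrightarrow>
     is_eobj W \<and> ev \<in> ehom (etens D W U) eunit \<and> coev \<in> ehom eunit (etens D U W) \<and>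
     runit D (und U) \<cdot> (idm (und U) \<otimes>\<^bsub>D\<^esub> ev) \<cdot> assoc D (und U) (und W) (und U) \<cdot>
       (coev \<otimes>\<^bsub>D\<^esub> idm (und U)) = lunit D (und U) \<and>
     lunit D (und W) \<cdot> (ev \<otimes>\<^bsub>D\<^esub> idm (und W)) \<cdot> minv (assoc D (und W) (und U) (und W)) \<cdot>
       (idm (und W) \<otimes>\<^bsub>D\<^esub> coev) = runit D (und W)"

text \<open>The ribbon trace of an endomorphism \<open>f\<close> of \<open>U\<close>: the scalar
  \<open>ev \<circ> c\<^bsub>U,W\<^esub> \<circ> ((\<theta>\<^bsub>U\<^esub> \<circ> f) \<otimes> id) \<circ> coev\<close>, which does not depend on the chosen
  dual \<open>W\<close>.\<close>

definition rtrace :: "'a::ab_group_add crossed_data \<Rightarrow> 'a eobj \<Rightarrow> 'a mor \<Rightarrow> complex" where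
  "rtrace D U f = (THE z. \<exists>W ev coev. is_dual D U W ev coev \<and>
     ev \<cdot> ebraid D U W \<cdot> ((etwist D U \<cdot> f) \<otimes>\<^bsub>D\<^esub> idm (und W)) \<cdot> coev
       = mscale z (idm unit_obj))"


section \<open>Simple objects and modular data\<close>

text \<open>In \<open>Xobj\<close> and \<open>Zobj\<close> the source and target of \<open>\<phi>\<^sub>g\<close> agree (for \<open>Xobj a s\<close>
  because \<open>2a = 0\<close>). In \<open>Yobj b\<close> the object \<open>g\<^sub>*(\<complex>\<^sub>b \<oplus> \<complex>\<^sub>-\<^sub>b)\<close> has the same labels as
  \<open>\<complex>\<^sub>b \<oplus> \<complex>\<^sub>-\<^sub>b\<close> with the two simple objects exchanged, so the interchange is the
  matrix that is 1 wherever \<open>morph\<close> allows it; moreover \<open>Yobj b = Yobj (-b)\<close>.\<close>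

definition Xobj :: "'a::ab_group_add \<Rightarrow> complex \<Rightarrow> 'a eobj" where
  "Xobj a s = EObj (osum {Cs a})
     (morph (gobj (osum {Cs a})) (osum {Cs a}) (\<lambda>j i. if j = i then s else 0))"

definition Yobj :: "'a::ab_group_add \<Rightarrow> 'a eobj" where
  "Yobj b = EObj (osum {Cs b, Cs (- b)})
     (morph (gobj (osum {Cs b, Cs (- b)})) (osum {Cs b, Cs (- b)}) (\<lambda>j i. 1))"

definition Zobj :: "'a::ab_group_add mod2 \<Rightarrow> complex \<Rightarrow> 'a eobj" where
  "Zobj x r = EObj (osum {Xs x})
     (morph (gobj (osum {Xs x})) (osum {Xs x}) (\<lambda>j i. if j = i then r else 0))"

definition simple_eobjs :: "'a::ab_group_add eobj set" where
  "simple_eobjs = {Xobj a s | a s. a + a = 0 \<and> s \<in> {1, -1}} \<union>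
                  {Yobj b | b. b + b \<noteq> 0} \<union>
                  {Zobj x r | x r. r \<in> {1, -1}}"

definition twist_scalar :: "'a::ab_group_add crossed_data \<Rightarrow> 'a eobj \<Rightarrow> complex" where
  "twist_scalar D U = (THE z. etwist D U = mscale z (idm (und U)))"

definition T_entry :: "'a::ab_group_add crossed_data \<Rightarrow> 'a eobj \<Rightarrow> 'a eobj \<Rightarrow> complex" where
  "T_entry D U V = (if eiso U V then inverse (twist_scalar D U) else 0)"

text \<open>\<open>rtrace\<close> uses the twist, so the trace of the identity of \<open>Zobj x r\<close> is
  \<open>\<epsilon>\<alpha>\<beta>|2\<Gamma>|\<^sup>1\<^sup>/\<^sup>2\<close>. It is positive for \<open>\<beta> = \<epsilon>/\<alpha>\<close> and negative for the other choice
  \<open>\<beta> = -\<epsilon>/\<alpha>\<close>; the same sign enters \<open>S_entry D (Xobj a s) (Zobj x r)\<close>.\<close>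

definition S_entry :: "'a::ab_group_add crossed_data \<Rightarrow> 'a eobj \<Rightarrow> 'a eobj \<Rightarrow> complex" where
  "S_entry D U V = rtrace D (etens D U V) (ebraid D V U \<cdot> ebraid D U V)"

end

theory Submission
  imports Defs
begin

text \<open>In the equivariantisation the ribbon trace of an endomorphism \<open>f\<close> is the sum of the diagonal
  entries of \<open>f\<close>, each weighted by \<open>1\<close> in degree \<open>1\<close> and by \<open>\<epsilon>\<alpha>\<beta>|2\<Gamma>|\<^sup>1\<^sup>/\<^sup>2\<close> in degree \<open>g\<close>. For an arbitrary dual
  this follows from a single zigzag identity and the equivariance of the evaluation: the latter moves
  the \<open>\<phi>\<close> of the dual, which enters through the braiding, to the inverse of the \<open>\<phi>\<close> of the object,
  and this cancels the \<open>\<phi>\<close> of the twist. A dual exists on the same labels; inverting its associator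
  amounts to the orthogonality of the characters \<open>B\<^sub>Q(\<cdot>, d)\<close> on a coset of \<open>2\<Gamma>\<close>. The double braiding
  has an explicit diagonal, so the entries of the \<open>S\<close>-matrix become finite sums. Finally \<open>\<alpha> \<noteq> 0\<close>, as
  the Gauss sums of \<open>q\<close> and of its inverse over \<open>\<delta>\<close> have product \<open>1\<close>.\<close>

section \<open>Morphisms as matrices\<close>

text \<open>\<open>rtrace\<close> is a definite description over all duals at once, so its value
  needs one dual for existence and every dual for uniqueness. An arbitrary dual has unknown labels
  and unknown evaluation and coevaluation matrices. What is known is that these matrices are
  supported on unit summands, where the zigzag identity makes them inverse to each other up to an
  associator scalar. The weights come from these unit summands. Braiding with the dual and twisting
  contribute \<open>\<sigma>(a,-a) \<sigma>(a,a)\<close> in degree 1 and \<alpha>\<beta> in degree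
  g; the associator scalar is \<open>\<omega>(a,-a,a)\<close> or
  \<open>\<epsilon> |2\<Gamma>|^(-1/2)\<close>, and the quotients are the two weights. As \<beta> is
  1/\<alpha> up to sign, \<epsilon>\<alpha>\<beta> is a sign as soon as \<alpha> is nonzero; this
  sign separates the two cases for \<beta> in the theorem. One family of character sums over cosets
  of 2\<Gamma> serves both the inverse associator and the product of the Gauss sums.\<close>

lemma mat_morph [simp]:
  "mat (morph A B h) j i = (if i \<in> dom A \<and> B j = A i then h j i else 0)"
  by (simp add: morph_def)

lemma src_morph [simp]: "src (morph A B h) = A"
  and tgt_morph [simp]: "tgt (morph A B h) = B"
  by (simp_all add: morph_def)

lemma src_comp [simp]: "src (g \<cdot> f) = src f"
  and tgt_comp [simp]: "tgt (g \<cdot> f) = tgt g"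
  by (simp_all add: comp_def)

lemma mat_comp: "mat (g \<cdot> f) k i = (\<Sum>j\<in>dom (tgt f). mat g k j * mat f j i)"
  by (simp add: comp_def)

lemma src_mtens [simp]: "src (f \<otimes>\<^bsub>D\<^esub> g) = src f \<boxtimes>\<^bsub>D\<^esub> src g"
  and tgt_mtens [simp]: "tgt (f \<otimes>\<^bsub>D\<^esub> g) = tgt f \<boxtimes>\<^bsub>D\<^esub> tgt g"
  by (simp_all add: mtens_def)

lemma src_idm [simp]: "src (idm A) = A"
  and tgt_idm [simp]: "tgt (idm A) = A"
  and mat_idm [simp]: "mat (idm A) j i = (if i \<in> dom A \<and> j = i then 1 else 0)"
  by (auto simp: idm_def)

lemma src_gmor [simp]: "src (gmor f) = gobj (src f)"
  and tgt_gmor [simp]: "tgt (gmor f) = gobj (tgt f)"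
  and mat_gmor [simp]: "mat (gmor f) = mat f"
  by (simp_all add: gmor_def)

lemma dom_gobj [simp]: "dom (gobj A) = dom A"
  by (auto simp: gobj_def)

lemma mor_eqI:
  "src f = src g \<Longrightarrow> tgt f = tgt g \<Longrightarrow> (\<And>i j. mat f j i = mat g j i) \<Longrightarrow> f = g"
  by (cases f; cases g) (auto simp: fun_eq_iff)

lemma src_hom: "f \<in> hom A B \<Longrightarrow> src f = A"
  and tgt_hom: "f \<in> hom A B \<Longrightarrow> tgt f = B"
  by (auto simp: hom_def)

lemma hom_nonzeroD:
  assumes "f \<in> hom A B" "mat f j i \<noteq> 0"
  obtains a where "A i = Some a" "B j = Some a"
  using assms by (auto simp: hom_def)

text \<open>Entries between different simple objects vanish on both sides, so equality has to be
  tested only between copies of the same simple object.\<close>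

lemma hom_eqI:
  assumes "f \<in> hom A B" "g \<in> hom A B"
    and "\<And>i j a. A i = Some a \<Longrightarrow> B j = Some a \<Longrightarrow> mat f j i = mat g j i"
  shows "f = g"
proof (rule mor_eqI)
  show "src f = src g" "tgt f = tgt g" using assms by (auto simp: hom_def)
  show "mat f j i = mat g j i" for i j
    using assms by (metis hom_nonzeroD)
qed

lemma morph_hom [simp]: "morph A B h \<in> hom A B"
  by (auto simp: hom_def)

lemma idm_hom [simp]: "idm A \<in> hom A A"
  by (auto simp: idm_def)

lemma comp_hom:
  assumes "f \<in> hom A B" "g \<in> hom B C"
  shows "g \<cdot> f \<in> hom A C"
proof -
  have "i \<in> dom A \<and> C k = A i" if "mat (g \<cdot> f) k i \<noteq> 0" for k i
  proof -
    have "\<exists>j. mat g k j * mat f j i \<noteq> 0"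
      using that unfolding mat_comp by (meson sum.neutral)
    then obtain j where "mat g k j \<noteq> 0" "mat f j i \<noteq> 0" by auto
    then show ?thesis using assms by (auto simp: hom_def)
  qed
  then show ?thesis using assms by (auto simp: hom_def)
qed

lemma mtens_hom:
  "f \<in> hom A A' \<Longrightarrow> g \<in> hom B B' \<Longrightarrow> f \<otimes>\<^bsub>D\<^esub> g \<in> hom (A \<boxtimes>\<^bsub>D\<^esub> B) (A' \<boxtimes>\<^bsub>D\<^esub> B')"
  unfolding mtens_def by (metis morph_hom src_hom tgt_hom)

lemma gmor_hom: "f \<in> hom A B \<Longrightarrow> gmor f \<in> hom (gobj A) (gobj B)"
  by (simp add: hom_def, metis gobj_def)

lemma madd_hom: "f \<in> hom A B \<Longrightarrow> g \<in> hom A B \<Longrightarrow> madd f g \<in> hom A B"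
  unfolding hom_def madd_def by (simp, metis add_0)

lemma comp_assoc: "(h \<cdot> g) \<cdot> f = h \<cdot> (g \<cdot> f)"
proof (rule mor_eqI)
  fix i l
  have "mat ((h \<cdot> g) \<cdot> f) l i
      = (\<Sum>j\<in>dom (tgt f). \<Sum>k\<in>dom (tgt g). mat h l k * mat g k j * mat f j i)"
    by (simp add: mat_comp sum_distrib_right)
  also have "\<dots> = (\<Sum>k\<in>dom (tgt g). \<Sum>j\<in>dom (tgt f). mat h l k * mat g k j * mat f j i)"
    by (rule sum.swap)
  also have "\<dots> = mat (h \<cdot> (g \<cdot> f)) l i"
    by (simp add: mat_comp sum_distrib_left mult.assoc)
  finally show "mat ((h \<cdot> g) \<cdot> f) l i = mat (h \<cdot> (g \<cdot> f)) l i" .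
qed simp_all

text \<open>The intermediate labels that matter in a composite depend on few parameters, and
  \<open>p\<close> parametrises them. The image of \<open>p\<close> may contain labels that are no
  summands of \<open>B\<close>: the entries of \<open>f\<close> vanish there, so the sum can be
  extended to them at no cost.\<close>

lemma mat_comp_reindex:
  assumes f: "f \<in> hom A B" and "finite (dom B)" "finite J" "inj_on p J"
    and nz: "\<And>j. mat g k j \<noteq> 0 \<Longrightarrow> mat f j i \<noteq> 0 \<Longrightarrow> j \<in> p ` J"
  shows "mat (g \<cdot> f) k i = (\<Sum>x\<in>J. mat g k (p x) * mat f (p x) i)"
proof -
  have "mat (g \<cdot> f) k i = (\<Sum>j\<in>dom B. mat g k j * mat f j i)"
    using f by (simp add: mat_comp tgt_hom)
  also have "\<dots> = (\<Sum>j\<in>dom B \<union> p ` J. mat g k j * mat f j i)"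
    using assms by (intro sum.mono_neutral_left) (auto simp: hom_def, metis domIff)
  also have "\<dots> = (\<Sum>j\<in>p ` J. mat g k j * mat f j i)"
    using assms by (intro sum.mono_neutral_right) auto
  finally show ?thesis using \<open>inj_on p J\<close> by (simp add: sum.reindex)
qed

lemma mat_comp_single:
  assumes "f \<in> hom A B" "finite (dom B)"
    and "\<And>j. mat g k j \<noteq> 0 \<Longrightarrow> mat f j i \<noteq> 0 \<Longrightarrow> j = j0"
  shows "mat (g \<cdot> f) k i = mat g k j0 * mat f j0 i"
  using mat_comp_reindex[OF assms(1,2), of "{j0}" "\<lambda>x. x" g k i] assms(3) by auto

lemma comp_idm_left:
  assumes "f \<in> hom A B" "finite (dom B)"
  shows "idm B \<cdot> f = f"
proof (rule hom_eqI)
  show "mat (idm B \<cdot> f) j i = mat f j i" if "B j = Some a" for i j a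
    using that by (subst mat_comp_single[OF assms, where ?j0.0 = j]) (auto split: if_splits)
qed (use assms in \<open>auto intro: comp_hom\<close>)

lemma comp_idm_right:
  assumes "f \<in> hom A B" "finite (dom A)"
  shows "f \<cdot> idm A = f"
proof (rule hom_eqI)
  show "mat (f \<cdot> idm A) j i = mat f j i" if "A i = Some a" for i j a
    using that by (subst mat_comp_single[OF idm_hom assms(2), where ?j0.0 = i]) (auto split: if_splits)
  show "f \<cdot> idm A \<in> hom A B" using assms(1) by (rule comp_hom[OF idm_hom])
qed (use assms in auto)

text \<open>The usual uniqueness of two-sided inverses identifies the definite description in
  \<open>minv\<close>. Finiteness enters because a sum over an infinite label set is 0, so that
  identities would not be neutral.\<close>

lemma minv_eqI:
  assumes "f \<in> hom A B" "h \<in> hom B A" "finite (dom A)" "finite (dom B)"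
    and "h \<cdot> f = idm A" "f \<cdot> h = idm B"
  shows "minv f = h"
proof -
  have [simp]: "src f = A" "tgt f = B" using assms(1) by (auto simp: hom_def)
  show ?thesis
    unfolding minv_def
  proof (rule the_equality)
    fix h' assume h': "h' \<in> hom (tgt f) (src f) \<and> h' \<cdot> f = idm (src f) \<and> f \<cdot> h' = idm (tgt f)"
    have "h' = (h \<cdot> f) \<cdot> h'"
      using h' assms comp_idm_left[of h' B A] by simp
    also have "\<dots> = h"
      unfolding comp_assoc using h' assms comp_idm_right[of h B A] by simp
    finally show "h' = h" .
  qed (use assms in auto)
qed

section \<open>Labels and matrices of tensor products\<close>

lemma otens_eq_Some_iff:
  "(A \<boxtimes>\<^bsub>D\<^esub> B) l = Some t \<longleftrightarrow>
     (\<exists>i j a b. l = Node i j t \<and> A i = Some a \<and> B j = Some b \<and> t \<in> fuse D a b)"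
  by (auto simp: otens_def split: lab.splits option.splits)

lemma otens_Node:
  "A i = Some a \<Longrightarrow> B j = Some b \<Longrightarrow>
     (A \<boxtimes>\<^bsub>D\<^esub> B) (Node i j t) = (if t \<in> fuse D a b then Some t else None)"
  by (auto simp: otens_def)

lemma finite_fuse [simp]: "finite (fuse (D :: 'a::{finite,ab_group_add} crossed_data) a b)"
  by (cases a; cases b) auto

lemma dom_otens:
  "dom (A \<boxtimes>\<^bsub>D\<^esub> B) =
     (\<Union>i\<in>dom A. \<Union>j\<in>dom B. Node i j ` fuse D (the (A i)) (the (B j)))"
  unfolding dom_def by (force simp: otens_eq_Some_iff)

lemma finite_dom_otens [simp]:
  fixes D :: "'a::{finite,ab_group_add} crossed_data"
  shows "finite (dom A) \<Longrightarrow> finite (dom B) \<Longrightarrow> finite (dom (A \<boxtimes>\<^bsub>D\<^esub> B))"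
  by (auto simp: dom_otens)

lemma sum_dom_otens:
  fixes D :: "'a::{finite,ab_group_add} crossed_data"
  assumes "finite (dom A)" "finite (dom B)"
  shows "(\<Sum>l\<in>dom (A \<boxtimes>\<^bsub>D\<^esub> B). F l) =
    (\<Sum>i\<in>dom A. \<Sum>j\<in>dom B. \<Sum>t\<in>fuse D (the (A i)) (the (B j)). F (Node i j t))"
proof -
  have "(\<Sum>l\<in>dom (A \<boxtimes>\<^bsub>D\<^esub> B). F l) =
    (\<Sum>i\<in>dom A. \<Sum>l\<in>(\<Union>j\<in>dom B. Node i j ` fuse D (the (A i)) (the (B j))). F l)"
    unfolding dom_otens using assms by (intro sum.UNION_disjoint) auto
  also have "\<dots> =
    (\<Sum>i\<in>dom A. \<Sum>j\<in>dom B. \<Sum>l\<in>Node i j ` fuse D (the (A i)) (the (B j)). F l)"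
    using assms by (intro sum.cong refl sum.UNION_disjoint) auto
  finally show ?thesis by (simp add: sum.reindex inj_on_def)
qed

text \<open>\<open>morph\<close> keeps an entry only if the target label is a summand carrying the
  same simple object. If both factors are nonzero they preserve the simple objects \<open>a\<close>
  and \<open>b\<close>, so \<open>t\<close> is a summand of the target as well; otherwise both sides
  are 0.\<close>

lemma mat_mtens_Node:
  assumes "f \<in> hom A A'" "g \<in> hom B B'" "A i = Some a" "B j = Some b" "t \<in> fuse D a b"
  shows "mat (f \<otimes>\<^bsub>D\<^esub> g) (Node i' j' t') (Node i j t) =
    (if t' = t then mat f i' i * mat g j' j else 0)"
proof -
  have src: "src f = A" "src g = B" "tgt f = A'" "tgt g = B'" using assms by (auto simp: hom_def)
  show ?thesis
  proof (cases "mat f i' i * mat g j' j = 0")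
    case True
    then show ?thesis by (auto simp: mtens_def)
  next
    case False
    then have "A' i' = Some a" "B' j' = Some b"
      using hom_nonzeroD[OF assms(1), of i' i] hom_nonzeroD[OF assms(2), of j' j] assms(3,4) by auto
    then show ?thesis by (simp add: mtens_def src otens_Node assms(3-5) dom_def)
  qed
qed

lemma mat_mtens_nonzeroE:
  assumes "f \<in> hom A A'" "g \<in> hom B B'" "mat (f \<otimes>\<^bsub>D\<^esub> g) l' l \<noteq> 0"
  obtains i j i' j' t a b where "l = Node i j t" "l' = Node i' j' t"
    "A i = Some a" "B j = Some b" "A' i' = Some a" "B' j' = Some b" "t \<in> fuse D a b"
    "mat f i' i \<noteq> 0" "mat g j' j \<noteq> 0"
proof -
  have src: "src f = A" "src g = B" "tgt f = A'" "tgt g = B'" using assms by (auto simp: hom_def)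
  obtain i j t a b where l: "l = Node i j t" "A i = Some a" "B j = Some b" "t \<in> fuse D a b"
  proof -
    have "l \<in> dom (A \<boxtimes>\<^bsub>D\<^esub> B)"
      using assms(3) by (simp add: mtens_def src split: if_splits)
    then show ?thesis using that by (auto simp: otens_eq_Some_iff)
  qed
  obtain i' j' where l': "l' = Node i' j' t"
  proof -
    have "(A' \<boxtimes>\<^bsub>D\<^esub> B') l' = Some t"
      using assms(3) l by (simp add: mtens_def src otens_Node split: if_splits)
    then show ?thesis using that by (auto simp: otens_eq_Some_iff)
  qed
  have nz: "mat f i' i \<noteq> 0" "mat g j' j \<noteq> 0"
    using assms(3) unfolding l(1) l' by (simp_all add: mat_mtens_Node[OF assms(1,2) l(2-4)])
  have "A' i' = Some a" "B' j' = Some b"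
    using nz hom_nonzeroD[OF assms(1), of i' i] hom_nonzeroD[OF assms(2), of j' j] l by auto
  with l l' nz show ?thesis by (intro that)
qed

section \<open>The discriminant form\<close>

lemma cls_add: "cls (a + b) = cls a + cls b"
  by transfer (simp add: equivp_reflp[OF equivp_mod2_rel])

lemma cls_0 [simp]: "cls 0 = 0"
  by transfer (simp add: equivp_reflp[OF equivp_mod2_rel])

lemma cls_eq_iff: "cls a = cls b \<longleftrightarrow> (\<exists>c. a = b + (c + c))"
  by transfer (auto simp: mod2_rel_def algebra_simps diff_eq_eq)

lemma cls_uminus [simp]: "cls (- a) = cls a"
  unfolding cls_eq_iff by (rule exI[of _ "- a"]) simp

lemma obtain_cls: obtains a where "cls a = x"
  by transfer (auto intro: equivp_reflp[OF equivp_mod2_rel])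

lemma cls_rep [simp]: "cls (rep x) = x"
  unfolding rep_def by (rule someI_ex) (metis obtain_cls)

lemma mod2_add_self [simp]: "x + x = (0 :: 'a::ab_group_add mod2)"
proof -
  obtain a where "x = cls a" by (metis obtain_cls)
  moreover have "cls (a + a) = cls 0" unfolding cls_eq_iff by auto
  ultimately show ?thesis by (simp add: cls_add)
qed

lemma mod2_add_eq_iff: "x + y = z \<longleftrightarrow> y = x + (z :: 'a::ab_group_add mod2)"
  by auto

lemma root2_sq:
  "root2 TYPE('a::{finite,ab_group_add}) * root2 TYPE('a) = of_nat (card (range (\<lambda>a::'a. a + a)))"
  by (simp add: root2_def flip: of_real_mult)

lemma root2_nonzero [simp]: "root2 TYPE('a::{finite,ab_group_add}) \<noteq> 0"
proof -
  have "card (range (\<lambda>a::'a. a + a)) \<noteq> 0" by simp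
  then show ?thesis by (simp add: root2_def del: card_eq_0_iff)
qed

lemma card_coset:
  "of_nat (card {a::'a::{finite,ab_group_add}. cls a = z}) = root2 TYPE('a) * root2 TYPE('a)"
proof -
  have "{a. cls a = z} = (+) (rep z) ` range (\<lambda>a::'a. a + a)"
    using cls_eq_iff[of _ "rep z"] by (auto simp: image_iff)
  then show ?thesis unfolding root2_sq by (simp add: card_image)
qed

section \<open>Identities for \<sigma>, \<omega>, q and the bilinear form\<close>

locale crossed =
  fixes D :: "'a::{finite,ab_group_add} crossed_data"
  assumes crossed: "is_crossed_data D"
begin

lemma
  shows disc: "discriminant_form (Qf D)"
    and sg_nonzero [simp]: "sgf D a b \<noteq> 0"
    and om_cases: "omf D a b c = 1 \<or> omf D a b c = - 1"
    and sg_diag: "sgf D a a = Qf D a"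
    and sg_0 [simp]: "sgf D a 0 = 1" "sgf D 0 a = 1"
    and sg_sym: "sgf D a b = sgf D b a"
    and om_eq: "omf D a b c = sgf D a (b + c) * inverse (sgf D a b) * inverse (sgf D a c)"
    and om_add: "omf D (a + a') b c = omf D a b c * omf D a' b c"
    and q_nonzero [simp]: "qf D a \<noteq> 0"
    and q_sq: "qf D a ^ 2 = Qf D a"
    and q_add: "qf D (a + b) * inverse (qf D a) * inverse (qf D b)
            = sgf D a b * omf D (a + b) a b * omb D (dlt D) a b"
    and eps_cases: "eps D = 1 \<or> eps D = - 1"
    and alp_sq: "alp D ^ 2 = eps D * gauss (dlt D) (\<lambda>a. inverse (qf D a))"
  using crossed unfolding is_crossed_data_def by blast+

lemma Q_nonzero [simp]: "Qf D a \<noteq> 0"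
  and Q_zmult: "Qf D (zmult n a) = Qf D a ^ nat (n ^ 2)"
  and B_add_left: "bilin (Qf D) (a + b) c = bilin (Qf D) a c * bilin (Qf D) b c"
  and B_add_right: "bilin (Qf D) a (b + c) = bilin (Qf D) a b * bilin (Qf D) a c"
  using disc unfolding discriminant_form_def by blast+

lemma B_nondeg: "a \<noteq> 0 \<Longrightarrow> \<exists>b. bilin (Qf D) a b \<noteq> 1"
  using disc unfolding discriminant_form_def by blast

lemma B_sym: "bilin (Qf D) a b = bilin (Qf D) b a"
  by (simp add: bilin_def add.commute mult_ac)

lemma B_nonzero [simp]: "bilin (Qf D) a b \<noteq> 0"
  by (simp add: bilin_def)

lemma Q_0 [simp]: "Qf D 0 = 1"
  using sg_diag[of 0] by simp

lemma B_0 [simp]: "bilin (Qf D) 0 b = 1" "bilin (Qf D) b 0 = 1"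
  by (simp_all add: bilin_def)

lemma Q_uminus [simp]: "Qf D (- a) = Qf D a"
proof -
  have "zmult (-1) a = - a" by (simp add: zmult_def)
  then show ?thesis using Q_zmult[of "-1" a] by simp
qed

lemma Q_double: "Qf D (a + a) = Qf D a ^ 4"
proof -
  have "zmult 2 a = a + a" by (simp add: zmult_def numeral_2_eq_2)
  then show ?thesis using Q_zmult[of 2 a] by simp
qed

lemma B_uminus_left [simp]: "bilin (Qf D) (- a) b = inverse (bilin (Qf D) a b)"
  using B_add_left[of "- a" a b] by (simp add: field_simps)

lemma B_uminus_right [simp]: "bilin (Qf D) b (- a) = inverse (bilin (Qf D) b a)"
  using B_sym B_uminus_left by metis

lemma B_diag: "bilin (Qf D) a a = Qf D a ^ 2"
  by (simp add: bilin_def Q_double field_simps power4_eq_xxxx power2_eq_square)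

lemma om_sq [simp]: "omf D a b c * omf D a b c = 1"
  using om_cases[of a b c] by auto

lemma om_nonzero [simp]: "omf D a b c \<noteq> 0"
  using om_cases[of a b c] by auto

lemma om_inverse [simp]: "inverse (omf D a b c) = omf D a b c"
  using om_cases[of a b c] by auto

lemma om_0 [simp]: "omf D 0 b c = 1" "omf D a b 0 = 1" "omf D a 0 b = 1"
  by (simp_all add: om_eq)

lemma om_commute: "omf D a b c = omf D a c b"
  by (simp add: om_eq add.commute mult_ac)

text \<open>A homomorphism with values in the signs is trivial on doubles. This is what makes
  \<omega> well defined on \<open>mod2\<close>, whatever \<open>rep\<close> chooses.\<close>

lemma om_cong: "cls a = cls b \<Longrightarrow> omf D a c d = omf D b c d"
  by (auto simp: cls_eq_iff om_add)

lemma om_uminus [simp]: "omf D (- a) b c = omf D a b c"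
  by (rule om_cong) simp

lemma omb_cls [simp]: "omb D (cls a) b c = omf D a b c"
  unfolding omb_def by (rule om_cong) simp

lemma omb_cls_eq: "cls a = x \<Longrightarrow> omb D x b c = omf D a b c"
  by auto

lemma omb_0 [simp]: "omb D 0 b c = 1" "omb D x b 0 = 1" "omb D x 0 c = 1"
  using omb_cls[of 0] by (simp_all add: omb_def)

lemma omb_sq [simp]: "omb D x b c * omb D x b c = 1"
  and omb_nonzero [simp]: "omb D x b c \<noteq> 0"
  and omb_commute: "omb D x b c = omb D x c b"
  by (simp_all add: omb_def om_commute)

lemma sg_add: "sgf D a (b + c) = sgf D a b * sgf D a c * omf D a b c"
  by (simp add: om_eq field_simps)

text \<open>Squaring the relation between q and \<sigma> turns q into Q and removes both signs
  \<omega>. This is why a double braiding of group objects yields the bilinear form.\<close>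

lemma sg_sq: "sgf D a b * sgf D a b = bilin (Qf D) a b"
proof -
  have "bilin (Qf D) a b = (qf D (a + b) * inverse (qf D a) * inverse (qf D b)) ^ 2"
    by (simp add: bilin_def power_mult_distrib power_inverse q_sq)
  also have "\<dots> = sgf D a b * sgf D a b * (omf D (a + b) a b * omf D (a + b) a b)
      * (omb D (dlt D) a b * omb D (dlt D) a b)"
    unfolding q_add by (simp only: power2_eq_square mult_ac)
  finally show ?thesis by simp
qed

text \<open>Changing an argument of \<sigma> by an element of 2\<Gamma> multiplies it by a character
  value up to a sign, which is how \<sigma> enters the character sums.\<close>

lemma sg_double: "sgf D r (d + d) = bilin (Qf D) r d * omf D r d d"
  by (simp add: sg_add sg_sq)

lemma sg_uminus_om: "omf D a b (- b) = inverse (sgf D a b * sgf D a (- b))"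
  by (simp add: om_eq)

lemma q_0 [simp]: "qf D 0 = 1"
  using q_add[of 0 0] by (simp add: field_simps)

section \<open>Character sums over cosets of 2\<Gamma> and Gauss sums\<close>

text \<open>Translation by \<open>s + s\<close> permutes the coset and multiplies the sum by
  \<open>B(2s, d)\<close>. Only translations in 2\<Gamma> are available, hence the assumption on
  \<open>d + d\<close> instead of \<open>d\<close>.\<close>

lemma sum_coset_B:
  assumes "d + d \<noteq> 0"
  shows "(\<Sum>a | cls a = z. bilin (Qf D) a d) = 0"
proof -
  obtain s where "bilin (Qf D) (d + d) s \<noteq> 1" using B_nondeg[OF assms] by blast
  \<comment> \<open>Bimultiplicativity and symmetry move the doubling from \<open>d\<close> to
    \<open>s\<close>.\<close>
  then have s: "bilin (Qf D) (s + s) d \<noteq> 1"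
    by (metis B_add_left B_add_right B_sym)
  have "bij_betw ((+) (s + s)) {a. cls a = z} {a. cls a = z}"
    by (rule bij_betw_byWitness[where f' = "\<lambda>a. a - (s + s)"])
      (auto simp: cls_add diff_conv_add_uminus simp del: add_uminus_conv_diff minus_add_distrib)
  then have "(\<Sum>a | cls a = z. bilin (Qf D) a d) = (\<Sum>a | cls a = z. bilin (Qf D) (s + s + a) d)"
    by (rule sum.reindex_bij_betw[symmetric])
  also have "\<dots> = bilin (Qf D) (s + s) d * (\<Sum>a | cls a = z. bilin (Qf D) a d)"
    by (simp add: B_add_left[of "s + s"] sum_distrib_left)
  finally show ?thesis using s by simp
qed

text \<open>With \<open>t' = t + 2d\<close> the quotient of the two \<sigma> is
  \<open>B(r, d)\<close> times signs, so the sum vanishes unless \<open>2d = 0\<close>, that is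
  \<open>t' = t\<close>. Then every term is 1 and the value is the size of the coset.\<close>

lemma sum_coset_sg:
  assumes "cls t = cls t'"
  shows "(\<Sum>r | cls r = z. inverse (sgf D t r) * sgf D t' r)
    = (if t = t' then root2 TYPE('a) * root2 TYPE('a) else 0)"
proof -
  obtain d where t': "t' = t + (d + d)"
    using assms cls_eq_iff[of t' t] by metis
  \<comment> \<open>The signs depend on \<open>r\<close> only through its class \<open>z\<close> and
    leave the sum as a constant.\<close>
  define k where "k = omb D z d d * omb D z t (d + d)"
  have "inverse (sgf D t r) * sgf D t' r = k * bilin (Qf D) r d" if "cls r = z" for r
    unfolding t' sg_sym[of _ r] sg_add[of r t "d + d"] sg_double
    using that by (auto simp: k_def)
  then have eq: "(\<Sum>r | cls r = z. inverse (sgf D t r) * sgf D t' r) =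
      k * (\<Sum>r | cls r = z. bilin (Qf D) r d)"
    by (simp add: sum_distrib_left)
  show ?thesis
  proof (cases "d + d = 0")
    case True
    then show ?thesis using t' card_coset[of z] by simp
  next
    case False
    then show ?thesis using eq sum_coset_B[of d z] t' by simp
  qed
qed

text \<open>The substitution \<open>b = a + (d + d)\<close> turns the product of the two Gauss sums into a
  combination of the character sums \<open>\<Sum>a. B(a, d)\<close>, which vanish unless \<open>b = a\<close>.\<close>

lemma gauss_q_inverse:
  "gauss (dlt D) (\<lambda>a. inverse (qf D a)) * gauss (dlt D) (qf D) = 1"
proof -
  define S where "S = {a. cls a = dlt D}"
  define K :: "'a set" where "K = {c. cls c = 0}"
  have "(\<Sum>a\<in>S. inverse (qf D a)) * (\<Sum>b\<in>S. qf D b)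
      = (\<Sum>a\<in>S. \<Sum>b\<in>S. inverse (qf D a) * qf D b)"
    by (simp add: sum_product)
  also have "\<dots> = (\<Sum>a\<in>S. \<Sum>c\<in>K. inverse (qf D a) * qf D (a + c))"
  proof (rule sum.cong[OF refl])
    fix a assume "a \<in> S"
    then have "bij_betw ((+) a) K S"
      by (intro bij_betw_byWitness[where f' = "\<lambda>b. b - a"])
        (auto simp: S_def K_def cls_add diff_conv_add_uminus simp del: add_uminus_conv_diff)
    then show "(\<Sum>b\<in>S. inverse (qf D a) * qf D b)
        = (\<Sum>c\<in>K. inverse (qf D a) * qf D (a + c))"
      by (rule sum.reindex_bij_betw[symmetric])
  qed
  also have "\<dots> = (\<Sum>a\<in>S. \<Sum>c\<in>K. qf D c * sgf D a c)"
  proof (intro sum.cong refl)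
    fix a c assume "a \<in> S" "c \<in> K"
    \<comment> \<open>Here the coset \<delta> matters: \<open>a + c\<close> again has class
      \<delta>, so the two signs in the relation between q and \<sigma> are equal and
      cancel.\<close>
    then have "omf D (a + c) a c = omb D (dlt D) a c"
      by (intro omb_cls_eq[symmetric]) (simp add: S_def K_def cls_add)
    with q_add[of a c] have "qf D (a + c) * inverse (qf D a) * inverse (qf D c)
        = sgf D a c * (omb D (dlt D) a c * omb D (dlt D) a c)"
      by (simp only: mult.assoc)
    then show "inverse (qf D a) * qf D (a + c) = qf D c * sgf D a c"
      by (simp add: field_simps)
  qed
  also have "\<dots> = (\<Sum>c\<in>K. qf D c * (\<Sum>a\<in>S. sgf D a c))"
    by (subst sum.swap) (simp add: sum_distrib_left)
  also have "\<dots> = (\<Sum>c\<in>K. if c = 0 then root2 TYPE('a) * root2 TYPE('a) else 0)"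
  proof (intro sum.cong refl)
    fix c :: 'a assume "c \<in> K"
    then have "cls 0 = cls c" by (simp add: K_def)
    from sum_coset_sg[OF this, of "dlt D"]
    show "qf D c * (\<Sum>a\<in>S. sgf D a c) = (if c = 0 then root2 TYPE('a) * root2 TYPE('a) else 0)"
      by (auto simp: S_def sg_sym[of _ c] eq_commute[of 0])
  qed
  also have "\<dots> = root2 TYPE('a) * root2 TYPE('a)"
    by (simp add: K_def)
  finally show ?thesis
    by (simp add: gauss_def S_def field_simps)
qed

lemma alp_nonzero: "alp D \<noteq> 0"
  using alp_sq gauss_q_inverse eps_cases by auto

lemma eps_sq [simp]: "eps D * eps D = 1"
  using eps_cases by auto

lemma eps_nonzero [simp]: "eps D \<noteq> 0"
  using eps_cases by auto

end

section \<open>Associator and unitors\<close>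

lemma fuse_commute: "fuse D a b = fuse D b a"
  by (cases a; cases b) (auto simp: add.commute add.left_commute)

lemma fuse_gsim: "grade a = Z2_gen \<Longrightarrow> fuse D a (gsim b) = fuse D a b"
  by (cases a; cases b) auto

lemma gsim_gsim [simp]: "gsim (gsim a) = a"
  by (cases a) auto

text \<open>For two objects of degree g this holds because a class modulo 2\<Gamma> is stable under
  negation, so the action merely permutes the summands.\<close>

lemma fuse_gsim_gsim: "fuse D (gsim a) (gsim b) = gsim ` fuse D a b"
proof (cases a; cases b)
  fix x y assume "a = Xs x" "b = Xs y"
  then show ?thesis
    by (auto simp: image_iff) (metis cls_uminus minus_minus gsim.simps(1))
qed auto

lemma gsim_fuse_iff: "gsim t \<in> fuse D (gsim a) (gsim b) \<longleftrightarrow> t \<in> fuse D a b"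
  unfolding fuse_gsim_gsim by (metis gsim_gsim image_iff)

text \<open>The dual of a simple object. The product of \<open>X^x\<close> and \<open>X^y\<close>
  contains the unit exactly if \<open>\<delta> + x + y = 0\<close>, and \<Gamma>/2\<Gamma> has
  exponent 2, hence the shift by \<delta>.\<close>

fun dsim :: "'a::ab_group_add crossed_data \<Rightarrow> 'a simple \<Rightarrow> 'a simple" where
  "dsim D (Cs a) = Cs (- a)"
| "dsim D (Xs x) = Xs (dlt D + x)"

lemma dsim_dsim [simp]: "dsim D (dsim D a) = a"
  by (cases a) auto

lemma unit_in_fuse_iff: "Cs 0 \<in> fuse D a b \<longleftrightarrow> b = dsim D a"
proof (cases a; cases b)
  fix x y assume "a = Xs x" "b = Xs y"
  moreover have "0 = dlt D + x + y \<longleftrightarrow> y = dlt D + x"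
    using mod2_add_eq_iff[of "dlt D + x" y 0] by auto
  ultimately show ?thesis by simp
qed (auto simp: eq_neg_iff_add_eq_0 add.commute)

lemma unit_in_fuse_iff': "Cs 0 \<in> fuse D a b \<longleftrightarrow> a = dsim D b"
  using unit_in_fuse_iff[of D b a] by (simp add: fuse_commute)

lemma fuse_unit_left [simp]: "fuse D (Cs 0) a = {a}"
  by (cases a) auto

lemma fuse_unit_right [simp]: "fuse D a (Cs 0) = {a}"
  by (cases a) auto

lemma cls_diff: "cls (a - b) = cls a + cls b"
  unfolding diff_conv_add_uminus cls_add by simp

lemma Cs_in_fuse_Cs: "Cs u \<in> fuse D (Cs a) r \<longleftrightarrow> r = Cs (u - a)"
  by (cases r) (auto simp: algebra_simps)

lemma Cs_in_fuse_Cs': "Cs u \<in> fuse D r (Cs a) \<longleftrightarrow> r = Cs (u - a)"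
  using Cs_in_fuse_Cs[of u D a r] by (simp add: fuse_commute)

lemma unit_obj_eq_Some [simp]: "unit_obj l = Some c \<longleftrightarrow> l = Leaf (Cs 0) \<and> c = Cs 0"
  by (auto simp: unit_obj_def osum_def split: lab.splits)

lemma dom_unit_obj [simp]: "dom unit_obj = {Leaf (Cs 0)}"
  by (auto simp: dom_def)

lemma osum_eq_Some [simp]: "osum S l = Some c \<longleftrightarrow> l = Leaf c \<and> c \<in> S"
  by (auto simp: osum_def split: lab.splits)

lemma dom_osum [simp]: "dom (osum S) = Leaf ` S"
  by (auto simp: dom_def)

lemma part_eq_Some [simp]: "part h A i = Some a \<longleftrightarrow> A i = Some a \<and> grade a = h"
  by (auto simp: part_def split: option.splits)

lemma gobj_eq_Some [simp]: "gobj A i = Some a \<longleftrightarrow> A i = Some (gsim a)"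
  by (auto simp: gobj_def)

lemma finite_dom_part [simp]: "finite (dom A) \<Longrightarrow> finite (dom (part h A))"
  by (rule finite_subset[of _ "dom A"]) (auto simp: dom_def)

lemma dom_hobj [simp]: "dom (hobj h A) = dom A"
  by (cases h) auto

lemma lunit_hom: "lunit D A \<in> hom (unit_obj \<boxtimes>\<^bsub>D\<^esub> A) A"
  and runit_hom: "runit D A \<in> hom (A \<boxtimes>\<^bsub>D\<^esub> unit_obj) A"
  and assoc_hom: "assoc D A B C \<in> hom ((A \<boxtimes>\<^bsub>D\<^esub> B) \<boxtimes>\<^bsub>D\<^esub> C) (A \<boxtimes>\<^bsub>D\<^esub> (B \<boxtimes>\<^bsub>D\<^esub> C))"
  by (simp_all add: lunit_def runit_def assoc_def)

lemma mat_lunit: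
  "A i = Some a \<Longrightarrow> mat (lunit D A) i' (Node (Leaf (Cs 0)) i a) = (if i' = i then 1 else 0)"
  using otens_Node[of unit_obj "Leaf (Cs 0)" "Cs 0" A i a D a]
  by (auto simp: lunit_def)

lemma mat_runit:
  "A i = Some a \<Longrightarrow> mat (runit D A) i' (Node i (Leaf (Cs 0)) a) = (if i' = i then 1 else 0)"
  using otens_Node[of A i a unit_obj "Leaf (Cs 0)" "Cs 0" D a]
  by (auto simp: runit_def)

lemma mat_lunit_nonzero:
  "mat (lunit D A) i' l \<noteq> 0 \<Longrightarrow> \<exists>a. l = Node (Leaf (Cs 0)) i' a \<and> A i' = Some a"
  by (auto simp: lunit_def otens_eq_Some_iff split: if_splits)

lemma mat_runit_nonzero:
  "mat (runit D A) i' l \<noteq> 0 \<Longrightarrow> \<exists>a. l = Node i' (Leaf (Cs 0)) a \<and> A i' = Some a"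
  by (auto simp: runit_def otens_eq_Some_iff split: if_splits)

lemma otens3_left:
  "((A \<boxtimes>\<^bsub>D\<^esub> B) \<boxtimes>\<^bsub>D\<^esub> C) l = Some u \<longleftrightarrow> (\<exists>i j k t a b c. l = Node (Node i j t) k u \<and>
     A i = Some a \<and> B j = Some b \<and> C k = Some c \<and> t \<in> fuse D a b \<and> u \<in> fuse D t c)"
  by (auto simp: otens_eq_Some_iff)

lemma otens3_right:
  "(A \<boxtimes>\<^bsub>D\<^esub> (B \<boxtimes>\<^bsub>D\<^esub> C)) l = Some u \<longleftrightarrow> (\<exists>i j k r a b c. l = Node i (Node j k r) u \<and>
     A i = Some a \<and> B j = Some b \<and> C k = Some c \<and> r \<in> fuse D b c \<and> u \<in> fuse D a r)"
  by (auto simp: otens_eq_Some_iff)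

lemma mat_assoc:
  assumes "A i = Some a" "B j = Some b" "C k = Some c"
    and "t \<in> fuse D a b" "u \<in> fuse D t c" "r \<in> fuse D b c" "u \<in> fuse D a r"
  shows "mat (assoc D A B C) (Node i (Node j k r) u) (Node (Node i j t) k u)
    = assoc_coeff D a b c t r u"
proof -
  have "((A \<boxtimes>\<^bsub>D\<^esub> B) \<boxtimes>\<^bsub>D\<^esub> C) (Node (Node i j t) k u) = Some u"
    "(A \<boxtimes>\<^bsub>D\<^esub> (B \<boxtimes>\<^bsub>D\<^esub> C)) (Node i (Node j k r) u) = Some u"
    using assms by (auto simp: otens_eq_Some_iff)
  then show ?thesis by (simp add: assoc_def dom_def assms(1-3))
qed

lemma mat_assoc_nonzeroE:
  assumes "mat (assoc D A B C) l' l \<noteq> 0"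
  obtains i j k t r u a b c where "l = Node (Node i j t) k u" "l' = Node i (Node j k r) u"
    "A i = Some a" "B j = Some b" "C k = Some c"
    "t \<in> fuse D a b" "u \<in> fuse D t c" "r \<in> fuse D b c" "u \<in> fuse D a r"
proof -
  obtain u where l: "((A \<boxtimes>\<^bsub>D\<^esub> B) \<boxtimes>\<^bsub>D\<^esub> C) l = Some u" and l': "(A \<boxtimes>\<^bsub>D\<^esub> (B \<boxtimes>\<^bsub>D\<^esub> C)) l' = Some u"
    using assms hom_nonzeroD[OF assoc_hom] by metis
  obtain i j k t a b c where 1: "l = Node (Node i j t) k u" "A i = Some a" "B j = Some b"
      "C k = Some c" "t \<in> fuse D a b" "u \<in> fuse D t c"
    using l unfolding otens3_left by blast
  obtain i' j' k' r a' b' c' where 2: "l' = Node i' (Node j' k' r) u" "A i' = Some a'"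
      "B j' = Some b'" "C k' = Some c'" "r \<in> fuse D b' c'" "u \<in> fuse D a' r"
    using l' unfolding otens3_right by blast
  have 3: "i' = i" "j' = j" "k' = k"
    using assms unfolding 1 2 by (simp_all add: assoc_def split: if_splits)
  have abc: "a' = a" "b' = b" "c' = c"
    using 1(2-4) 2(2-4) 3 by auto
  show ?thesis
    by (rule that[OF 1(1) 2(1)[unfolded 3] 1(2-6) 2(5,6)[unfolded abc]])
qed

section \<open>The inverse associator\<close>

text \<open>For three objects of degree g the associator is a matrix in \<open>t\<close> and
  \<open>r\<close>, a multiple of the Fourier-type matrix with entries
  \<open>1/\<sigma>(t,r)\<close>. Its inverse has the entries \<open>\<sigma>(t,r)\<close> with the
  same prefactor, since the square of that prefactor is \<open>1/|2\<Gamma>|\<close>. In all other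
  cases the associator is a scalar on each summand.\<close>

fun ainv_coeff :: "'a::ab_group_add crossed_data \<Rightarrow>
    'a simple \<Rightarrow> 'a simple \<Rightarrow> 'a simple \<Rightarrow> 'a simple \<Rightarrow> 'a simple \<Rightarrow> 'a simple \<Rightarrow> complex" where
  "ainv_coeff D (Xs x) (Xs y) (Xs z) t r u =
     eps D * inverse (root2 TYPE('a)) * sgf D (grp t) (grp r)"
| "ainv_coeff D a b c t r u = inverse (assoc_coeff D a b c t r u)"

definition ainv :: "'a::ab_group_add crossed_data \<Rightarrow>
    'a obj \<Rightarrow> 'a obj \<Rightarrow> 'a obj \<Rightarrow> 'a mor" where
  "ainv D A B C = morph (A \<boxtimes>\<^bsub>D\<^esub> (B \<boxtimes>\<^bsub>D\<^esub> C)) ((A \<boxtimes>\<^bsub>D\<^esub> B) \<boxtimes>\<^bsub>D\<^esub> C)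
     (\<lambda>l' l. case (l', l) of
        (Node (Node i' j' t) k' u', Node i (Node j k r) u) \<Rightarrow>
           if i' = i \<and> j' = j \<and> k' = k
           then ainv_coeff D (the (A i)) (the (B j)) (the (C k)) t r u else 0
      | _ \<Rightarrow> 0)"

lemma ainv_hom: "ainv D A B C \<in> hom (A \<boxtimes>\<^bsub>D\<^esub> (B \<boxtimes>\<^bsub>D\<^esub> C)) ((A \<boxtimes>\<^bsub>D\<^esub> B) \<boxtimes>\<^bsub>D\<^esub> C)"
  by (simp add: ainv_def)

lemma mat_ainv:
  assumes "A i = Some a" "B j = Some b" "C k = Some c"
    and "t \<in> fuse D a b" "u \<in> fuse D t c" "r \<in> fuse D b c" "u \<in> fuse D a r"
  shows "mat (ainv D A B C) (Node (Node i j t) k u) (Node i (Node j k r) u)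
    = ainv_coeff D a b c t r u"
proof -
  have "((A \<boxtimes>\<^bsub>D\<^esub> B) \<boxtimes>\<^bsub>D\<^esub> C) (Node (Node i j t) k u) = Some u"
    "(A \<boxtimes>\<^bsub>D\<^esub> (B \<boxtimes>\<^bsub>D\<^esub> C)) (Node i (Node j k r) u) = Some u"
    using assms by (auto simp: otens_eq_Some_iff)
  then show ?thesis by (simp add: ainv_def dom_def assms(1-3))
qed

lemma mat_ainv_nonzeroE:
  assumes "mat (ainv D A B C) l' l \<noteq> 0"
  obtains i j k t r u a b c where "l = Node i (Node j k r) u" "l' = Node (Node i j t) k u"
    "A i = Some a" "B j = Some b" "C k = Some c"
    "t \<in> fuse D a b" "u \<in> fuse D t c" "r \<in> fuse D b c" "u \<in> fuse D a r"
proof -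
  obtain u where l: "((A \<boxtimes>\<^bsub>D\<^esub> B) \<boxtimes>\<^bsub>D\<^esub> C) l' = Some u" and l': "(A \<boxtimes>\<^bsub>D\<^esub> (B \<boxtimes>\<^bsub>D\<^esub> C)) l = Some u"
    using assms hom_nonzeroD[OF ainv_hom] by metis
  obtain i j k t a b c where 1: "l' = Node (Node i j t) k u" "A i = Some a" "B j = Some b"
      "C k = Some c" "t \<in> fuse D a b" "u \<in> fuse D t c"
    using l unfolding otens3_left by blast
  obtain i' j' k' r a' b' c' where 2: "l = Node i' (Node j' k' r) u" "A i' = Some a'"
      "B j' = Some b'" "C k' = Some c'" "r \<in> fuse D b' c'" "u \<in> fuse D a' r"
    using l' unfolding otens3_right by blast
  have 3: "i' = i" "j' = j" "k' = k"
    using assms unfolding 1 2 by (simp_all add: ainv_def split: if_splits)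
  have abc: "a' = a" "b' = b" "c' = c"
    using 1(2-4) 2(2-4) 3 by auto
  show ?thesis
    by (rule that[OF 2(1)[unfolded 3] 1(1) 1(2-6) 2(5,6)[unfolded abc]])
qed

context crossed begin

lemma assoc_coeff_nonzero [simp]: "assoc_coeff D a b c t r u \<noteq> 0"
  by (cases a; cases b; cases c) auto

text \<open>For three objects of degree g the sum over \<open>r\<close> is a character sum over the
  coset \<open>\<delta> + y + z\<close>. Otherwise there is exactly one admissible \<open>r\<close>,
  and \<open>t\<close> is determined by \<open>u\<close>, so a nonzero scalar meets its
  inverse.\<close>

lemma ainv_coeff_left:
  assumes "t \<in> fuse D a b" "u \<in> fuse D t c" "t' \<in> fuse D a b" "u \<in> fuse D t' c"
  shows "(\<Sum>r | r \<in> fuse D b c \<and> u \<in> fuse D a r.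
      ainv_coeff D a b c t' r u * assoc_coeff D a b c t r u) = (if t' = t then 1 else 0)"
proof (cases "\<exists>x y z. a = Xs x \<and> b = Xs y \<and> c = Xs z")
  case True
  then obtain x y z where abc: "a = Xs x" "b = Xs y" "c = Xs z" by blast
  obtain s s' where s: "t = Cs s" "cls s = dlt D + x + y" "t' = Cs s'" "cls s' = dlt D + x + y"
    using assms abc by auto
  have u: "u = Xs (dlt D + x + y + z)" using assms s abc by auto
  have R: "{r. r \<in> fuse D b c \<and> u \<in> fuse D a r} = Cs ` {r. cls r = dlt D + y + z}"
    unfolding abc u by (auto simp: ac_simps)
  have "(\<Sum>r | r \<in> fuse D b c \<and> u \<in> fuse D a r.
      ainv_coeff D a b c t' r u * assoc_coeff D a b c t r u)
    = (\<Sum>r | cls r = dlt D + y + z. ainv_coeff D a b c t' (Cs r) u * assoc_coeff D a b c t (Cs r) u)"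
    unfolding R by (subst sum.reindex) (auto simp: inj_on_def)
  also have "\<dots> = eps D * eps D * inverse (root2 TYPE('a) * root2 TYPE('a)) *
      (\<Sum>r | cls r = dlt D + y + z. inverse (sgf D s r) * sgf D s' r)"
    unfolding sum_distrib_left abc s by (rule sum.cong) (auto simp: mult_ac)
  also have "\<dots> = (if t' = t then 1 else 0)"
    by (subst sum_coset_sg) (use s in \<open>auto simp: field_simps\<close>)
  finally show ?thesis .
next
  case False
  have "\<exists>!r. r \<in> fuse D b c \<and> u \<in> fuse D a r"
    using assms False
    by (cases a; cases b; cases c) (auto simp: cls_add cls_diff Cs_in_fuse_Cs ac_simps)
  then have "\<exists>r. {r. r \<in> fuse D b c \<and> u \<in> fuse D a r} = {r}" by auto
  moreover have "t' = t"
    using assms False by (cases a; cases b; cases c) auto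
  moreover have "ainv_coeff D a b c t r u = inverse (assoc_coeff D a b c t r u)" for r
    using False by (cases a; cases b; cases c) auto
  ultimately show ?thesis by auto
qed

text \<open>The same with the roles of \<open>t\<close> and \<open>r\<close> exchanged; the symmetry
  of \<sigma> allows the same character sum to be used.\<close>

lemma ainv_coeff_right:
  assumes "r \<in> fuse D b c" "u \<in> fuse D a r" "r' \<in> fuse D b c" "u \<in> fuse D a r'"
  shows "(\<Sum>t | t \<in> fuse D a b \<and> u \<in> fuse D t c.
      assoc_coeff D a b c t r' u * ainv_coeff D a b c t r u) = (if r' = r then 1 else 0)"
proof (cases "\<exists>x y z. a = Xs x \<and> b = Xs y \<and> c = Xs z")
  case True
  then obtain x y z where abc: "a = Xs x" "b = Xs y" "c = Xs z" by blast
  obtain s s' where s: "r = Cs s" "cls s = dlt D + y + z" "r' = Cs s'" "cls s' = dlt D + y + z"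
    using assms abc by auto
  have u: "u = Xs (dlt D + x + y + z)" using assms s abc by (auto simp: ac_simps)
  have R: "{t. t \<in> fuse D a b \<and> u \<in> fuse D t c} = Cs ` {t. cls t = dlt D + x + y}"
    unfolding abc u by (auto simp: ac_simps)
  have "(\<Sum>t | t \<in> fuse D a b \<and> u \<in> fuse D t c.
      assoc_coeff D a b c t r' u * ainv_coeff D a b c t r u)
    = (\<Sum>t | cls t = dlt D + x + y. assoc_coeff D a b c (Cs t) r' u * ainv_coeff D a b c (Cs t) r u)"
    unfolding R by (subst sum.reindex) (auto simp: inj_on_def)
  also have "\<dots> = eps D * eps D * inverse (root2 TYPE('a) * root2 TYPE('a)) *
      (\<Sum>t | cls t = dlt D + x + y. inverse (sgf D s' t) * sgf D s t)"
    unfolding sum_distrib_left abc s sg_sym[of s] sg_sym[of s'] by (rule sum.cong) (auto simp: mult_ac)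
  also have "\<dots> = (if r' = r then 1 else 0)"
    by (subst sum_coset_sg) (use s in \<open>auto simp: field_simps\<close>)
  finally show ?thesis .
next
  case False
  have "\<exists>!t. t \<in> fuse D a b \<and> u \<in> fuse D t c"
    using assms False
    by (cases a; cases b; cases c) (auto simp: cls_add cls_diff Cs_in_fuse_Cs' ac_simps)
  then have "\<exists>t. {t. t \<in> fuse D a b \<and> u \<in> fuse D t c} = {t}" by auto
  moreover have "r' = r"
    using assms False by (cases a; cases b; cases c) auto
  moreover have "ainv_coeff D a b c t r u = inverse (assoc_coeff D a b c t r u)" for t
    using False by (cases a; cases b; cases c) auto
  ultimately show ?thesis by auto
qed


text \<open>Both composites keep the labels \<open>i\<close>, \<open>j\<close>, \<open>k\<close> of
  the three factors and the total summand \<open>u\<close>, so each splits into the small matrices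
  indexed by intermediate summands that have just been inverted. The explicit form is needed because
  the second zigzag identity contains \<open>minv\<close>.\<close>

lemma minv_assoc:
  assumes fin: "finite (dom A)" "finite (dom B)" "finite (dom C)"
  shows "minv (assoc D A B C) = ainv D A B C"
proof (rule minv_eqI[OF assoc_hom ainv_hom])
  show finL: "finite (dom ((A \<boxtimes>\<^bsub>D\<^esub> B) \<boxtimes>\<^bsub>D\<^esub> C))" and finR: "finite (dom (A \<boxtimes>\<^bsub>D\<^esub> (B \<boxtimes>\<^bsub>D\<^esub> C)))"
    using fin by auto
  show "ainv D A B C \<cdot> assoc D A B C = idm ((A \<boxtimes>\<^bsub>D\<^esub> B) \<boxtimes>\<^bsub>D\<^esub> C)"
  proof (rule hom_eqI[OF comp_hom[OF assoc_hom ainv_hom] idm_hom])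
    fix l l' u assume l: "((A \<boxtimes>\<^bsub>D\<^esub> B) \<boxtimes>\<^bsub>D\<^esub> C) l = Some u" and l': "((A \<boxtimes>\<^bsub>D\<^esub> B) \<boxtimes>\<^bsub>D\<^esub> C) l' = Some u"
    obtain i j k t a b c where 1: "l = Node (Node i j t) k u" "A i = Some a" "B j = Some b"
      "C k = Some c" "t \<in> fuse D a b" "u \<in> fuse D t c"
      using l unfolding otens3_left by blast
    obtain i' j' k' t' a' b' c' where 2: "l' = Node (Node i' j' t') k' u" "A i' = Some a'" "B j' = Some b'"
      "C k' = Some c'" "t' \<in> fuse D a' b'" "u \<in> fuse D t' c'"
      using l' unfolding otens3_left by blast
    define R where "R = {r. r \<in> fuse D b c \<and> u \<in> fuse D a r}"
    have "finite R" by (rule finite_subset[of _ "fuse D b c"]) (auto simp: R_def)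
    have "mat (ainv D A B C \<cdot> assoc D A B C) l' l = (\<Sum>r\<in>R.
        mat (ainv D A B C) l' (Node i (Node j k r) u) * mat (assoc D A B C) (Node i (Node j k r) u) l)"
    proof (rule mat_comp_reindex[OF assoc_hom finR \<open>finite R\<close>])
      show "m \<in> (\<lambda>r. Node i (Node j k r) u) ` R" if "mat (assoc D A B C) m l \<noteq> 0" for m
        using that 1 by (elim mat_assoc_nonzeroE) (auto simp: R_def)
    qed (auto simp: inj_on_def)
    also have "\<dots> = (if l' = l then 1 else 0)"
    proof (cases "i' = i \<and> j' = j \<and> k' = k")
      case True
      have "(\<Sum>r\<in>R.
        mat (ainv D A B C) l' (Node i (Node j k r) u) * mat (assoc D A B C) (Node i (Node j k r) u) l)
        = (\<Sum>r\<in>R. ainv_coeff D a b c t' r u * assoc_coeff D a b c t r u)"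
        using 1 2 True by (intro sum.cong refl) (auto simp: R_def mat_ainv mat_assoc)
      also have "\<dots> = (if t' = t then 1 else 0)"
        unfolding R_def using 1 2 True by (intro ainv_coeff_left) auto
      finally show ?thesis using 1 2 True by auto
    next
      case False
      then have "mat (ainv D A B C) l' (Node i (Node j k r) u) = 0" for r
        unfolding 2(1) by - (rule ccontr, auto elim!: mat_ainv_nonzeroE)
      then show ?thesis using False 1 2 by auto
    qed
    finally show "mat (ainv D A B C \<cdot> assoc D A B C) l' l = mat (idm ((A \<boxtimes>\<^bsub>D\<^esub> B) \<boxtimes>\<^bsub>D\<^esub> C)) l' l"
      using l by (simp add: dom_def)
  qed
  show "assoc D A B C \<cdot> ainv D A B C = idm (A \<boxtimes>\<^bsub>D\<^esub> (B \<boxtimes>\<^bsub>D\<^esub> C))"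
  proof (rule hom_eqI[OF comp_hom[OF ainv_hom assoc_hom] idm_hom])
    fix l l' u assume l: "(A \<boxtimes>\<^bsub>D\<^esub> (B \<boxtimes>\<^bsub>D\<^esub> C)) l = Some u" and l': "(A \<boxtimes>\<^bsub>D\<^esub> (B \<boxtimes>\<^bsub>D\<^esub> C)) l' = Some u"
    obtain i j k r a b c where 1: "l = Node i (Node j k r) u" "A i = Some a" "B j = Some b"
      "C k = Some c" "r \<in> fuse D b c" "u \<in> fuse D a r"
      using l unfolding otens3_right by blast
    obtain i' j' k' r' a' b' c' where 2: "l' = Node i' (Node j' k' r') u" "A i' = Some a'" "B j' = Some b'"
      "C k' = Some c'" "r' \<in> fuse D b' c'" "u \<in> fuse D a' r'"
      using l' unfolding otens3_right by blast
    define T where "T = {t. t \<in> fuse D a b \<and> u \<in> fuse D t c}"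
    have "finite T" by (rule finite_subset[of _ "fuse D a b"]) (auto simp: T_def)
    have "mat (assoc D A B C \<cdot> ainv D A B C) l' l = (\<Sum>t\<in>T.
        mat (assoc D A B C) l' (Node (Node i j t) k u) * mat (ainv D A B C) (Node (Node i j t) k u) l)"
    proof (rule mat_comp_reindex[OF ainv_hom finL \<open>finite T\<close>])
      show "m \<in> (\<lambda>t. Node (Node i j t) k u) ` T" if "mat (ainv D A B C) m l \<noteq> 0" for m
        using that 1 by (elim mat_ainv_nonzeroE) (auto simp: T_def)
    qed (auto simp: inj_on_def)
    also have "\<dots> = (if l' = l then 1 else 0)"
    proof (cases "i' = i \<and> j' = j \<and> k' = k")
      case True
      have "(\<Sum>t\<in>T.
        mat (assoc D A B C) l' (Node (Node i j t) k u) * mat (ainv D A B C) (Node (Node i j t) k u) l)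
        = (\<Sum>t\<in>T. assoc_coeff D a b c t r' u * ainv_coeff D a b c t r u)"
        using 1 2 True by (intro sum.cong refl) (auto simp: T_def mat_ainv mat_assoc)
      also have "\<dots> = (if r' = r then 1 else 0)"
        unfolding T_def using 1 2 True by (intro ainv_coeff_right) auto
      finally show ?thesis using 1 2 True by auto
    next
      case False
      then have "mat (assoc D A B C) l' (Node (Node i j t) k u) = 0" for t
        unfolding 2(1) by - (rule ccontr, auto elim!: mat_assoc_nonzeroE)
      then show ?thesis using False 1 2 by auto
    qed
    finally show "mat (assoc D A B C \<cdot> ainv D A B C) l' l = mat (idm (A \<boxtimes>\<^bsub>D\<^esub> (B \<boxtimes>\<^bsub>D\<^esub> C))) l' l"
      using l by (simp add: dom_def)
  qed
qed

section \<open>The zigzag composites in coordinates\<close>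

text \<open>The associator entry with the unit as intermediate summand on both sides. It is the only
  associator entry that a zigzag composite on a copy of \<open>a\<close> can meet.\<close>

definition dual_coeff :: "'a simple \<Rightarrow> complex" where
  "dual_coeff a = assoc_coeff D a (dsim D a) a (Cs 0) (Cs 0) a"

text \<open>Coevaluation creates and evaluation annihilates unit summands only, so of the associator
  just the entry from unit to unit is used. The first zigzag identity thereby becomes a matrix
  identity between \<open>ev\<close> and \<open>coev\<close>.\<close>

lemma zigzag_left:
  assumes fin: "finite (dom A)" "finite (dom B)"
    and ev: "ev \<in> hom (B \<boxtimes>\<^bsub>D\<^esub> A) unit_obj" and coev: "coev \<in> hom unit_obj (A \<boxtimes>\<^bsub>D\<^esub> B)"
    and i: "A i = Some a" and i': "A i' = Some a"
  shows "mat (runit D A \<cdot> (idm A \<otimes>\<^bsub>D\<^esub> ev) \<cdot> assoc D A B A \<cdot> (coev \<otimes>\<^bsub>D\<^esub> idm A))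
      i' (Node (Leaf (Cs 0)) i a)
    = dual_coeff a * (\<Sum>j\<in>dom B. mat ev (Leaf (Cs 0)) (Node j i (Cs 0)) *
        mat coev (Node i' j (Cs 0)) (Leaf (Cs 0)))"
proof -
  define l0 where "l0 = Node (Leaf (Cs 0)) i a"
  have U: "unit_obj (Leaf (Cs 0)) = Some (Cs 0)" by simp
  define k0 where "k0 = coev \<otimes>\<^bsub>D\<^esub> idm A"
  define k1 where "k1 = assoc D A B A \<cdot> k0"
  define k2 where "k2 = (idm A \<otimes>\<^bsub>D\<^esub> ev) \<cdot> k1"
  have k0: "k0 \<in> hom (unit_obj \<boxtimes>\<^bsub>D\<^esub> A) ((A \<boxtimes>\<^bsub>D\<^esub> B) \<boxtimes>\<^bsub>D\<^esub> A)"
    unfolding k0_def by (intro mtens_hom coev idm_hom)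
  have k1: "k1 \<in> hom (unit_obj \<boxtimes>\<^bsub>D\<^esub> A) (A \<boxtimes>\<^bsub>D\<^esub> (B \<boxtimes>\<^bsub>D\<^esub> A))"
    unfolding k1_def by (intro comp_hom[OF k0] assoc_hom)
  have k2: "k2 \<in> hom (unit_obj \<boxtimes>\<^bsub>D\<^esub> A) (A \<boxtimes>\<^bsub>D\<^esub> unit_obj)"
    unfolding k2_def by (intro comp_hom[OF k1] mtens_hom ev idm_hom)
  have k0_mat: "mat k0 (Node l i a) l0 = mat coev l (Leaf (Cs 0))" for l
    unfolding k0_def l0_def using i by (subst mat_mtens_Node[OF coev idm_hom[of A] U i]) auto
  have k0_nz: "\<exists>m. l = Node m i a \<and> mat coev m (Leaf (Cs 0)) \<noteq> 0" if "mat k0 l l0 \<noteq> 0" for l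
    using that unfolding k0_def
    by (elim mat_mtens_nonzeroE[OF coev idm_hom[of A]]) (auto simp: l0_def i split: if_splits)
  have coev_nz: "\<exists>j. m = Node i1 j (Cs 0)" if "mat coev m (Leaf (Cs 0)) \<noteq> 0" "m = Node i1 j1 t1" for m i1 j1 t1
    using hom_nonzeroD[OF coev that(1)] that(2) by (auto simp: otens_eq_Some_iff)
  have k1_nz: "\<exists>i1 j r. l = Node i1 (Node j i r) a" if nz: "mat k1 l l0 \<noteq> 0" for l
  proof -
    obtain m where m: "mat (assoc D A B A) l m \<noteq> 0" "mat k0 m l0 \<noteq> 0"
      using nz unfolding k1_def mat_comp by (metis (no_types, lifting) mult_not_zero sum.neutral)
    from m(1) k0_nz[OF m(2)] show ?thesis by (elim mat_assoc_nonzeroE) auto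
  qed
  have k1_mat: "mat k1 (Node i1 (Node j i r) a) l0 = mat (assoc D A B A) (Node i1 (Node j i r) a)
      (Node (Node i1 j (Cs 0)) i a) * mat coev (Node i1 j (Cs 0)) (Leaf (Cs 0))" for i1 j r
  proof -
    have "mat k1 (Node i1 (Node j i r) a) l0 = mat (assoc D A B A) (Node i1 (Node j i r) a)
      (Node (Node i1 j (Cs 0)) i a) * mat k0 (Node (Node i1 j (Cs 0)) i a) l0"
      unfolding k1_def
    proof (rule mat_comp_single[OF k0])
      fix m assume m: "mat (assoc D A B A) (Node i1 (Node j i r) a) m \<noteq> 0" "mat k0 m l0 \<noteq> 0"
      from m(1) k0_nz[OF m(2)] show "m = Node (Node i1 j (Cs 0)) i a"
        by (elim mat_assoc_nonzeroE) (auto dest: coev_nz)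
    qed (use fin in auto)
    then show ?thesis by (simp add: k0_mat)
  qed
  have k2_mat: "mat k2 (Node i' (Leaf (Cs 0)) a) l0 = (\<Sum>j\<in>dom B.
      mat (idm A \<otimes>\<^bsub>D\<^esub> ev) (Node i' (Leaf (Cs 0)) a) (Node i' (Node j i (Cs 0)) a)
      * mat k1 (Node i' (Node j i (Cs 0)) a) l0)"
    unfolding k2_def
  proof (rule mat_comp_reindex[OF k1 _ fin(2)])
    fix l assume l: "mat (idm A \<otimes>\<^bsub>D\<^esub> ev) (Node i' (Leaf (Cs 0)) a) l \<noteq> 0" "mat k1 l l0 \<noteq> 0"
    from l(1) obtain j where "l = Node i' j a" "mat ev (Leaf (Cs 0)) j \<noteq> 0"
      by (elim mat_mtens_nonzeroE[OF idm_hom[of A] ev]) (auto split: if_splits)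
    moreover from this hom_nonzeroD[OF ev] have "(B \<boxtimes>\<^bsub>D\<^esub> A) j = Some (Cs 0)"
      by (metis U)
    ultimately show "l \<in> (\<lambda>j. Node i' (Node j i (Cs 0)) a) ` dom B"
      using k1_nz[OF l(2)] by (auto simp: otens_eq_Some_iff)
  qed (use fin in \<open>auto simp: inj_on_def\<close>)
  have summand: "mat (idm A \<otimes>\<^bsub>D\<^esub> ev) (Node i' (Leaf (Cs 0)) a) (Node i' (Node j i (Cs 0)) a)
      * mat k1 (Node i' (Node j i (Cs 0)) a) l0 = dual_coeff a *
      (mat ev (Leaf (Cs 0)) (Node j i (Cs 0)) * mat coev (Node i' j (Cs 0)) (Leaf (Cs 0)))"
    if j: "j \<in> dom B" for j
  proof (cases "mat coev (Node i' j (Cs 0)) (Leaf (Cs 0)) = 0")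
    case True
    then show ?thesis by (simp add: k1_mat)
  next
    case False
    then have "(A \<boxtimes>\<^bsub>D\<^esub> B) (Node i' j (Cs 0)) = Some (Cs 0)"
      using hom_nonzeroD[OF coev False] by auto
    \<comment> \<open>A nonzero coevaluation entry forces summand \<open>j\<close> of
      \<open>B\<close> to be dual to \<open>a\<close>. The associator entry is then
      \<open>dual_coeff a\<close> for every such \<open>j\<close> and can be taken out of the
      sum.\<close>
    then have b: "B j = Some (dsim D a)"
      using i' by (auto simp: otens_eq_Some_iff unit_in_fuse_iff)
    have 0: "Cs 0 \<in> fuse D a (dsim D a)" "Cs 0 \<in> fuse D (dsim D a) a"
      by (auto simp: unit_in_fuse_iff)
    have BA: "(B \<boxtimes>\<^bsub>D\<^esub> A) (Node j i (Cs 0)) = Some (Cs 0)"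
      using b i 0 by (auto simp: otens_eq_Some_iff)
    have "mat k1 (Node i' (Node j i (Cs 0)) a) l0 =
        dual_coeff a * mat coev (Node i' j (Cs 0)) (Leaf (Cs 0))"
      unfolding k1_mat dual_coeff_def by (subst mat_assoc[where A = A and B = B and C = A, OF i' b i]) (use 0 in auto)
    moreover have "mat (idm A \<otimes>\<^bsub>D\<^esub> ev) (Node i' (Leaf (Cs 0)) a) (Node i' (Node j i (Cs 0)) a)
        = mat ev (Leaf (Cs 0)) (Node j i (Cs 0))"
      using i' by (subst mat_mtens_Node[OF idm_hom[of A] ev i' BA]) auto
    ultimately show ?thesis by simp
  qed
  have "mat (runit D A \<cdot> k2) i' l0 = mat (runit D A) i' (Node i' (Leaf (Cs 0)) a)
      * mat k2 (Node i' (Leaf (Cs 0)) a) l0"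
  proof (rule mat_comp_single[OF k2])
    show "j = Node i' (Leaf (Cs 0)) a" if "mat (runit D A) i' j \<noteq> 0" for j
      using mat_runit_nonzero[OF that] i' by auto
  qed (use fin in auto)
  also have "\<dots> = mat k2 (Node i' (Leaf (Cs 0)) a) l0"
    using i' by (simp add: mat_runit)
  also have "\<dots> = dual_coeff a * (\<Sum>j\<in>dom B. mat ev (Leaf (Cs 0)) (Node j i (Cs 0)) *
        mat coev (Node i' j (Cs 0)) (Leaf (Cs 0)))"
    unfolding k2_mat sum_distrib_left by (intro sum.cong refl summand)
  finally show ?thesis unfolding k2_def k1_def k0_def l0_def .
qed

text \<open>Mirror image of the previous computation: the inverse associator takes the place of the
  associator, and the contraction runs over the labels of \<open>A\<close>. It serves only to verify
  that the constructed object is a dual.\<close>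

lemma zigzag_right:
  assumes fin: "finite (dom A)" "finite (dom B)"
    and ev: "ev \<in> hom (B \<boxtimes>\<^bsub>D\<^esub> A) unit_obj" and coev: "coev \<in> hom unit_obj (A \<boxtimes>\<^bsub>D\<^esub> B)"
    and j: "B j = Some b" and j': "B j' = Some b"
  shows "mat (lunit D B \<cdot> (ev \<otimes>\<^bsub>D\<^esub> idm B) \<cdot> ainv D B A B \<cdot> (idm B \<otimes>\<^bsub>D\<^esub> coev))
      j' (Node j (Leaf (Cs 0)) b)
    = ainv_coeff D b (dsim D b) b (Cs 0) (Cs 0) b *
      (\<Sum>i\<in>dom A. mat ev (Leaf (Cs 0)) (Node j i (Cs 0)) *
        mat coev (Node i j' (Cs 0)) (Leaf (Cs 0)))"
proof -
  define l0 where "l0 = Node j (Leaf (Cs 0)) b"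
  have U: "unit_obj (Leaf (Cs 0)) = Some (Cs 0)" by simp
  define k0 where "k0 = idm B \<otimes>\<^bsub>D\<^esub> coev"
  define k1 where "k1 = ainv D B A B \<cdot> k0"
  define k2 where "k2 = (ev \<otimes>\<^bsub>D\<^esub> idm B) \<cdot> k1"
  have k0: "k0 \<in> hom (B \<boxtimes>\<^bsub>D\<^esub> unit_obj) (B \<boxtimes>\<^bsub>D\<^esub> (A \<boxtimes>\<^bsub>D\<^esub> B))"
    unfolding k0_def by (intro mtens_hom coev idm_hom)
  have k1: "k1 \<in> hom (B \<boxtimes>\<^bsub>D\<^esub> unit_obj) ((B \<boxtimes>\<^bsub>D\<^esub> A) \<boxtimes>\<^bsub>D\<^esub> B)"
    unfolding k1_def by (intro comp_hom[OF k0] ainv_hom)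
  have k2: "k2 \<in> hom (B \<boxtimes>\<^bsub>D\<^esub> unit_obj) (unit_obj \<boxtimes>\<^bsub>D\<^esub> B)"
    unfolding k2_def by (intro comp_hom[OF k1] mtens_hom ev idm_hom)
  have k0_mat: "mat k0 (Node j l b) l0 = mat coev l (Leaf (Cs 0))" for l
    unfolding k0_def l0_def using j by (subst mat_mtens_Node[OF idm_hom[of B] coev j U]) auto
  have k0_nz: "\<exists>m. l = Node j m b \<and> mat coev m (Leaf (Cs 0)) \<noteq> 0" if "mat k0 l l0 \<noteq> 0" for l
    using that unfolding k0_def
    by (elim mat_mtens_nonzeroE[OF idm_hom[of B] coev]) (auto simp: l0_def j split: if_splits)
  have coev_nz: "m = Node i1 j1 (Cs 0)" if "mat coev m (Leaf (Cs 0)) \<noteq> 0" "m = Node i1 j1 t1" for m i1 j1 t1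
    using hom_nonzeroD[OF coev that(1)] that(2) by (auto simp: otens_eq_Some_iff)
  have k1_nz: "\<exists>i j1 t. l = Node (Node j i t) j1 b" if nz: "mat k1 l l0 \<noteq> 0" for l
  proof -
    obtain m where m: "mat (ainv D B A B) l m \<noteq> 0" "mat k0 m l0 \<noteq> 0"
      using nz unfolding k1_def mat_comp by (metis (no_types, lifting) mult_not_zero sum.neutral)
    from m(1) k0_nz[OF m(2)] show ?thesis by (elim mat_ainv_nonzeroE) auto
  qed
  have k1_mat: "mat k1 (Node (Node j i t) j1 b) l0 = mat (ainv D B A B) (Node (Node j i t) j1 b)
      (Node j (Node i j1 (Cs 0)) b) * mat coev (Node i j1 (Cs 0)) (Leaf (Cs 0))" for i j1 t
  proof -
    have "mat k1 (Node (Node j i t) j1 b) l0 = mat (ainv D B A B) (Node (Node j i t) j1 b)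
      (Node j (Node i j1 (Cs 0)) b) * mat k0 (Node j (Node i j1 (Cs 0)) b) l0"
      unfolding k1_def
    proof (rule mat_comp_single[OF k0])
      fix m assume m: "mat (ainv D B A B) (Node (Node j i t) j1 b) m \<noteq> 0" "mat k0 m l0 \<noteq> 0"
      from m(1) k0_nz[OF m(2)] show "m = Node j (Node i j1 (Cs 0)) b"
        by (elim mat_ainv_nonzeroE) (auto dest: coev_nz)
    qed (use fin in auto)
    then show ?thesis by (simp add: k0_mat)
  qed
  have k2_mat: "mat k2 (Node (Leaf (Cs 0)) j' b) l0 = (\<Sum>i\<in>dom A.
      mat (ev \<otimes>\<^bsub>D\<^esub> idm B) (Node (Leaf (Cs 0)) j' b) (Node (Node j i (Cs 0)) j' b)
      * mat k1 (Node (Node j i (Cs 0)) j' b) l0)"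
    unfolding k2_def
  proof (rule mat_comp_reindex[OF k1 _ fin(1)])
    fix l assume l: "mat (ev \<otimes>\<^bsub>D\<^esub> idm B) (Node (Leaf (Cs 0)) j' b) l \<noteq> 0" "mat k1 l l0 \<noteq> 0"
    from l(1) obtain i where "l = Node i j' b" "mat ev (Leaf (Cs 0)) i \<noteq> 0"
      by (elim mat_mtens_nonzeroE[OF ev idm_hom[of B]]) (auto split: if_splits)
    moreover from this hom_nonzeroD[OF ev] have "(B \<boxtimes>\<^bsub>D\<^esub> A) i = Some (Cs 0)"
      by (metis U)
    ultimately show "l \<in> (\<lambda>i. Node (Node j i (Cs 0)) j' b) ` dom A"
      using k1_nz[OF l(2)] by (auto simp: otens_eq_Some_iff)
  qed (use fin in \<open>auto simp: inj_on_def\<close>)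
  have summand: "mat (ev \<otimes>\<^bsub>D\<^esub> idm B) (Node (Leaf (Cs 0)) j' b) (Node (Node j i (Cs 0)) j' b)
      * mat k1 (Node (Node j i (Cs 0)) j' b) l0 = ainv_coeff D b (dsim D b) b (Cs 0) (Cs 0) b *
      (mat ev (Leaf (Cs 0)) (Node j i (Cs 0)) * mat coev (Node i j' (Cs 0)) (Leaf (Cs 0)))"
    for i
  proof (cases "mat coev (Node i j' (Cs 0)) (Leaf (Cs 0)) = 0")
    case True
    then show ?thesis by (simp add: k1_mat)
  next
    case False
    then have "(A \<boxtimes>\<^bsub>D\<^esub> B) (Node i j' (Cs 0)) = Some (Cs 0)"
      using hom_nonzeroD[OF coev False] by auto
    then have a: "A i = Some (dsim D b)"
      using j' by (auto simp: otens_eq_Some_iff unit_in_fuse_iff')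
    have 0: "Cs 0 \<in> fuse D b (dsim D b)" "Cs 0 \<in> fuse D (dsim D b) b"
      by (auto simp: unit_in_fuse_iff)
    have BA: "(B \<boxtimes>\<^bsub>D\<^esub> A) (Node j i (Cs 0)) = Some (Cs 0)"
      using a j 0 by (auto simp: otens_eq_Some_iff)
    have "mat k1 (Node (Node j i (Cs 0)) j' b) l0 =
        ainv_coeff D b (dsim D b) b (Cs 0) (Cs 0) b * mat coev (Node i j' (Cs 0)) (Leaf (Cs 0))"
      unfolding k1_mat by (subst mat_ainv[where A = B and B = A and C = B, OF j a j']) (use 0 in auto)
    moreover have "mat (ev \<otimes>\<^bsub>D\<^esub> idm B) (Node (Leaf (Cs 0)) j' b) (Node (Node j i (Cs 0)) j' b)
        = mat ev (Leaf (Cs 0)) (Node j i (Cs 0))"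
      using j' by (subst mat_mtens_Node[OF ev idm_hom[of B] BA j']) auto
    ultimately show ?thesis by simp
  qed
  have "mat (lunit D B \<cdot> k2) j' l0 = mat (lunit D B) j' (Node (Leaf (Cs 0)) j' b)
      * mat k2 (Node (Leaf (Cs 0)) j' b) l0"
  proof (rule mat_comp_single[OF k2])
    show "i = Node (Leaf (Cs 0)) j' b" if "mat (lunit D B) j' i \<noteq> 0" for i
      using mat_lunit_nonzero[OF that] j' by auto
  qed (use fin in auto)
  also have "\<dots> = mat k2 (Node (Leaf (Cs 0)) j' b) l0"
    using j' by (simp add: mat_lunit)
  also have "\<dots> = ainv_coeff D b (dsim D b) b (Cs 0) (Cs 0) b *
      (\<Sum>i\<in>dom A. mat ev (Leaf (Cs 0)) (Node j i (Cs 0)) *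
        mat coev (Node i j' (Cs 0)) (Leaf (Cs 0)))"
    unfolding k2_mat sum_distrib_left by (intro sum.cong refl summand)
  finally show ?thesis unfolding k2_def k1_def k0_def l0_def .
qed

end

section \<open>Braiding, twist and trace\<close>

lemma phi_at_hom:
  assumes "phi U \<in> hom (gobj (und U)) (und U)"
  shows "phi_at h U \<in> hom (hobj h (und U)) (und U)"
  using assms by (cases h) auto

lemma eobj_phi_hom: "is_eobj U \<Longrightarrow> phi U \<in> hom (gobj (und U)) (und U)"
  and eobj_finite: "is_eobj U \<Longrightarrow> finite (dom (und U))"
  by (auto simp: is_eobj_def)

lemma hobj_eq_Some: "A i = Some a \<Longrightarrow> hobj h A i = Some (case h of Z2_one \<Rightarrow> a | Z2_gen \<Rightarrow> gsim a)"
  by (cases h) auto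

text \<open>In degree g the action does not change the class of a group element, hence not its
  product with an object \<open>X\<close>. So the crossed braiding can keep the label
  \<open>t\<close> of a summand.\<close>

lemma fuse_hobj:
  "fuse D (case grade a of Z2_one \<Rightarrow> b | Z2_gen \<Rightarrow> gsim b) a = fuse D a b"
  by (cases "grade a") (auto simp: fuse_gsim fuse_commute[of D _ a])

section \<open>Entries of the equivariant braiding\<close>

text \<open>Projection, crossed braiding and inclusion each send a label to a multiple of a single
  label. Only \<phi> can mix labels, and it acts on the label of \<open>V\<close> alone, so no sum
  remains in the composite.\<close>

lemma mat_braid_component:
  fixes D :: "'a::{finite,ab_group_add} crossed_data"
  assumes phi: "phi V \<in> hom (gobj B) B" and B: "B = und V" and fin: "finite (dom A)" "finite (dom B)"
    and i: "A i = Some a" and j: "B j = Some b" and t: "t \<in> fuse D a b"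
  shows "mat ((idm B \<otimes>\<^bsub>D\<^esub> incl h A) \<cdot> (phi_at h V \<otimes>\<^bsub>D\<^esub> idm (part h A)) \<cdot>
      braid D h (part h A) B \<cdot> (proj h A \<otimes>\<^bsub>D\<^esub> idm B)) (Node j' i' t') (Node i j t)
    = (if grade a = h \<and> i' = i \<and> t' = t then braid_coeff D a b t * mat (phi_at h V) j' j else 0)"
    (is "mat (?k3 \<cdot> ?k2 \<cdot> ?k1 \<cdot> ?k0) _ ?l0 = _")
proof -
  have pa: "phi_at h V \<in> hom (hobj h B) B"
    using phi_at_hom[of V h] phi B by simp
  have incl: "incl h A \<in> hom (part h A) A" and proj: "proj h A \<in> hom A (part h A)"
    by (simp_all add: incl_def proj_def)
  have k0: "?k0 \<in> hom (A \<boxtimes>\<^bsub>D\<^esub> B) (part h A \<boxtimes>\<^bsub>D\<^esub> B)"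
    by (intro mtens_hom proj idm_hom)
  have k1': "?k1 \<in> hom (part h A \<boxtimes>\<^bsub>D\<^esub> B) (hobj h B \<boxtimes>\<^bsub>D\<^esub> part h A)"
    by (simp add: braid_def)
  have k2': "?k2 \<in> hom (hobj h B \<boxtimes>\<^bsub>D\<^esub> part h A) (B \<boxtimes>\<^bsub>D\<^esub> part h A)"
    by (intro mtens_hom pa idm_hom)
  have k1: "?k1 \<cdot> ?k0 \<in> hom (A \<boxtimes>\<^bsub>D\<^esub> B) (hobj h B \<boxtimes>\<^bsub>D\<^esub> part h A)"
    by (intro comp_hom[OF k0] k1')
  have k2: "?k2 \<cdot> ?k1 \<cdot> ?k0 \<in> hom (A \<boxtimes>\<^bsub>D\<^esub> B) (B \<boxtimes>\<^bsub>D\<^esub> part h A)"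
    by (intro comp_hom[OF k1] k2')
  have k3': "?k3 \<in> hom (B \<boxtimes>\<^bsub>D\<^esub> part h A) (B \<boxtimes>\<^bsub>D\<^esub> A)"
    by (intro mtens_hom incl idm_hom)
  have k0_mat: "mat ?k0 l ?l0 = (if grade a = h \<and> l = ?l0 then 1 else 0)" for l
  proof (cases "mat ?k0 l ?l0 = 0")
    case True
    moreover have "mat ?k0 ?l0 ?l0 = 1" if "grade a = h"
      using i j that by (subst mat_mtens_Node[OF proj idm_hom[of B] i j t]) (auto simp: proj_def)
    ultimately show ?thesis by auto
  next
    case False
    then obtain m n where l: "l = Node m n t"
      by (elim mat_mtens_nonzeroE[OF proj idm_hom[of B]]) auto
    show ?thesis
      unfolding l using i j by (subst mat_mtens_Node[OF proj idm_hom[of B] i j t]) (auto simp: proj_def)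
  qed
  have k1_mat: "mat (?k1 \<cdot> ?k0) l ?l0 = (if grade a = h \<and> l = Node j i t then braid_coeff D a b t else 0)" for l
  proof (cases "grade a = h")
    case True
    have src: "(part h A \<boxtimes>\<^bsub>D\<^esub> B) ?l0 = Some t" and tgt: "(hobj h B \<boxtimes>\<^bsub>D\<^esub> part h A) (Node j i t) = Some t"
      using i j t True hobj_eq_Some[where A = B, OF j, of h] fuse_hobj[where D = D and a = a and b = b]
      by (auto simp: otens_eq_Some_iff)
    have *: "mat (?k1 \<cdot> ?k0) l ?l0 = mat ?k1 l ?l0 * mat ?k0 ?l0 ?l0"
      by (rule mat_comp_single[OF k0]) (use fin in \<open>auto simp: k0_mat split: if_splits\<close>)
    show ?thesis
    proof (cases "l = Node j i t")
      case True
      then show ?thesis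
        unfolding * k0_mat using src tgt i j \<open>grade a = h\<close> by (simp add: braid_def dom_def part_def)
    next
      case False
      have "mat ?k1 l ?l0 = 0"
      proof (rule ccontr)
        assume nz: "mat ?k1 l ?l0 \<noteq> 0"
        then have "(hobj h B \<boxtimes>\<^bsub>D\<^esub> part h A) l = Some t"
          using hom_nonzeroD[OF k1' nz] src by auto
        then obtain j1 i1 where l: "l = Node j1 i1 t"
          by (auto simp: otens_eq_Some_iff)
        show False using nz False unfolding l by (simp add: braid_def split: if_splits)
      qed
      then show ?thesis using * False by simp
    qed
  next
    case False
    then show ?thesis by (simp add: mat_comp k0_mat)
  qed
  have k2_mat: "mat (?k2 \<cdot> ?k1 \<cdot> ?k0) (Node j' i' t') ?l0 =
    (if grade a = h \<and> i' = i \<and> t' = t then braid_coeff D a b t * mat (phi_at h V) j' j else 0)" for j' i' t'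
  proof (cases "grade a = h")
    case True
    have *: "mat (?k2 \<cdot> ?k1 \<cdot> ?k0) (Node j' i' t') ?l0 = mat ?k2 (Node j' i' t') (Node j i t) * mat (?k1 \<cdot> ?k0) (Node j i t) ?l0"
      by (rule mat_comp_single[OF k1]) (use fin in \<open>auto simp: k1_mat split: if_splits\<close>)
    have i2: "part h A i = Some a" using i True by simp
    have j2: "hobj h B j = Some (case h of Z2_one \<Rightarrow> b | Z2_gen \<Rightarrow> gsim b)"
      using j by (rule hobj_eq_Some)
    have t2: "t \<in> fuse D (case h of Z2_one \<Rightarrow> b | Z2_gen \<Rightarrow> gsim b) a"
      using t True fuse_hobj[where D = D and a = a and b = b] by auto
    show ?thesis
      unfolding * k1_mat mat_mtens_Node[OF pa idm_hom[of "part h A"] j2 i2 t2]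
      using True i by (auto simp: dom_def)
  next
    case False
    then show ?thesis by (subst mat_comp) (simp add: k1_mat)
  qed
  have k3_mat: "mat (?k3 \<cdot> ?k2 \<cdot> ?k1 \<cdot> ?k0) (Node j' i' t') ?l0 = mat (?k2 \<cdot> ?k1 \<cdot> ?k0) (Node j' i' t') ?l0" for j' i' t'
  proof -
    \<comment> \<open>The inclusion acts as the identity only on labels of degree \<open>h\<close>.
      The composite of the other three maps has no entries elsewhere, so this is enough.\<close>
    have id: "mat ?k3 (Node j' i' t') (Node j1 i1 t1) = (if j' = j1 \<and> i' = i1 \<and> t' = t1 then 1 else 0)"
      if "(B \<boxtimes>\<^bsub>D\<^esub> part h A) (Node j1 i1 t1) = Some t1" for j1 i1 t1
    proof -
      from that obtain a1 b1 where *: "B j1 = Some b1" "part h A i1 = Some a1" "t1 \<in> fuse D b1 a1"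
        by (auto simp: otens_eq_Some_iff)
      show ?thesis
        unfolding mat_mtens_Node[OF idm_hom[of B] incl *] using * part_eq_Some[of h A i1 a1]
        by (auto simp: incl_def dom_def simp del: part_eq_Some)
    qed
    have "mat (?k3 \<cdot> ?k2 \<cdot> ?k1 \<cdot> ?k0) (Node j' i' t') ?l0 =
        mat ?k3 (Node j' i' t') (Node j' i' t') * mat (?k2 \<cdot> ?k1 \<cdot> ?k0) (Node j' i' t') ?l0"
    proof (rule mat_comp_single[OF k2])
      fix m assume "mat ?k3 (Node j' i' t') m \<noteq> 0"
      then show "m = Node j' i' t'"
        by (elim mat_mtens_nonzeroE[OF idm_hom[of B] incl]) (auto simp: incl_def split: if_splits)
    qed (use fin in auto)
    moreover have "(B \<boxtimes>\<^bsub>D\<^esub> part h A) (Node j' i' t') = Some t'"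
      if "mat (?k2 \<cdot> ?k1 \<cdot> ?k0) (Node j' i' t') ?l0 \<noteq> 0"
      using hom_nonzeroD[OF k2 that] by (metis lab.inject(2) otens_eq_Some_iff)
    ultimately show ?thesis
      using id by (cases "mat (?k2 \<cdot> ?k1 \<cdot> ?k0) (Node j' i' t') ?l0 = 0") auto
  qed
  show ?thesis unfolding k3_mat k2_mat ..
qed

lemma braid_component_hom:
  assumes "phi V \<in> hom (gobj (und V)) (und V)"
  shows "(idm (und V) \<otimes>\<^bsub>D\<^esub> incl h A) \<cdot> (phi_at h V \<otimes>\<^bsub>D\<^esub> idm (part h A)) \<cdot>
      braid D h (part h A) (und V) \<cdot> (proj h A \<otimes>\<^bsub>D\<^esub> idm (und V)) \<in> hom (A \<boxtimes>\<^bsub>D\<^esub> und V) (und V \<boxtimes>\<^bsub>D\<^esub> A)"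
proof -
  have incl: "incl h A \<in> hom (part h A) A" and proj: "proj h A \<in> hom A (part h A)"
    and braid: "braid D h (part h A) (und V) \<in> hom (part h A \<boxtimes>\<^bsub>D\<^esub> und V) (hobj h (und V) \<boxtimes>\<^bsub>D\<^esub> part h A)"
    by (simp_all add: incl_def proj_def braid_def)
  show ?thesis
    by (rule comp_hom[OF comp_hom[OF comp_hom[OF mtens_hom[OF proj idm_hom] braid]
      mtens_hom[OF phi_at_hom[OF assms] idm_hom]] mtens_hom[OF idm_hom incl]])
qed

lemma ebraid_hom:
  "phi V \<in> hom (gobj (und V)) (und V) \<Longrightarrow>
    ebraid D U V \<in> hom (und U \<boxtimes>\<^bsub>D\<^esub> und V) (und V \<boxtimes>\<^bsub>D\<^esub> und U)"
  unfolding ebraid_def Let_def by (intro madd_hom braid_component_hom)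

lemma mat_ebraid:
  fixes D :: "'a::{finite,ab_group_add} crossed_data"
  assumes "phi V \<in> hom (gobj (und V)) (und V)" "finite (dom (und U))" "finite (dom (und V))"
    and "und U i = Some a" "und V j = Some b" "t \<in> fuse D a b"
  shows "mat (ebraid D U V) (Node j' i' t') (Node i j t)
    = (if i' = i \<and> t' = t then braid_coeff D a b t * mat (phi_at (grade a) V) j' j else 0)"
  unfolding ebraid_def Let_def madd_def mor.sel
    mat_braid_component[OF assms(1) refl assms(2-6)]
  by (cases "grade a") auto

text \<open>In degree 1 the map is the identity, and in degree g every simple object is fixed by the
  action. So \<phi>, used in the degree of the summand, never changes the simple object.\<close>

lemma mat_phi_at_nonzero:
  assumes "phi U \<in> hom (gobj (und U)) (und U)" "mat (phi_at (grade a) U) k i \<noteq> 0" "und U i = Some a"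
  shows "und U k = Some a"
proof (cases "grade a")
  case Z2_one
  then show ?thesis using assms by (simp split: if_splits)
next
  case Z2_gen
  then obtain x where "a = Xs x" by (cases a) auto
  have "mat (phi U) k i \<noteq> 0" using assms(2) Z2_gen by simp
  then obtain b where "gobj (und U) i = Some b" "und U k = Some b"
    using hom_nonzeroD[OF assms(1)] by metis
  then show ?thesis using assms(3) \<open>a = Xs x\<close> by (simp add: gobj_def)
qed

section \<open>Entries of the equivariant twist\<close>

lemma twist_component:
  assumes phi: "phi U \<in> hom (gobj (und U)) (und U)" and fin: "finite (dom (und U))"
  shows "phi_at h U \<cdot> hmor h (incl h (und U)) \<cdot> twist D h (part h (und U)) \<cdot> proj h (und U)
      \<in> hom (und U) (und U)" (is "?hom")
    and "und U i = Some a \<Longrightarrow>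
      mat (phi_at h U \<cdot> hmor h (incl h (und U)) \<cdot> twist D h (part h (und U)) \<cdot> proj h (und U)) j i
      = (if grade a = h then twist_coeff D a * mat (phi_at h U) j i else 0)" (is "_ \<Longrightarrow> ?mat")
proof -
  define A where "A = und U"
  define k0 where "k0 = proj h A"
  define k1 where "k1 = twist D h (part h A) \<cdot> k0"
  define k2 where "k2 = hmor h (incl h A) \<cdot> k1"
  have k0: "k0 \<in> hom A (part h A)"
    by (simp add: k0_def proj_def)
  have tw: "twist D h (part h A) \<in> hom (part h A) (hobj h (part h A))"
    by (simp add: twist_def)
  have inc: "hmor h (incl h A) \<in> hom (hobj h (part h A)) (hobj h A)"
    by (cases h) (auto simp: incl_def intro!: gmor_hom)
  have k1: "k1 \<in> hom A (hobj h (part h A))"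
    unfolding k1_def by (rule comp_hom[OF k0 tw])
  have k2: "k2 \<in> hom A (hobj h A)"
    unfolding k2_def by (rule comp_hom[OF k1 inc])
  have pa: "phi_at h U \<in> hom (hobj h A) A"
    using phi_at_hom[OF phi] by (simp add: A_def)
  show ?hom
    using comp_hom[OF k2 pa] unfolding k2_def k1_def k0_def A_def .
  assume i: "und U i = Some a"
  have k0_mat: "mat k0 l i = (if grade a = h \<and> l = i then 1 else 0)" for l
    using i by (auto simp: k0_def proj_def A_def part_def dom_def)
  have k1_mat: "mat k1 l i = (if grade a = h \<and> l = i then twist_coeff D a else 0)" for l
  proof -
    have "mat k1 l i = mat (twist D h (part h A)) l i * mat k0 i i"
      unfolding k1_def
      by (rule mat_comp_single[OF k0]) (use fin in \<open>auto simp: k0_mat A_def split: if_splits\<close>)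
    also have "\<dots> = (if grade a = h \<and> l = i then twist_coeff D a else 0)"
    proof (cases "grade a = h")
      case True
      have pi: "part h A i = Some a"
        using i True by (simp add: A_def)
      \<comment> \<open>In degree g the object \<open>a\<close> is fixed by the action, so the
        diagonal entries of the twist survive the restriction made by \<open>morph\<close>.\<close>
      have "hobj h (part h A) i = Some a"
        using pi True by (cases h; cases a) (simp_all add: gobj_def del: part_eq_Some)
      then have "mat (twist D h (part h A)) l i = (if l = i then twist_coeff D a else 0)"
        by (simp add: twist_def dom_def pi del: part_eq_Some)
      then show ?thesis using True by (simp add: k0_mat)
    qed (simp add: k0_mat)
    finally show ?thesis .
  qed
  have k2_mat: "mat k2 l i = (if grade a = h \<and> l = i then twist_coeff D a else 0)" for l
  proof -
    have "mat k2 l i = mat (hmor h (incl h A)) l i * mat k1 i i"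
      unfolding k2_def
      by (rule mat_comp_single[OF k1]) (use fin in \<open>auto simp: k1_mat A_def split: if_splits\<close>)
    also have "\<dots> = (if grade a = h \<and> l = i then twist_coeff D a else 0)"
    proof (cases "grade a = h")
      case True
      have pi: "part h A i = Some a" and Ai: "A i = Some a"
        using i True by (simp_all add: A_def)
      have "mat (hmor h (incl h A)) l i = mat (incl h A) l i"
        by (cases h) auto
      also have "\<dots> = (if l = i then 1 else 0)"
        by (simp add: incl_def dom_def pi Ai del: part_eq_Some)
      finally show ?thesis using True by (simp add: k1_mat)
    qed (simp add: k1_mat)
    finally show ?thesis .
  qed
  have "mat (phi_at h U \<cdot> k2) j i = mat (phi_at h U) j i * mat k2 i i"
    by (rule mat_comp_single[OF k2]) (use fin in \<open>auto simp: k2_mat A_def split: if_splits\<close>)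
  also have "\<dots> = (if grade a = h then twist_coeff D a * mat (phi_at h U) j i else 0)"
    by (simp only: k2_mat) (simp add: mult.commute)
  finally show ?mat unfolding k2_def k1_def k0_def A_def .
qed

lemma etwist_hom:
  assumes "phi U \<in> hom (gobj (und U)) (und U)" "finite (dom (und U))"
  shows "etwist D U \<in> hom (und U) (und U)"
  unfolding etwist_def Let_def by (intro madd_hom twist_component(1) assms)

lemma mat_etwist:
  assumes "phi U \<in> hom (gobj (und U)) (und U)" "finite (dom (und U))" "und U i = Some a"
  shows "mat (etwist D U) j i = twist_coeff D a * mat (phi_at (grade a) U) j i"
  unfolding etwist_def Let_def madd_def mor.sel twist_component(2)[OF assms]
  by (cases "grade a") auto

section \<open>Equivariant structure on tensor products\<close>

lemma tau_hom: "tau D A B \<in> hom (gobj (A \<boxtimes>\<^bsub>D\<^esub> B)) (gobj A \<boxtimes>\<^bsub>D\<^esub> gobj B)"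
  by (simp add: tau_def)

lemma mat_tau:
  assumes "A i = Some a" "B j = Some b" "t \<in> fuse D a b"
  shows "mat (tau D A B) l (Node i j t)
    = (if l = Node i j (gsim t) then tau_coeff D a b t else 0)"
proof -
  have src: "gobj (A \<boxtimes>\<^bsub>D\<^esub> B) (Node i j t) = Some (gsim t)"
    using assms by (auto simp: gobj_def otens_Node)
  have tgt: "(gobj A \<boxtimes>\<^bsub>D\<^esub> gobj B) (Node i j (gsim t)) = Some (gsim t)"
    using assms gsim_fuse_iff[of t D a b] by (auto simp: otens_eq_Some_iff gobj_def)
  show ?thesis
  proof (cases "l = Node i j (gsim t)")
    case True
    then show ?thesis by (simp add: tau_def dom_def src tgt assms(1,2) del: gobj_eq_Some)
  next
    case False
    have "mat (tau D A B) l (Node i j t) = 0"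
    proof (rule ccontr)
      assume nz: "mat (tau D A B) l (Node i j t) \<noteq> 0"
      then have "(gobj A \<boxtimes>\<^bsub>D\<^esub> gobj B) l = Some (gsim t)"
        using hom_nonzeroD[OF tau_hom nz] src by (metis)
      then obtain i' j' where l: "l = Node i' j' (gsim t)"
        by (auto simp: otens_eq_Some_iff)
      show False using nz False unfolding l by (simp add: tau_def split: if_splits)
    qed
    then show ?thesis using False by simp
  qed
qed

lemma und_etens [simp]: "und (etens D U V) = und U \<boxtimes>\<^bsub>D\<^esub> und V"
  by (simp add: etens_def)

lemma phi_etens_hom:
  assumes "phi U \<in> hom (gobj (und U)) (und U)" "phi V \<in> hom (gobj (und V)) (und V)"
  shows "phi (etens D U V) \<in> hom (gobj (und U \<boxtimes>\<^bsub>D\<^esub> und V)) (und U \<boxtimes>\<^bsub>D\<^esub> und V)"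
  unfolding etens_def eobj.sel by (intro comp_hom[OF tau_hom] mtens_hom assms)

lemma mat_phi_etens:
  fixes D :: "'a::{finite,ab_group_add} crossed_data"
  assumes U: "phi U \<in> hom (gobj (und U)) (und U)" and V: "phi V \<in> hom (gobj (und V)) (und V)"
    and fin: "finite (dom (und U))" "finite (dom (und V))"
    and i: "und U i = Some a" and j: "und V j = Some b" and t: "t \<in> fuse D a b"
  shows "mat (phi (etens D U V)) (Node i' j' t') (Node i j t)
    = (if t' = gsim t then tau_coeff D a b t * mat (phi U) i' i * mat (phi V) j' j else 0)"
proof -
  have "mat (phi (etens D U V)) (Node i' j' t') (Node i j t)
    = mat (phi U \<otimes>\<^bsub>D\<^esub> phi V) (Node i' j' t') (Node i j (gsim t)) *
      mat (tau D (und U) (und V)) (Node i j (gsim t)) (Node i j t)"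
    unfolding etens_def eobj.sel
    by (rule mat_comp_single[OF tau_hom])
      (use fin i j t in \<open>auto simp: mat_tau[where A = "und U" and B = "und V"] split: if_splits\<close>)
  also have "mat (phi U \<otimes>\<^bsub>D\<^esub> phi V) (Node i' j' t') (Node i j (gsim t)) =
      (if t' = gsim t then mat (phi U) i' i * mat (phi V) j' j else 0)"
  proof (rule mat_mtens_Node[OF U V])
    show "gobj (und U) i = Some (gsim a)" "gobj (und V) j = Some (gsim b)" using i j by auto
    show "gsim t \<in> fuse D (gsim a) (gsim b)" using t by (simp add: gsim_fuse_iff)
  qed
  finally show ?thesis
    using i j t by (simp add: mat_tau[where A = "und U" and B = "und V"])
qed

lemma eobj_phi_sq:
  assumes "is_eobj U" "i \<in> dom (und U)"
  shows "(\<Sum>j\<in>dom (und U). mat (phi U) k j * mat (phi U) j i) = (if k = i then 1 else 0)"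
proof -
  have "mat (phi U \<cdot> gmor (phi U)) k i = mat (idm (und U)) k i"
    using assms by (simp add: is_eobj_def)
  moreover have "tgt (phi U) = und U"
    using eobj_phi_hom[OF assms(1)] by (simp add: tgt_hom)
  ultimately show ?thesis using assms(2) by (simp add: mat_comp)
qed

lemma phi_nonzero:
  assumes "phi U \<in> hom (gobj (und U)) (und U)" "mat (phi U) k i \<noteq> 0" "und U i = Some a"
  shows "und U k = Some (gsim a)"
proof -
  obtain b where "gobj (und U) i = Some b" and k: "und U k = Some b"
    using hom_nonzeroD[OF assms(1,2)] by metis
  then have "a = gsim b" using assms(3) by simp
  then show ?thesis using k by simp
qed

lemma is_eobjI:
  assumes fin: "finite (dom (und U))" and phi: "phi U \<in> hom (gobj (und U)) (und U)"
    and sq: "\<And>i k a. und U i = Some a \<Longrightarrow> und U k = Some a \<Longrightarrow>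
      (\<Sum>j\<in>dom (und U). mat (phi U) k j * mat (phi U) j i) = (if k = i then 1 else 0)"
  shows "is_eobj U"
proof -
  have "phi U \<cdot> gmor (phi U) = idm (und U)"
  proof (rule hom_eqI)
    have "gobj (gobj (und U)) i = und U i" for i
      by (cases "und U i") (simp_all add: gobj_def)
    then have "gobj (gobj (und U)) = und U" by (rule ext)
    then show "phi U \<cdot> gmor (phi U) \<in> hom (und U) (und U)"
      using comp_hom[OF gmor_hom[OF phi] phi] by simp
    show "mat (phi U \<cdot> gmor (phi U)) k i = mat (idm (und U)) k i"
      if "und U i = Some a" "und U k = Some a" for i k a
      using sq[OF that] that by (auto simp: mat_comp tgt_hom[OF phi])
  qed simp
  then show ?thesis using fin phi by (simp add: is_eobj_def)
qed

section \<open>The trace formula for an arbitrary dual\<close>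

text \<open>In degree g this is \<alpha>\<beta> divided by the associator scalar
  \<open>\<epsilon> |2\<Gamma>|^(-1/2)\<close>, where \<epsilon> is its own inverse.\<close>

definition qdim :: "'a::{finite,ab_group_add} crossed_data \<Rightarrow> 'a simple \<Rightarrow> complex" where
  "qdim D a = (case a of Cs _ \<Rightarrow> 1 | Xs _ \<Rightarrow> eps D * alp D * bet D * root2 TYPE('a))"

lemma eunit_sel [simp]:
  "und eunit = unit_obj"
  "phi eunit = morph (gobj unit_obj) unit_obj (\<lambda>j i. if j = i then 1 else 0)"
  by (simp_all add: eunit_def)

lemma phi_eunit_hom: "phi eunit \<in> hom (gobj unit_obj) unit_obj"
  by simp

lemma mat_phi_eunit:
  "mat (phi (eunit :: 'a::ab_group_add eobj)) l (Leaf (Cs 0)) = (if l = Leaf (Cs 0) then 1 else 0)"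
proof -
  have "gobj unit_obj (Leaf (Cs (0 :: 'a))) = Some (Cs 0)" "unit_obj (Leaf (Cs (0 :: 'a))) = Some (Cs 0)"
    by auto
  then show ?thesis
    by (cases "l = Leaf (Cs 0)") (simp_all add: dom_def del: gobj_eq_Some unit_obj_eq_Some)
qed

lemma dom_otens_unitD:
  "(A \<boxtimes>\<^bsub>D\<^esub> B) l = Some (Cs 0) \<Longrightarrow> \<exists>i j a. l = Node i j (Cs 0) \<and> A i = Some a \<and> B j = Some (dsim D a)"
  by (auto simp: otens_eq_Some_iff unit_in_fuse_iff)

lemma otens_unitI: "A i = Some a \<Longrightarrow> B j = Some (dsim D a) \<Longrightarrow> (A \<boxtimes>\<^bsub>D\<^esub> B) (Node i j (Cs 0)) = Some (Cs 0)"
  by (auto simp: otens_eq_Some_iff unit_in_fuse_iff)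

lemma hom_to_unit_nonzero:
  assumes "f \<in> hom (A \<boxtimes>\<^bsub>D\<^esub> B) unit_obj" "mat f l m \<noteq> 0"
  shows "\<exists>i j a. m = Node i j (Cs 0) \<and> A i = Some a \<and> B j = Some (dsim D a)"
  using hom_nonzeroD[OF assms] dom_otens_unitD[of A D B m] by auto

lemma hom_from_unit_nonzero:
  assumes "f \<in> hom unit_obj (A \<boxtimes>\<^bsub>D\<^esub> B)" "mat f m l \<noteq> 0"
  shows "\<exists>i j a. m = Node i j (Cs 0) \<and> A i = Some a \<and> B j = Some (dsim D a)"
  using hom_nonzeroD[OF assms] dom_otens_unitD[of A D B m] by auto

lemma mat_comp_phi_etens:
  fixes D :: "'a::{finite,ab_group_add} crossed_data"
  assumes W: "phi W \<in> hom (gobj (und W)) (und W)" and U: "phi U \<in> hom (gobj (und U)) (und U)"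
    and fin: "finite (dom (und W))" "finite (dom (und U))"
    and ev: "ev \<in> hom (und W \<boxtimes>\<^bsub>D\<^esub> und U) unit_obj"
    and j: "und W j = Some b" and i: "und U i = Some (dsim D b)"
  shows "mat (ev \<cdot> phi (etens D W U)) (Leaf (Cs 0)) (Node j i (Cs 0)) =
    tau_coeff D b (dsim D b) (Cs 0) *
    (\<Sum>j'\<in>dom (und W). \<Sum>i'\<in>dom (und U).
       mat ev (Leaf (Cs 0)) (Node j' i' (Cs 0)) * mat (phi W) j' j * mat (phi U) i' i)"
proof -
  have 0: "Cs 0 \<in> fuse D b (dsim D b)" by (simp add: unit_in_fuse_iff)
  have "mat (ev \<cdot> phi (etens D W U)) (Leaf (Cs 0)) (Node j i (Cs 0)) =
    (\<Sum>x\<in>dom (und W) \<times> dom (und U). mat ev (Leaf (Cs 0)) (case x of (j', i') \<Rightarrow> Node j' i' (Cs 0)) *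
      mat (phi (etens D W U)) (case x of (j', i') \<Rightarrow> Node j' i' (Cs 0)) (Node j i (Cs 0)))"
  proof (rule mat_comp_reindex[OF phi_etens_hom[OF W U]])
    fix m assume "mat ev (Leaf (Cs 0)) m \<noteq> 0"
    from hom_to_unit_nonzero[OF ev this]
    show "m \<in> (\<lambda>x. case x of (j', i') \<Rightarrow> Node j' i' (Cs 0)) ` (dom (und W) \<times> dom (und U))"
      by force
  qed (use fin in \<open>auto simp: inj_on_def\<close>)
  also have "\<dots> = (\<Sum>j'\<in>dom (und W). \<Sum>i'\<in>dom (und U). mat ev (Leaf (Cs 0)) (Node j' i' (Cs 0)) *
      mat (phi (etens D W U)) (Node j' i' (Cs 0)) (Node j i (Cs 0)))"
    by (simp add: sum.cartesian_product split_def)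
  also have "\<dots> = (\<Sum>j'\<in>dom (und W). \<Sum>i'\<in>dom (und U). mat ev (Leaf (Cs 0)) (Node j' i' (Cs 0)) *
      (tau_coeff D b (dsim D b) (Cs 0) * mat (phi W) j' j * mat (phi U) i' i))"
    by (simp add: mat_phi_etens[OF W U fin j i 0])
  finally show ?thesis by (simp add: sum_distrib_left mult_ac)
qed

text \<open>Compatibility of \<open>ev\<close> with the actions, read off at one unit summand; the
  action on the unit object is 1, so the right-hand composite is \<open>ev\<close> itself.\<close>

lemma ev_equivariant:
  fixes D :: "'a::{finite,ab_group_add} crossed_data"
  assumes W: "is_eobj W" and U: "is_eobj U" and ev: "ev \<in> ehom (etens D W U) eunit"
    and j: "und W j = Some b" and i: "und U i = Some (dsim D b)"
  shows "mat ev (Leaf (Cs 0)) (Node j i (Cs 0)) =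
    tau_coeff D b (dsim D b) (Cs 0) *
    (\<Sum>j'\<in>dom (und W). \<Sum>i'\<in>dom (und U).
       mat ev (Leaf (Cs 0)) (Node j' i' (Cs 0)) * mat (phi W) j' j * mat (phi U) i' i)"
proof -
  have evh: "ev \<in> hom (und W \<boxtimes>\<^bsub>D\<^esub> und U) unit_obj"
    and eq: "ev \<cdot> phi (etens D W U) = phi eunit \<cdot> gmor ev"
    using ev by (simp_all add: ehom_def)
  have "mat (phi eunit \<cdot> gmor ev) (Leaf (Cs 0)) (Node j i (Cs 0)) =
      mat (phi (eunit :: 'a eobj)) (Leaf (Cs 0)) (Leaf (Cs 0)) * mat (gmor ev) (Leaf (Cs 0)) (Node j i (Cs 0))"
  proof (rule mat_comp_single)
    show "gmor ev \<in> hom (gobj (und W \<boxtimes>\<^bsub>D\<^esub> und U)) (gobj unit_obj)"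
      by (rule gmor_hom[OF evh])
  qed (auto split: if_splits)
  also have "\<dots> = mat ev (Leaf (Cs 0)) (Node j i (Cs 0))"
    unfolding mat_phi_eunit by simp
  finally show ?thesis
    using mat_comp_phi_etens[OF eobj_phi_hom[OF W] eobj_phi_hom[OF U] eobj_finite[OF W] eobj_finite[OF U] evh j i]
    by (simp only: eq)
qed

text \<open>Nonzero entries keep the simple object, hence also the degree, so both factors use the
  same map: either the identity or \<phi>, whose square is the identity.\<close>

lemma phi_at_sq:
  assumes U: "is_eobj U" and m: "und U m = Some a"
  shows "(\<Sum>i\<in>dom (und U). mat (phi_at (grade (the (und U i))) U) k i * mat (phi_at (grade a) U) i m)
    = (if k = m then 1 else 0)"
proof -
  have mdom: "m \<in> dom (und U)" using m by auto
  have P: "und U i = Some a" if "mat (phi_at (grade a) U) i m \<noteq> 0" for i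
    using mat_phi_at_nonzero[OF eobj_phi_hom[OF U] that m] .
  have "(\<Sum>i\<in>dom (und U). mat (phi_at (grade (the (und U i))) U) k i * mat (phi_at (grade a) U) i m)
    = (\<Sum>i\<in>dom (und U). mat (phi_at (grade a) U) k i * mat (phi_at (grade a) U) i m)"
    using P by (intro sum.cong refl) (metis mult_zero_right option.sel)
  also have "\<dots> = (if k = m then 1 else 0)"
  proof (cases "grade a")
    case Z2_one
    have "(\<Sum>i\<in>dom (und U). mat (phi_at (grade a) U) k i * mat (phi_at (grade a) U) i m)
      = (\<Sum>i\<in>dom (und U). if i = m then mat (phi_at (grade a) U) k i else 0)"
      using Z2_one by (intro sum.cong) auto
    then show ?thesis using m Z2_one eobj_finite[OF U] by (auto simp: sum.delta)
  next
    case Z2_gen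
    then show ?thesis using eobj_phi_sq[OF U mdom, of k] by simp
  qed
  finally show ?thesis .
qed

context crossed begin

text \<open>In degree 1 both sides reduce to \<open>\<omega>(b,-b,b)\<close>, which is its own
  inverse; in degree g both are \<alpha>\<beta>. The factor \<open>dual_coeff\<close> is kept apart
  because the zigzag identity will absorb it.\<close>

lemma braid_twist_coeff:
  "braid_coeff D a (dsim D a) (Cs 0) * twist_coeff D a = dual_coeff a * qdim D a"
proof (cases a)
  case (Cs b)
  have "sgf D b (- b) * sgf D b b = inverse (omf D b (- b) b)"
    by (simp add: om_eq mult_ac)
  then show ?thesis using Cs by (simp add: dual_coeff_def qdim_def)
next
  case (Xs x)
  then show ?thesis by (simp add: dual_coeff_def qdim_def field_simps)
qed

text \<open>In degree 1 both sums pick out one entry. In degree g the tensor structure on the unit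
  summand is 1, so inserting the equivariance of \<open>ev\<close> on the right produces \<phi> of
  the object twice, and this product is the identity.\<close>

lemma braid_ev:
  assumes W: "is_eobj W" and U: "is_eobj U" and ev: "ev \<in> ehom (etens D W U) eunit"
    and i: "und U i = Some a" and j: "und W j = Some (dsim D a)"
  shows "(\<Sum>j'\<in>dom (und W). mat ev (Leaf (Cs 0)) (Node j' i (Cs 0)) * mat (phi_at (grade a) W) j' j)
    = (\<Sum>k\<in>dom (und U). mat ev (Leaf (Cs 0)) (Node j k (Cs 0)) * mat (phi_at (grade a) U) k i)"
proof (cases a)
  case (Cs b)
  have *: "(\<Sum>k\<in>dom M. f k * (if x \<in> dom M \<and> k = x then 1 else 0)) = f x"
    if "finite (dom M)" "M x = Some y" for f :: "'a lab \<Rightarrow> complex" and M x and y :: "'a simple"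
    using that by (simp add: if_distrib[of "\<lambda>u. f _ * u"] dom_def sum.delta cong: if_cong)
  show ?thesis
    using *[where M = "und W", OF eobj_finite[OF W] j] *[where M = "und U", OF eobj_finite[OF U] i] Cs by simp
next
  case (Xs x)
  let ?L = "Leaf (Cs 0)"
  have inv: "mat ev ?L (Node j k (Cs 0)) = (\<Sum>j'\<in>dom (und W). \<Sum>i'\<in>dom (und U).
       mat ev ?L (Node j' i' (Cs 0)) * mat (phi W) j' j * mat (phi U) i' k)" if "und U k = Some a" for k
    using ev_equivariant[OF W U ev j, of k] that Xs by simp
  have "(\<Sum>k\<in>dom (und U). mat ev ?L (Node j k (Cs 0)) * mat (phi U) k i)
    = (\<Sum>k\<in>dom (und U). (\<Sum>j'\<in>dom (und W). \<Sum>i'\<in>dom (und U).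
       mat ev ?L (Node j' i' (Cs 0)) * mat (phi W) j' j * mat (phi U) i' k) * mat (phi U) k i)"
  proof (intro sum.cong refl)
    fix k
    show "mat ev ?L (Node j k (Cs 0)) * mat (phi U) k i = (\<Sum>j'\<in>dom (und W). \<Sum>i'\<in>dom (und U).
       mat ev ?L (Node j' i' (Cs 0)) * mat (phi W) j' j * mat (phi U) i' k) * mat (phi U) k i"
    proof (cases "mat (phi U) k i = 0")
      case False
      then have "und U k = Some a"
        using mat_phi_at_nonzero[OF eobj_phi_hom[OF U], of a k i] i Xs by simp
      then show ?thesis using inv by simp
    qed simp
  qed
  also have "\<dots> = (\<Sum>j'\<in>dom (und W). \<Sum>i'\<in>dom (und U). \<Sum>k\<in>dom (und U).
       mat ev ?L (Node j' i' (Cs 0)) * mat (phi W) j' j * (mat (phi U) i' k * mat (phi U) k i))"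
    unfolding sum_distrib_right
    by (subst sum.swap, rule sum.cong[OF refl], subst sum.swap) (simp add: mult.assoc)
  also have "\<dots> = (\<Sum>j'\<in>dom (und W). \<Sum>i'\<in>dom (und U).
       mat ev ?L (Node j' i' (Cs 0)) * mat (phi W) j' j * (if i' = i then 1 else 0))"
    unfolding sum_distrib_left[symmetric] using i by (subst eobj_phi_sq[OF U]) auto
  also have "\<dots> = (\<Sum>j'\<in>dom (und W). mat ev ?L (Node j' i (Cs 0)) * mat (phi W) j' j)"
    using i eobj_finite[OF U] by (intro sum.cong refl) (auto simp: if_distrib sum.delta cong: if_cong)
  finally show ?thesis using Xs by simp
qed

text \<open>Along a closed path of labels the braiding leaves \<phi> on the side of the dual and the
  twist leaves \<phi> on the side of \<open>U\<close>. Once both act on \<open>U\<close> they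
  cancel, and \<open>ev\<close>, \<open>coev\<close> and one associator scalar contract to the
  identity, so that the diagonal of \<open>f\<close> remains.\<close>

theorem trace_formula:
  assumes U: "is_eobj U" and f: "f \<in> hom (und U) (und U)" and dual: "is_dual D U W ev coev"
  shows "mat (ev \<cdot> ebraid D U W \<cdot> ((etwist D U \<cdot> f) \<otimes>\<^bsub>D\<^esub> idm (und W)) \<cdot> coev) (Leaf (Cs 0)) (Leaf (Cs 0))
    = (\<Sum>i\<in>dom (und U). qdim D (the (und U i)) * mat f i i)"
proof -
  define A B L where "A = und U" and "B = und W" and "L = Leaf (Cs (0::'a))"
  \<comment> \<open>\<open>E\<close> and \<open>C\<close> are the unit parts of evaluation and
    coevaluation, \<open>P\<close> is \<phi> taken in the degree of the summand, and
    \<open>fC\<close> is \<open>f\<close> applied to the coevaluation.\<close>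
  define E where "E j i = mat ev L (Node j i (Cs 0))" for j i
  define C where "C i j = mat coev (Node i j (Cs 0)) L" for i j
  define P where "P k i = mat (phi_at (grade (the (A i))) U) k i" for k i
  define F where "F = etwist D U \<cdot> f"
  define fC where "fC m j = (\<Sum>i\<in>dom A. mat f m i * C i j)" for m j
  define bc where "bc i = braid_coeff D (the (A i)) (dsim D (the (A i))) (Cs 0)" for i
  define tw where "tw i = twist_coeff D (the (A i))" for i
  have W: "is_eobj W" and ev: "ev \<in> ehom (etens D W U) eunit" and coev: "coev \<in> ehom eunit (etens D U W)"
    and zz: "runit D A \<cdot> (idm A \<otimes>\<^bsub>D\<^esub> ev) \<cdot> assoc D A B A \<cdot> (coev \<otimes>\<^bsub>D\<^esub> idm A) = lunit D A"
    using dual by (simp_all add: is_dual_def A_def B_def)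
  have evh: "ev \<in> hom (B \<boxtimes>\<^bsub>D\<^esub> A) unit_obj" and coevh: "coev \<in> hom unit_obj (A \<boxtimes>\<^bsub>D\<^esub> B)"
    using ev coev by (simp_all add: ehom_def A_def B_def)
  have finA [simp]: "finite (dom A)" and finB [simp]: "finite (dom B)"
    using U W by (simp_all add: eobj_finite A_def B_def)
  have phU: "phi U \<in> hom (gobj A) A" and phW: "phi W \<in> hom (gobj B) B"
    using U W by (simp_all add: eobj_phi_hom A_def B_def)
  have fA: "f \<in> hom A A" using f by (simp add: A_def)
  have etw: "etwist D U \<in> hom A A"
    using etwist_hom[of U D] phU finA unfolding A_def by simp
  have F: "F \<in> hom A A" unfolding F_def by (rule comp_hom[OF fA etw])
  have FI: "F \<otimes>\<^bsub>D\<^esub> idm B \<in> hom (A \<boxtimes>\<^bsub>D\<^esub> B) (A \<boxtimes>\<^bsub>D\<^esub> B)"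
    by (intro mtens_hom F idm_hom)
  have G1: "(F \<otimes>\<^bsub>D\<^esub> idm B) \<cdot> coev \<in> hom unit_obj (A \<boxtimes>\<^bsub>D\<^esub> B)" (is "?G1 \<in> _")
    by (rule comp_hom[OF coevh FI])
  have br: "ebraid D U W \<in> hom (A \<boxtimes>\<^bsub>D\<^esub> B) (B \<boxtimes>\<^bsub>D\<^esub> A)"
    using ebraid_hom[of W D U] phW by (simp add: A_def B_def)
  have G2: "ebraid D U W \<cdot> ?G1 \<in> hom unit_obj (B \<boxtimes>\<^bsub>D\<^esub> A)" (is "?G2 \<in> _")
    by (rule comp_hom[OF G1 br])
  have P_nz: "A k = A i" if "P k i \<noteq> 0" "i \<in> dom A" for k i
  proof -
    obtain a where a: "A i = Some a" using \<open>i \<in> dom A\<close> by auto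
    have "mat (phi_at (grade a) U) k i \<noteq> 0" using \<open>P k i \<noteq> 0\<close> a by (simp add: P_def)
    then have "und U k = Some a"
      using mat_phi_at_nonzero[of U a k i] phU a unfolding A_def by blast
    then show ?thesis using a by (simp add: A_def)
  qed
  have C_nz: "B j = Some (dsim D a)" if "C i j \<noteq> 0" "A i = Some a" for i j a
    using hom_from_unit_nonzero[OF coevh, of "Node i j (Cs 0)" L] that by (auto simp: C_def)
  have F_mat: "mat F i i' = (\<Sum>m\<in>dom A. P i m * tw m * mat f m i')" for i i'
  proof -
    have "mat F i i' = (\<Sum>m\<in>dom A. mat (etwist D U) i m * mat f m i')"
      using fA by (simp add: F_def mat_comp tgt_hom)
    also have "\<dots> = (\<Sum>m\<in>dom A. P i m * tw m * mat f m i')"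
      using phU finA unfolding A_def
      by (intro sum.cong refl) (auto simp: mat_etwist P_def tw_def A_def mult_ac)
    finally show ?thesis .
  qed
  have G1_mat: "mat ?G1 (Node i j (Cs 0)) L = (\<Sum>m\<in>dom A. P i m * tw m * fC m j)" for i j
  proof -
    have "mat ?G1 (Node i j (Cs 0)) L = (\<Sum>i'\<in>dom A.
        mat (F \<otimes>\<^bsub>D\<^esub> idm B) (Node i j (Cs 0)) (Node i' j (Cs 0)) * mat coev (Node i' j (Cs 0)) L)"
    proof (rule mat_comp_reindex[OF coevh])
      fix m assume m: "mat (F \<otimes>\<^bsub>D\<^esub> idm B) (Node i j (Cs 0)) m \<noteq> 0" "mat coev m L \<noteq> 0"
      obtain i' j' a where *: "m = Node i' j' (Cs 0)" "A i' = Some a"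
        using hom_from_unit_nonzero[OF coevh m(2)] by blast
      have "j' = j" using m(1) unfolding *
        by (elim mat_mtens_nonzeroE[OF F idm_hom[of B]]) (auto split: if_splits)
      then show "m \<in> (\<lambda>i'. Node i' j (Cs 0)) ` dom A" using * by auto
    qed (auto simp: inj_on_def)
    also have "\<dots> = (\<Sum>i'\<in>dom A. mat F i i' * C i' j)"
    proof (intro sum.cong refl)
      fix i' assume "i' \<in> dom A"
      then obtain a where a: "A i' = Some a" by auto
      show "mat (F \<otimes>\<^bsub>D\<^esub> idm B) (Node i j (Cs 0)) (Node i' j (Cs 0)) * mat coev (Node i' j (Cs 0)) L
          = mat F i i' * C i' j"
      proof (cases "C i' j = 0")
        case False
        then have b: "B j = Some (dsim D a)" using C_nz a by blast
        have 0: "Cs 0 \<in> fuse D a (dsim D a)" by (simp add: unit_in_fuse_iff)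
        have "mat (F \<otimes>\<^bsub>D\<^esub> idm B) (Node i j (Cs 0)) (Node i' j (Cs 0)) = mat F i i'"
          using b by (subst mat_mtens_Node[OF F idm_hom[of B] a b 0]) auto
        then show ?thesis by (simp add: C_def)
      qed (simp add: C_def)
    qed
    also have "\<dots> = (\<Sum>m\<in>dom A. \<Sum>i'\<in>dom A. P i m * tw m * mat f m i' * C i' j)"
      unfolding F_mat sum_distrib_right by (rule sum.swap)
    finally show ?thesis by (simp add: fC_def sum_distrib_left mult.assoc)
  qed
  have G1_nz: "B j = Some (dsim D (the (A i)))" if "mat ?G1 (Node i j (Cs 0)) L \<noteq> 0" for i j
    using hom_from_unit_nonzero[OF G1 that] by auto
  have G2_mat: "mat ?G2 (Node j' i (Cs 0)) L = (\<Sum>j\<in>dom B.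
      bc i * mat (phi_at (grade (the (A i))) W) j' j * mat ?G1 (Node i j (Cs 0)) L)" if i: "i \<in> dom A" for j' i
  proof -
    obtain a where a: "A i = Some a" using i by auto
    have brm: "mat (ebraid D U W) (Node j' i'' t') (Node i' j t) =
      (if i'' = i' \<and> t' = t then braid_coeff D a b t * mat (phi_at (grade a) W) j' j else 0)"
      if "A i' = Some a" "B j = Some b" "t \<in> fuse D a b" for a b i' j t i'' t'
      using that phW finA finB unfolding A_def B_def by (intro mat_ebraid) auto
    have "mat ?G2 (Node j' i (Cs 0)) L = (\<Sum>j\<in>dom B.
        mat (ebraid D U W) (Node j' i (Cs 0)) (Node i j (Cs 0)) * mat ?G1 (Node i j (Cs 0)) L)"
    proof (rule mat_comp_reindex[OF G1])
      fix m assume m: "mat (ebraid D U W) (Node j' i (Cs 0)) m \<noteq> 0" "mat ?G1 m L \<noteq> 0"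
      obtain i' j a where *: "m = Node i' j (Cs 0)" "A i' = Some a" "B j = Some (dsim D a)"
        using hom_from_unit_nonzero[OF G1 m(2)] by blast
      have 0: "Cs 0 \<in> fuse D a (dsim D a)" by (simp add: unit_in_fuse_iff)
      from m(1) have "i' = i" unfolding *(1) brm[OF *(2,3) 0] by (auto split: if_splits)
      then show "m \<in> (\<lambda>j. Node i j (Cs 0)) ` dom B" using * by auto
    qed (auto simp: inj_on_def)
    also have "\<dots> = (\<Sum>j\<in>dom B.
      bc i * mat (phi_at (grade (the (A i))) W) j' j * mat ?G1 (Node i j (Cs 0)) L)"
    proof (intro sum.cong refl)
      fix j
      show "mat (ebraid D U W) (Node j' i (Cs 0)) (Node i j (Cs 0)) * mat ?G1 (Node i j (Cs 0)) L =
        bc i * mat (phi_at (grade (the (A i))) W) j' j * mat ?G1 (Node i j (Cs 0)) L"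
      proof (cases "mat ?G1 (Node i j (Cs 0)) L = 0")
        case False
        have b: "B j = Some (dsim D a)" using G1_nz[OF False] a by simp
        have 0: "Cs 0 \<in> fuse D a (dsim D a)" by (simp add: unit_in_fuse_iff)
        show ?thesis unfolding brm[OF a b 0] by (simp add: bc_def a)
      qed simp
    qed
    finally show ?thesis .
  qed
  \<comment> \<open>The equivariance of \<open>ev\<close> replaces the action on \<open>W\<close> by
    one on \<open>U\<close>. A nonzero \<open>P i m\<close> joins equal simple objects, so the
    braiding scalar at \<open>i\<close> and the twist scalar at \<open>m\<close> belong to the same
    object and combine to \<open>dual_coeff\<close> times \<open>qdim\<close>.\<close>
  have step: "(\<Sum>j'\<in>dom B. E j' i * (bc i * mat (phi_at (grade (the (A i))) W) j' j * mat ?G1 (Node i j (Cs 0)) L))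
    = (\<Sum>k\<in>dom A. \<Sum>m\<in>dom A. E j k * (P k i * P i m) * (dual_coeff (the (A m)) * qdim D (the (A m))) * fC m j)"
    if i: "i \<in> dom A" for i j
  proof -
    obtain a where a: "A i = Some a" using i by auto
    have "(\<Sum>j'\<in>dom B. E j' i * (bc i * mat (phi_at (grade (the (A i))) W) j' j * mat ?G1 (Node i j (Cs 0)) L))
      = (\<Sum>k\<in>dom A. E j k * P k i) * (bc i * mat ?G1 (Node i j (Cs 0)) L)"
    proof (cases "mat ?G1 (Node i j (Cs 0)) L = 0")
      case False
      have b: "B j = Some (dsim D a)" using G1_nz[OF False] a by simp
      have "(\<Sum>j'\<in>dom B. E j' i * (bc i * mat (phi_at (grade (the (A i))) W) j' j * mat ?G1 (Node i j (Cs 0)) L))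
        = (\<Sum>j'\<in>dom B. E j' i * mat (phi_at (grade a) W) j' j) * (bc i * mat ?G1 (Node i j (Cs 0)) L)"
        by (simp only: a option.sel sum_distrib_right) (simp add: mult_ac)
      also have "(\<Sum>j'\<in>dom B. E j' i * mat (phi_at (grade a) W) j' j) = (\<Sum>k\<in>dom A. E j k * P k i)"
        using braid_ev[OF W U ev, of i a j] a b by (simp add: A_def B_def E_def L_def P_def)
      finally show ?thesis .
    qed simp
    also have "\<dots> = (\<Sum>k\<in>dom A. \<Sum>m\<in>dom A. (E j k * P k i) * (bc i * (P i m * tw m * fC m j)))"
      unfolding G1_mat sum_distrib_left[of "bc i"] sum_product ..
    also have "\<dots> = (\<Sum>k\<in>dom A. \<Sum>m\<in>dom A. E j k * (P k i * P i m) *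
        (dual_coeff (the (A m)) * qdim D (the (A m))) * fC m j)"
    proof (intro sum.cong refl)
      fix k m assume "m \<in> dom A"
      show "(E j k * P k i) * (bc i * (P i m * tw m * fC m j)) =
        E j k * (P k i * P i m) * (dual_coeff (the (A m)) * qdim D (the (A m))) * fC m j"
      proof (cases "P i m = 0")
        case False
        then have "A i = A m" using P_nz \<open>m \<in> dom A\<close> by simp
        then have "bc i * tw m = dual_coeff (the (A m)) * qdim D (the (A m))"
          using braid_twist_coeff by (simp add: bc_def tw_def)
        moreover have "(E j k * P k i) * (bc i * (P i m * tw m * fC m j)) =
            E j k * (P k i * P i m) * (bc i * tw m) * fC m j"
          by (simp only: mult_ac)
        ultimately show ?thesis by simp
      qed simp
    qed
    finally show ?thesis .
  qed
  \<comment> \<open>The zigzag identity: on copies of one simple object, \<open>C\<close> is inverse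
    to \<open>E\<close> up to the factor \<open>dual_coeff\<close>.\<close>
  have zz_mat: "dual_coeff a * (\<Sum>j\<in>dom B. E j i * C i' j) = (if i' = i then 1 else 0)"
    if "A i = Some a" "A i' = Some a" for i i' a
    using zigzag_left[OF finA finB evh coevh that] mat_lunit[of A i a D i'] that
    by (simp add: zz E_def C_def L_def)
  have "mat (ev \<cdot> ?G2) L L = (\<Sum>x\<in>dom B \<times> dom A. mat ev L (case x of (j', i) \<Rightarrow> Node j' i (Cs 0)) *
      mat ?G2 (case x of (j', i) \<Rightarrow> Node j' i (Cs 0)) L)"
  proof (rule mat_comp_reindex[OF G2])
    fix m assume "mat ev L m \<noteq> 0"
    from hom_to_unit_nonzero[OF evh this]
    show "m \<in> (\<lambda>x. case x of (j', i) \<Rightarrow> Node j' i (Cs 0)) ` (dom B \<times> dom A)" by force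
  qed (auto simp: inj_on_def)
  also have "\<dots> = (\<Sum>j'\<in>dom B. \<Sum>i\<in>dom A. E j' i * mat ?G2 (Node j' i (Cs 0)) L)"
    by (simp add: sum.cartesian_product split_def E_def)
  also have "\<dots> = (\<Sum>i\<in>dom A. \<Sum>j'\<in>dom B. \<Sum>j\<in>dom B.
      E j' i * (bc i * mat (phi_at (grade (the (A i))) W) j' j * mat ?G1 (Node i j (Cs 0)) L))"
    by (subst sum.swap) (simp add: G2_mat sum_distrib_left)
  also have "\<dots> = (\<Sum>i\<in>dom A. \<Sum>j\<in>dom B. \<Sum>j'\<in>dom B.
      E j' i * (bc i * mat (phi_at (grade (the (A i))) W) j' j * mat ?G1 (Node i j (Cs 0)) L))"
    by (rule sum.cong[OF refl], rule sum.swap)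
  also have "\<dots> = (\<Sum>i\<in>dom A. \<Sum>j\<in>dom B. \<Sum>k\<in>dom A. \<Sum>m\<in>dom A. E j k * (P k i * P i m) *
      (dual_coeff (the (A m)) * qdim D (the (A m))) * fC m j)"
    by (intro sum.cong refl step)
  \<comment> \<open>The label \<open>i\<close> now occurs only in the product of the two
    \<open>P\<close>, so it is summed first.\<close>
  also have "\<dots> = (\<Sum>j\<in>dom B. \<Sum>k\<in>dom A. \<Sum>m\<in>dom A. \<Sum>i\<in>dom A. E j k * (P k i * P i m) *
      (dual_coeff (the (A m)) * qdim D (the (A m))) * fC m j)"
    by (subst sum.swap, rule sum.cong[OF refl], subst sum.swap, rule sum.cong[OF refl], rule sum.swap)
  also have "\<dots> = (\<Sum>j\<in>dom B. \<Sum>k\<in>dom A. \<Sum>m\<in>dom A. E j k * (if k = m then 1 else 0) *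
      (dual_coeff (the (A m)) * qdim D (the (A m))) * fC m j)"
  proof (intro sum.cong refl)
    fix j k m assume "m \<in> dom A"
    then have "(\<Sum>i\<in>dom A. P k i * P i m) = (if k = m then 1 else 0)"
      using phi_at_sq[OF U, of m _ k] by (auto simp: A_def P_def)
    then show "(\<Sum>i\<in>dom A. E j k * (P k i * P i m) * (dual_coeff (the (A m)) * qdim D (the (A m))) * fC m j)
      = E j k * (if k = m then 1 else 0) * (dual_coeff (the (A m)) * qdim D (the (A m))) * fC m j"
      by (simp only: flip: sum_distrib_right sum_distrib_left)
  qed
  also have "\<dots> = (\<Sum>j\<in>dom B. \<Sum>m\<in>dom A. E j m * (dual_coeff (the (A m)) * qdim D (the (A m))) * fC m j)"
    by (rule sum.cong[OF refl]) (simp add: if_distrib if_distribR sum.delta' cong: if_cong sum.cong)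
  also have "\<dots> = (\<Sum>m\<in>dom A. \<Sum>i\<in>dom A. qdim D (the (A m)) * mat f m i *
      (dual_coeff (the (A m)) * (\<Sum>j\<in>dom B. E j m * C i j)))"
    unfolding fC_def sum_distrib_left
    by (subst sum.swap, rule sum.cong[OF refl], subst sum.swap) (simp add: mult_ac)
  also have "\<dots> = (\<Sum>m\<in>dom A. \<Sum>i\<in>dom A. if i = m then qdim D (the (A m)) * mat f m i else 0)"
  proof (intro sum.cong refl)
    fix m i assume "m \<in> dom A" "i \<in> dom A"
    show "qdim D (the (A m)) * mat f m i * (dual_coeff (the (A m)) * (\<Sum>j\<in>dom B. E j m * C i j))
      = (if i = m then qdim D (the (A m)) * mat f m i else 0)"
    proof (cases "mat f m i = 0")
      case False
      then obtain a where "A i = Some a" "A m = Some a" using hom_nonzeroD[OF fA False] by metis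
      then show ?thesis using zz_mat[of m a i] by simp
    qed auto
  qed
  also have "\<dots> = (\<Sum>m\<in>dom A. qdim D (the (A m)) * mat f m m)"
    by (simp add: sum.delta cong: sum.cong)
  finally show ?thesis by (simp add: F_def A_def B_def L_def)
qed

end

section \<open>A dual on the same labels\<close>

text \<open>The scalar of the tensor structure on the unit summand of \<open>a\<close> times its
  dual. The action on the dual has to carry this sign for the pairing to be equivariant.\<close>

fun dual_sign :: "'a::ab_group_add crossed_data \<Rightarrow> 'a simple \<Rightarrow> complex" where
  "dual_sign D (Cs a) = omf D a a (- a)"
| "dual_sign D (Xs x) = 1"

text \<open>The contragredient action would be the transposed inverse of \<phi>. As \<phi> is an
  involution, the transpose suffices, corrected by \<open>dual_sign\<close>.\<close>

definition dual_eobj :: "'a::ab_group_add crossed_data \<Rightarrow> 'a eobj \<Rightarrow> 'a eobj" where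
  "dual_eobj D U = EObj (\<lambda>i. map_option (dsim D) (und U i))
     (morph (gobj (\<lambda>i. map_option (dsim D) (und U i))) (\<lambda>i. map_option (dsim D) (und U i))
       (\<lambda>j i. dual_sign D (the (und U i)) * mat (phi U) i j))"

definition dual_ev :: "'a::ab_group_add crossed_data \<Rightarrow> 'a eobj \<Rightarrow> 'a mor" where
  "dual_ev D U = morph (und (dual_eobj D U) \<boxtimes>\<^bsub>D\<^esub> und U) unit_obj
     (\<lambda>l' l. case l of Node j i t \<Rightarrow> if j = i then 1 else 0 | _ \<Rightarrow> 0)"

lemma dsim_eq_iff [simp]: "dsim D a = dsim D b \<longleftrightarrow> a = b"
  by (metis dsim_dsim)

lemma dsim_gsim: "dsim D (gsim a) = gsim (dsim D a)"
  by (cases a) auto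

lemma dom_dual [simp]: "dom (und (dual_eobj D U)) = dom (und U)"
  by (auto simp: dual_eobj_def)

lemma und_dual: "und (dual_eobj D U) i = map_option (dsim D) (und U i)"
  by (simp add: dual_eobj_def)

lemma phi_dual_hom: "phi (dual_eobj D U) \<in> hom (gobj (und (dual_eobj D U))) (und (dual_eobj D U))"
  by (simp add: dual_eobj_def)

lemma mat_phi_dual:
  assumes "phi U \<in> hom (gobj (und U)) (und U)" "und U i = Some a"
  shows "mat (phi (dual_eobj D U)) j i = dual_sign D a * mat (phi U) i j"
proof (cases "mat (phi U) i j = 0")
  case False
  then obtain b where "gobj (und U) j = Some b" "und U i = Some b"
    using hom_nonzeroD[OF assms(1)] by metis
  then have "und U j = Some (gsim a)" using assms(2) by simp
  then show ?thesis
    using assms(2) by (simp add: dual_eobj_def gobj_def dom_def dsim_gsim del: gobj_eq_Some)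
qed (simp add: dual_eobj_def assms(2))

context crossed begin

lemma dual_sign_sq [simp]: "dual_sign D a * dual_sign D a = 1"
  by (cases a) auto

lemma dual_sign_gsim [simp]: "dual_sign D (gsim a) = dual_sign D a"
  by (cases a) (auto simp: om_commute)

lemma tau_dual: "tau_coeff D (dsim D a) a (Cs 0) = dual_sign D a"
  "tau_coeff D a (dsim D a) (Cs 0) = dual_sign D a"
  by (cases a; auto simp: om_commute)+

lemma dual_coeff_nonzero [simp]: "dual_coeff a \<noteq> 0"
  by (simp add: dual_coeff_def)

lemma dual_coeff_gsim [simp]: "dual_coeff (gsim a) = dual_coeff a"
  by (cases a) (auto simp: dual_coeff_def om_commute)

text \<open>The scalar of the second zigzag composite agrees with that of the first, so a single
  normalisation of the coevaluation satisfies both identities.\<close>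

lemma ainv_dual: "ainv_coeff D (dsim D a) a (dsim D a) (Cs 0) (Cs 0) (dsim D a) = dual_coeff a"
  by (cases a) (auto simp: dual_coeff_def om_commute)

text \<open>The evaluation has entries 1, so the coevaluation has to carry the inverse of the
  associator scalar met by the zigzag composites.\<close>

definition dual_coev :: "'a eobj \<Rightarrow> 'a mor" where
  "dual_coev U = morph unit_obj (und U \<boxtimes>\<^bsub>D\<^esub> und (dual_eobj D U))
     (\<lambda>l' l. case l' of Node i j t \<Rightarrow> if i = j then inverse (dual_coeff (the (und U i))) else 0 | _ \<Rightarrow> 0)"

lemma mat_dual_ev:
  assumes "und U i = Some a" "und U j = Some a"
  shows "mat (dual_ev D U) (Leaf (Cs 0)) (Node j i (Cs 0)) = (if j = i then 1 else 0)"
proof -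
  have "(und (dual_eobj D U) \<boxtimes>\<^bsub>D\<^esub> und U) (Node j i (Cs 0)) = Some (Cs 0)"
    using assms by (intro otens_unitI[of _ _ "dsim D a"]) (simp_all add: und_dual)
  then show ?thesis by (simp add: dual_ev_def dom_def)
qed

lemma mat_dual_coev:
  assumes "und U i = Some a" "und U j = Some a"
  shows "mat (dual_coev U) (Node i j (Cs 0)) (Leaf (Cs 0)) = (if i = j then inverse (dual_coeff a) else 0)"
proof -
  have "(und U \<boxtimes>\<^bsub>D\<^esub> und (dual_eobj D U)) (Node i j (Cs 0)) = Some (Cs 0)"
    using assms by (intro otens_unitI[of _ _ "a"]) (simp_all add: und_dual)
  moreover have "unit_obj (Leaf (Cs (0::'a))) = Some (Cs 0)" by simp
  ultimately show ?thesis using assms by (simp add: dual_coev_def dom_def del: unit_obj_eq_Some)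
qed

lemma mat_dual_ev_eq_0: "j \<noteq> i \<Longrightarrow> mat (dual_ev D U) l (Node j i t) = 0"
  and mat_dual_coev_eq_0: "i \<noteq> j \<Longrightarrow> mat (dual_coev U) (Node i j t) l = 0"
  by (simp_all add: dual_ev_def dual_coev_def)

lemma dual_ev_hom: "dual_ev D U \<in> hom (und (dual_eobj D U) \<boxtimes>\<^bsub>D\<^esub> und U) unit_obj"
  and dual_coev_hom: "dual_coev U \<in> hom unit_obj (und U \<boxtimes>\<^bsub>D\<^esub> und (dual_eobj D U))"
  by (simp_all add: dual_ev_def dual_coev_def)

lemma sum_dual_ev:
  assumes "finite (dom (und U))" "i \<in> dom (und U)"
  shows "(\<Sum>j\<in>dom (und U). mat (dual_ev D U) (Leaf (Cs 0)) (Node j i (Cs 0)) * g j) = g i"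
    and "(\<Sum>j\<in>dom (und U). mat (dual_ev D U) (Leaf (Cs 0)) (Node i j (Cs 0)) * g j) = g i"
proof -
  have "(\<Sum>j\<in>dom (und U). mat (dual_ev D U) (Leaf (Cs 0)) (Node j i (Cs 0)) * g j)
      = (\<Sum>j\<in>dom (und U). if j = i then g j else 0)"
    using assms(2) by (intro sum.cong refl) (auto simp: mat_dual_ev mat_dual_ev_eq_0)
  then show "(\<Sum>j\<in>dom (und U). mat (dual_ev D U) (Leaf (Cs 0)) (Node j i (Cs 0)) * g j) = g i"
    using assms by (simp add: sum.delta)
  have "(\<Sum>j\<in>dom (und U). mat (dual_ev D U) (Leaf (Cs 0)) (Node i j (Cs 0)) * g j)
      = (\<Sum>j\<in>dom (und U). if j = i then g j else 0)"
    using assms(2) by (intro sum.cong refl) (auto simp: mat_dual_ev mat_dual_ev_eq_0)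
  then show "(\<Sum>j\<in>dom (und U). mat (dual_ev D U) (Leaf (Cs 0)) (Node i j (Cs 0)) * g j) = g i"
    using assms by (simp add: sum.delta)
qed

text \<open>The transpose of an involution is an involution. The two signs belong to objects
  exchanged by the action, hence are equal and cancel.\<close>

lemma is_eobj_dual:
  assumes U: "is_eobj U"
  shows "is_eobj (dual_eobj D U)"
proof -
  let ?W = "dual_eobj D U"
  note phU = eobj_phi_hom[OF U]
  show ?thesis
  proof (rule is_eobjI[OF _ phi_dual_hom])
    fix i j b assume i: "und ?W i = Some b" and j: "und ?W j = Some b"
    then obtain a where iU: "und U i = Some a" by (auto simp: und_dual)
    have jdom: "j \<in> dom (und U)" using j by (auto simp: und_dual)
    have "(\<Sum>k\<in>dom (und ?W). mat (phi ?W) j k * mat (phi ?W) k i)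
        = (\<Sum>k\<in>dom (und U). mat (phi U) i k * mat (phi U) k j)"
      unfolding dom_dual
    proof (intro sum.cong refl)
      fix k assume "k \<in> dom (und U)"
      then obtain c where k: "und U k = Some c" by auto
      have dual: "mat (phi ?W) j k = dual_sign D c * mat (phi U) k j"
          "mat (phi ?W) k i = dual_sign D a * mat (phi U) i k"
        by (rule mat_phi_dual[OF phU k], rule mat_phi_dual[OF phU iU])
      show "mat (phi ?W) j k * mat (phi ?W) k i = mat (phi U) i k * mat (phi U) k j"
      proof (cases "mat (phi U) i k = 0")
        case False
        then have "a = gsim c" using phi_nonzero[OF phU False k] iU by simp
        then show ?thesis by (simp add: dual flip: mult.assoc)
      qed (simp add: dual)
    qed
    then show "(\<Sum>k\<in>dom (und ?W). mat (phi ?W) j k * mat (phi ?W) k i) = (if j = i then 1 else 0)"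
      using eobj_phi_sq[OF U jdom] by simp
  qed (use eobj_finite[OF U] in simp)
qed

text \<open>The sign from the tensor structure cancels the one in the action on the dual; what is
  left is \<phi> composed with itself.\<close>

lemma dual_ev_ehom:
  assumes U: "is_eobj U"
  shows "dual_ev D U \<in> ehom (etens D (dual_eobj D U) U) eunit"
proof -
  let ?W = "dual_eobj D U"
  note phU = eobj_phi_hom[OF U] and fin = eobj_finite[OF U]
  have "dual_ev D U \<cdot> phi (etens D ?W U) = phi eunit \<cdot> gmor (dual_ev D U)"
  proof (rule hom_eqI)
    show "dual_ev D U \<cdot> phi (etens D ?W U) \<in> hom (gobj (und ?W \<boxtimes>\<^bsub>D\<^esub> und U)) unit_obj"
      by (rule comp_hom[OF phi_etens_hom[OF phi_dual_hom phU] dual_ev_hom])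
    show "phi eunit \<cdot> gmor (dual_ev D U) \<in> hom (gobj (und ?W \<boxtimes>\<^bsub>D\<^esub> und U)) unit_obj"
      by (rule comp_hom[OF gmor_hom[OF dual_ev_hom] phi_eunit_hom])
    fix l l' c assume l: "gobj (und ?W \<boxtimes>\<^bsub>D\<^esub> und U) l = Some c" and l': "unit_obj l' = Some c"
    then have "(und ?W \<boxtimes>\<^bsub>D\<^esub> und U) l = Some (Cs 0)" and l'0: "l' = Leaf (Cs 0)" by auto
    then obtain j i b where l0: "l = Node j i (Cs 0)" and j: "und ?W j = Some b" and i: "und U i = Some (dsim D b)"
      using dom_otens_unitD[of "und ?W" D "und U" l] by blast
    define a where "a = dsim D b"
    have i': "und U i = Some a" and j': "und U j = Some a" and b: "b = dsim D a"
      using i j by (auto simp: a_def und_dual)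
    have "mat (dual_ev D U \<cdot> phi (etens D ?W U)) (Leaf (Cs 0)) (Node j i (Cs 0)) = dual_sign D a *
      (\<Sum>j'\<in>dom (und U). \<Sum>i'\<in>dom (und U).
        mat (dual_ev D U) (Leaf (Cs 0)) (Node j' i' (Cs 0)) * (mat (phi ?W) j' j * mat (phi U) i' i))"
      using mat_comp_phi_etens[OF phi_dual_hom phU _ fin dual_ev_hom j i] fin
      by (simp add: b tau_dual mult.assoc)
    also have "\<dots> = dual_sign D a * (\<Sum>k\<in>dom (und U). mat (phi ?W) k j * mat (phi U) k i)"
      using fin by (simp add: sum_dual_ev)
    also have "\<dots> = dual_sign D a * dual_sign D a * (\<Sum>k\<in>dom (und U). mat (phi U) j k * mat (phi U) k i)"
      by (simp only: mat_phi_dual[OF phU j'] sum_distrib_left mult.assoc)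
    also have "\<dots> = (if j = i then 1 else 0)"
      using i' by (subst eobj_phi_sq[OF U]) auto
    also have "\<dots> = mat (dual_ev D U) (Leaf (Cs 0)) (Node j i (Cs 0))"
      by (simp add: mat_dual_ev[OF i' j'])
    also have "\<dots> = mat (phi eunit \<cdot> gmor (dual_ev D U)) (Leaf (Cs 0)) (Node j i (Cs 0))"
    proof -
      have "mat (phi eunit \<cdot> gmor (dual_ev D U)) (Leaf (Cs 0)) (Node j i (Cs 0)) =
        mat (phi (eunit :: 'a eobj)) (Leaf (Cs 0)) (Leaf (Cs 0)) * mat (gmor (dual_ev D U)) (Leaf (Cs 0)) (Node j i (Cs 0))"
        by (rule mat_comp_single[OF gmor_hom[OF dual_ev_hom]]) (auto split: if_splits)
      then show ?thesis unfolding mat_phi_eunit by simp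
    qed
    finally show "mat (dual_ev D U \<cdot> phi (etens D ?W U)) l' l = mat (phi eunit \<cdot> gmor (dual_ev D U)) l' l"
      unfolding l0 l'0 .
  qed
  then show ?thesis using dual_ev_hom by (simp add: ehom_def)
qed

text \<open>As for the evaluation, with one more ingredient: the normalising scalar must not change
  under the action, which is \<open>dual_coeff_gsim\<close>.\<close>

lemma dual_coev_ehom:
  assumes U: "is_eobj U"
  shows "dual_coev U \<in> ehom eunit (etens D U (dual_eobj D U))"
proof -
  let ?W = "dual_eobj D U"
  note phU = eobj_phi_hom[OF U] and fin = eobj_finite[OF U]
  have ph: "phi (etens D U ?W) \<in> hom (gobj (und U \<boxtimes>\<^bsub>D\<^esub> und ?W)) (und U \<boxtimes>\<^bsub>D\<^esub> und ?W)"
    by (rule phi_etens_hom[OF phU phi_dual_hom])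
  have "dual_coev U \<cdot> phi eunit = phi (etens D U ?W) \<cdot> gmor (dual_coev U)"
  proof (rule hom_eqI)
    show "dual_coev U \<cdot> phi eunit \<in> hom (gobj unit_obj) (und U \<boxtimes>\<^bsub>D\<^esub> und ?W)"
      by (rule comp_hom[OF phi_eunit_hom dual_coev_hom])
    show "phi (etens D U ?W) \<cdot> gmor (dual_coev U) \<in> hom (gobj unit_obj) (und U \<boxtimes>\<^bsub>D\<^esub> und ?W)"
      by (rule comp_hom[OF gmor_hom[OF dual_coev_hom] ph])
    fix l l' c assume l: "gobj unit_obj l = Some c" and l': "(und U \<boxtimes>\<^bsub>D\<^esub> und ?W) l' = Some c"
    have "gsim c = Cs 0" using l by simp
    then have "c = Cs 0" by (cases c) auto
    then have l0: "l = Leaf (Cs 0)" and "(und U \<boxtimes>\<^bsub>D\<^esub> und ?W) l' = Some (Cs 0)" using l l' by auto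
    then obtain i' j' a where l'0: "l' = Node i' j' (Cs 0)" and i': "und U i' = Some a" and "und ?W j' = Some (dsim D a)"
      using dom_otens_unitD[of "und U" D "und ?W" l'] by blast
    then have j': "und U j' = Some a"
      by (auto simp: und_dual)
    have "mat (phi (etens D U ?W) \<cdot> gmor (dual_coev U)) (Node i' j' (Cs 0)) (Leaf (Cs 0)) =
      (\<Sum>i\<in>dom (und U). mat (phi (etens D U ?W)) (Node i' j' (Cs 0)) (Node i i (Cs 0)) *
        mat (gmor (dual_coev U)) (Node i i (Cs 0)) (Leaf (Cs 0)))"
    proof (rule mat_comp_reindex[OF gmor_hom[OF dual_coev_hom]])
      fix m assume "mat (gmor (dual_coev U)) m (Leaf (Cs 0)) \<noteq> 0"
      then have nz: "mat (dual_coev U) m (Leaf (Cs 0)) \<noteq> 0" by simp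
      obtain i j b where m: "m = Node i j (Cs 0)" "und U i = Some b"
        using hom_from_unit_nonzero[OF dual_coev_hom nz] by blast
      have "i = j" using nz mat_dual_coev_eq_0 unfolding m by blast
      then show "m \<in> (\<lambda>i. Node i i (Cs 0)) ` dom (und U)" using m by auto
    qed (use fin in \<open>auto simp: inj_on_def\<close>)
    also have "\<dots> = (\<Sum>i\<in>dom (und U). inverse (dual_coeff a) * (mat (phi U) i' i * mat (phi U) i j'))"
    proof (intro sum.cong refl)
      fix i assume "i \<in> dom (und U)"
      then obtain b where i: "und U i = Some b" by auto
      have iW: "und ?W i = Some (dsim D b)" by (simp add: und_dual i)
      have 0: "Cs 0 \<in> fuse D b (dsim D b)" by (simp add: unit_in_fuse_iff)
      have 1: "mat (phi (etens D U ?W)) (Node i' j' (Cs 0)) (Node i i (Cs 0)) =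
          dual_sign D b * mat (phi U) i' i * (dual_sign D b * mat (phi U) i j')"
        using mat_phi_etens[OF phU phi_dual_hom fin _ i iW 0] fin
        by (simp add: tau_dual mat_phi_dual[OF phU i])
      have 2: "mat (gmor (dual_coev U)) (Node i i (Cs 0)) (Leaf (Cs 0)) = inverse (dual_coeff b)"
        by (simp add: mat_dual_coev[OF i i])
      show "mat (phi (etens D U ?W)) (Node i' j' (Cs 0)) (Node i i (Cs 0)) *
        mat (gmor (dual_coev U)) (Node i i (Cs 0)) (Leaf (Cs 0)) =
        inverse (dual_coeff a) * (mat (phi U) i' i * mat (phi U) i j')"
      proof (cases "mat (phi U) i' i = 0")
        case False
        have "b = gsim a"
          using hom_nonzeroD[OF phU False] i i' by (metis gobj_eq_Some option.inject)
        then have "dual_coeff b = dual_coeff a" by simp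
        moreover have "dual_sign D b * mat (phi U) i' i * (dual_sign D b * mat (phi U) i j') * inverse (dual_coeff b)
          = (dual_sign D b * dual_sign D b) * (inverse (dual_coeff b) * (mat (phi U) i' i * mat (phi U) i j'))"
          by (simp only: mult_ac)
        ultimately show ?thesis unfolding 1 2 by simp
      qed (simp add: 1)
    qed
    also have "\<dots> = (if i' = j' then inverse (dual_coeff a) else 0)"
      unfolding sum_distrib_left[symmetric] using j' by (subst eobj_phi_sq[OF U]) auto
    also have "\<dots> = mat (dual_coev U) (Node i' j' (Cs 0)) (Leaf (Cs 0))"
      by (simp add: mat_dual_coev[OF i' j'])
    also have "\<dots> = mat (dual_coev U \<cdot> phi eunit) (Node i' j' (Cs 0)) (Leaf (Cs 0))"
    proof -
      have "mat (dual_coev U \<cdot> phi eunit) (Node i' j' (Cs 0)) (Leaf (Cs 0)) =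
        mat (dual_coev U) (Node i' j' (Cs 0)) (Leaf (Cs 0)) * mat (phi (eunit :: 'a eobj)) (Leaf (Cs 0)) (Leaf (Cs 0))"
        by (rule mat_comp_single[OF phi_eunit_hom]) (auto split: if_splits)
      then show ?thesis unfolding mat_phi_eunit by simp
    qed
    finally show "mat (dual_coev U \<cdot> phi eunit) l' l = mat (phi (etens D U ?W) \<cdot> gmor (dual_coev U)) l' l"
      unfolding l0 l'0 by simp
  qed
  then show ?thesis using dual_coev_hom by (simp add: ehom_def)
qed

lemma is_dual_dual_eobj:
  assumes U: "is_eobj U"
  shows "is_dual D U (dual_eobj D U) (dual_ev D U) (dual_coev U)"
proof -
  let ?W = "dual_eobj D U"
  note fin = eobj_finite[OF U] and ev = dual_ev_hom[of U] and coev = dual_coev_hom[of U]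
  have finW: "finite (dom (und ?W))" using fin by simp
  have "runit D (und U) \<cdot> (idm (und U) \<otimes>\<^bsub>D\<^esub> dual_ev D U) \<cdot> assoc D (und U) (und ?W) (und U) \<cdot>
       (dual_coev U \<otimes>\<^bsub>D\<^esub> idm (und U)) = lunit D (und U)" (is "?l = _")
  proof (rule hom_eqI[OF _ lunit_hom])
    show "?l \<in> hom (unit_obj \<boxtimes>\<^bsub>D\<^esub> und U) (und U)"
      by (rule comp_hom[OF comp_hom[OF comp_hom[OF mtens_hom[OF coev idm_hom] assoc_hom] mtens_hom[OF idm_hom ev]] runit_hom])
    fix l i' a assume l: "(unit_obj \<boxtimes>\<^bsub>D\<^esub> und U) l = Some a" and i': "und U i' = Some a"
    then obtain i where l0: "l = Node (Leaf (Cs 0)) i a" and i: "und U i = Some a"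
      by (auto simp: otens_eq_Some_iff)
    have idom: "i \<in> dom (und U)" using i by auto
    have "mat ?l i' l = dual_coeff a * mat (dual_coev U) (Node i' i (Cs 0)) (Leaf (Cs 0))"
      unfolding l0 using sum_dual_ev(1)[OF fin idom]
      by (simp add: zigzag_left[OF fin finW ev coev i i'])
    then show "mat ?l i' l = mat (lunit D (und U)) i' l"
      unfolding l0 by (simp add: mat_dual_coev[OF i' i] mat_lunit[where A = "und U", OF i])
  qed
  moreover have "lunit D (und ?W) \<cdot> (dual_ev D U \<otimes>\<^bsub>D\<^esub> idm (und ?W)) \<cdot> ainv D (und ?W) (und U) (und ?W) \<cdot>
       (idm (und ?W) \<otimes>\<^bsub>D\<^esub> dual_coev U) = runit D (und ?W)" (is "?r = _")
  proof (rule hom_eqI[OF _ runit_hom])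
    show "?r \<in> hom (und ?W \<boxtimes>\<^bsub>D\<^esub> unit_obj) (und ?W)"
      by (rule comp_hom[OF comp_hom[OF comp_hom[OF mtens_hom[OF idm_hom coev] ainv_hom] mtens_hom[OF ev idm_hom]] lunit_hom])
    fix l j' b assume l: "(und ?W \<boxtimes>\<^bsub>D\<^esub> unit_obj) l = Some b" and j': "und ?W j' = Some b"
    then obtain j where l0: "l = Node j (Leaf (Cs 0)) b" and j: "und ?W j = Some b"
      by (auto simp: otens_eq_Some_iff)
    define a where "a = dsim D b"
    have b: "b = dsim D a" and ja: "und U j = Some a" and ja': "und U j' = Some a"
      using j j' by (auto simp: a_def und_dual)
    have jdom: "j \<in> dom (und U)" using ja by auto
    have "mat ?r j' l = dual_coeff a * mat (dual_coev U) (Node j j' (Cs 0)) (Leaf (Cs 0))"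
      unfolding l0 zigzag_right[OF fin finW ev coev j j']
      using sum_dual_ev(2)[OF fin jdom] ainv_dual[of a] by (simp add: b)
    then show "mat ?r j' l = mat (runit D (und ?W)) j' l"
      unfolding l0 by (auto simp: mat_dual_coev[OF ja ja'] mat_runit[where A = "und ?W", OF j])
  qed
  ultimately show ?thesis
    unfolding is_dual_def
    using is_eobj_dual[OF U] dual_ev_ehom[OF U] dual_coev_ehom[OF U] minv_assoc[OF finW fin finW] by simp
qed

text \<open>The constructed dual shows that some scalar satisfies the description; evaluating
  \<open>trace_formula\<close> at the only label of the unit shows that every dual gives this same
  scalar.\<close>

theorem rtrace_eq:
  assumes U: "is_eobj U" and f: "f \<in> hom (und U) (und U)"
  shows "rtrace D U f = (\<Sum>i\<in>dom (und U). qdim D (the (und U i)) * mat f i i)" (is "_ = ?z")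
  unfolding rtrace_def
proof (rule the_equality)
  let ?W = "dual_eobj D U"
  note dual = is_dual_dual_eobj[OF U]
  have W: "is_eobj ?W" by (rule is_eobj_dual[OF U])
  have h: "dual_ev D U \<cdot> ebraid D U ?W \<cdot> ((etwist D U \<cdot> f) \<otimes>\<^bsub>D\<^esub> idm (und ?W)) \<cdot> dual_coev U \<in> hom unit_obj unit_obj"
    by (rule comp_hom[OF comp_hom[OF comp_hom[OF dual_coev_hom mtens_hom[OF comp_hom[OF f
      etwist_hom[OF eobj_phi_hom[OF U] eobj_finite[OF U]]] idm_hom]] ebraid_hom[OF phi_dual_hom]] dual_ev_hom])
  have "dual_ev D U \<cdot> ebraid D U ?W \<cdot> ((etwist D U \<cdot> f) \<otimes>\<^bsub>D\<^esub> idm (und ?W)) \<cdot> dual_coev U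
      = mscale ?z (idm unit_obj)"
  proof (rule hom_eqI[OF h])
    show "mscale ?z (idm unit_obj) \<in> hom unit_obj unit_obj"
      by (auto simp: hom_def mscale_def split: if_splits)
  qed (auto simp: trace_formula[OF U f dual] mscale_def)
  then show "\<exists>W ev coev. is_dual D U W ev coev \<and>
     ev \<cdot> ebraid D U W \<cdot> ((etwist D U \<cdot> f) \<otimes>\<^bsub>D\<^esub> idm (und W)) \<cdot> coev = mscale ?z (idm unit_obj)"
    using dual by blast
  fix z assume "\<exists>W ev coev. is_dual D U W ev coev \<and>
     ev \<cdot> ebraid D U W \<cdot> ((etwist D U \<cdot> f) \<otimes>\<^bsub>D\<^esub> idm (und W)) \<cdot> coev = mscale z (idm unit_obj)"
  then obtain W ev coev where "is_dual D U W ev coev"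
    and eq: "ev \<cdot> ebraid D U W \<cdot> ((etwist D U \<cdot> f) \<otimes>\<^bsub>D\<^esub> idm (und W)) \<cdot> coev = mscale z (idm unit_obj)"
    by blast
  from trace_formula[OF U f this(1)] show "z = ?z"
    unfolding eq by (simp add: mscale_def)
qed

end

section \<open>Modular data\<close>

text \<open>Common form of the objects X and Z: a simple object fixed by the action, with \<phi> a
  scalar.\<close>

definition single_eobj :: "'a::ab_group_add simple \<Rightarrow> complex \<Rightarrow> 'a eobj" where
  "single_eobj c s = EObj (osum {c})
     (morph (gobj (osum {c})) (osum {c}) (\<lambda>j i. if j = i then s else 0))"

lemma Xobj_single: "Xobj a s = single_eobj (Cs a) s"
  and Zobj_single: "Zobj x s = single_eobj (Xs x) s"
  by (simp_all add: Xobj_def Zobj_def single_eobj_def)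

lemma und_single [simp]: "und (single_eobj c s) = osum {c}"
  by (simp add: single_eobj_def)

lemma phi_single_hom: "phi (single_eobj c s) \<in> hom (gobj (osum {c})) (osum {c})"
  by (simp add: single_eobj_def)

lemma mat_phi_single: "gsim c = c \<Longrightarrow> mat (phi (single_eobj c s)) (Leaf c) (Leaf c) = s"
  by (simp add: single_eobj_def gobj_def osum_def dom_def)

lemma is_eobj_single: "gsim c = c \<Longrightarrow> s \<in> {1, -1} \<Longrightarrow> is_eobj (single_eobj c s)"
  by (rule is_eobjI) (auto simp: phi_single_hom mat_phi_single)

lemma und_Yobj [simp]: "und (Yobj b) = osum {Cs b, Cs (- b)}"
  by (simp add: Yobj_def)

lemma Yobj_uminus: "Yobj (- b) = Yobj b"
  by (simp add: Yobj_def insert_commute)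

lemma phi_Yobj_hom: "phi (Yobj b) \<in> hom (gobj (osum {Cs b, Cs (- b)})) (osum {Cs b, Cs (- b)})"
  by (simp add: Yobj_def)

lemma mat_phi_Yobj:
  assumes "c \<in> {Cs b, Cs (- b)}"
  shows "mat (phi (Yobj b)) l (Leaf c) = (if l = Leaf (gsim c) then 1 else 0)"
proof -
  have "gobj (osum {Cs b, Cs (- b)}) (Leaf c) = Some (gsim c)"
    using assms by (auto simp: gobj_def osum_def)
  moreover have "osum {Cs b, Cs (- b)} l = Some (gsim c) \<longleftrightarrow> l = Leaf (gsim c)"
    using assms by auto
  ultimately show ?thesis by (simp add: Yobj_def dom_def del: osum_eq_Some gobj_eq_Some)
qed

lemma double_neq_iff: "b + b \<noteq> 0 \<longleftrightarrow> b \<noteq> - (b :: 'a::ab_group_add)"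
  by (simp add: eq_neg_iff_add_eq_0)

lemma is_eobj_Yobj: "b + b \<noteq> 0 \<Longrightarrow> is_eobj (Yobj b)"
  by (rule is_eobjI) (auto simp: phi_Yobj_hom mat_phi_Yobj double_neq_iff)

text \<open>A label on which the identity has an entry 1 makes the scalar unique, hence the
  assumption that the object is nonzero.\<close>

lemma twist_scalarI:
  assumes "etwist D U = mscale z (idm (und U))" "dom (und U) \<noteq> {}"
  shows "twist_scalar D U = z"
  unfolding twist_scalar_def
proof (rule the_equality)
  fix w assume "etwist D U = mscale w (idm (und U))"
  then have "mscale w (idm (und U)) = mscale z (idm (und U))" using assms(1) by simp
  moreover obtain i where "i \<in> dom (und U)" using assms(2) by blast
  ultimately show "w = z"
    by (metis (no_types, lifting) mat_idm mor.sel(3) mscale_def mult.right_neutral)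
qed (rule assms(1))

lemma etwist_scalar:
  assumes U: "is_eobj U" and ne: "dom (und U) \<noteq> {}"
    and eq: "\<And>i j a. und U i = Some a \<Longrightarrow> und U j = Some a \<Longrightarrow>
      twist_coeff D a * mat (phi_at (grade a) U) j i = (if j = i then z else 0)"
  shows "twist_scalar D U = z"
proof (rule twist_scalarI[OF _ ne])
  show "etwist D U = mscale z (idm (und U))"
  proof (rule hom_eqI)
    show "etwist D U \<in> hom (und U) (und U)"
      by (rule etwist_hom[OF eobj_phi_hom[OF U] eobj_finite[OF U]])
    show "mscale z (idm (und U)) \<in> hom (und U) (und U)"
      by (auto simp: hom_def mscale_def split: if_splits)
    show "mat (etwist D U) j i = mat (mscale z (idm (und U))) j i"
      if "und U i = Some a" "und U j = Some a" for i j a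
      using that by (simp add: mat_etwist[OF eobj_phi_hom[OF U] eobj_finite[OF U] that(1)] eq mscale_def dom_def)
  qed
qed

section \<open>Isomorphisms between simple equivariant objects\<close>

lemma eiso_refl:
  assumes U: "is_eobj U"
  shows "eiso U U"
proof -
  note fin = eobj_finite[OF U] and phi = eobj_phi_hom[OF U]
  have "gmor (idm (und U)) = idm (gobj (und U))"
    by (rule mor_eqI) auto
  then have "idm (und U) \<in> ehom U U"
    using comp_idm_left[OF phi fin] comp_idm_right[OF phi] fin by (simp add: ehom_def)
  moreover have "idm (und U) \<cdot> idm (und U) = idm (und U)"
    by (rule comp_idm_left[OF idm_hom fin])
  ultimately show ?thesis unfolding eiso_def by blast
qed

text \<open>A left inverse excludes zero columns, and a nonzero entry joins equal simple objects; so
  isomorphic objects share every simple summand.\<close>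

lemma eiso_nonzero:
  assumes "eiso U V" "und U i = Some a"
  obtains f j where "f \<in> ehom U V" "mat f j i \<noteq> 0" "und V j = Some a"
proof -
  obtain f h where f: "f \<in> ehom U V" and hf: "h \<cdot> f = idm (und U)"
    using assms(1) by (auto simp: eiso_def)
  have "mat (h \<cdot> f) i i \<noteq> 0" unfolding hf using assms(2) by auto
  then have "\<exists>j. mat h i j * mat f j i \<noteq> 0"
    unfolding mat_comp by (meson sum.neutral)
  then obtain j where j: "mat f j i \<noteq> 0" by auto
  have "f \<in> hom (und U) (und V)" using f by (simp add: ehom_def)
  then have "und V j = Some a"
    using hom_nonzeroD[OF _ j] assms(2) by (metis option.inject)
  then show ?thesis using that f j by blast
qed

text \<open>An equivariant map between these objects is a number \<open>f\<close> with
  \<open>f s = t f\<close>.\<close>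

lemma eiso_single:
  assumes "eiso (single_eobj c s) (single_eobj c t)" "gsim c = c"
  shows "s = t"
proof -
  obtain f j where f: "f \<in> ehom (single_eobj c s) (single_eobj c t)"
    and nz: "mat f j (Leaf c) \<noteq> 0" "osum {c} j = Some c"
    using eiso_nonzero[OF assms(1), of "Leaf c" c] by auto
  have fh: "f \<in> hom (osum {c}) (osum {c})"
    and eq: "f \<cdot> phi (single_eobj c s) = phi (single_eobj c t) \<cdot> gmor f"
    using f by (simp_all add: ehom_def)
  have "mat (f \<cdot> phi (single_eobj c s)) (Leaf c) (Leaf c) = mat f (Leaf c) (Leaf c) * s"
    by (simp add: mat_comp tgt_hom[OF phi_single_hom] mat_phi_single assms(2))
  moreover have "mat (phi (single_eobj c t) \<cdot> gmor f) (Leaf c) (Leaf c) = t * mat f (Leaf c) (Leaf c)"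
    by (simp add: mat_comp tgt_hom[OF fh] mat_phi_single assms(2))
  ultimately show ?thesis using eq nz by simp
qed

text \<open>A common simple summand decides the family: \<phi> has a group element with
  \<open>2a = 0\<close> only in an X, one with \<open>2b\<close> nonzero only in a Y, and degree g
  only in a Z. For Y the summand fixes \<open>b\<close> up to sign, which \<open>Yobj\<close> does
  not see; for X and Z the scalar of the action remains to be compared.\<close>

lemma eiso_simple_eobjs:
  assumes "U \<in> simple_eobjs" "V \<in> simple_eobjs" "eiso U V"
  shows "U = V"
proof -
  have common: "\<exists>c. Leaf c \<in> dom (und U) \<and> und U (Leaf c) = Some c \<and> und V (Leaf c) = Some c"
  proof -
    have "\<exists>c. und U (Leaf c) = Some c"
      using assms(1) by (auto simp: simple_eobjs_def Xobj_single Zobj_single)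
    then obtain c where c: "und U (Leaf c) = Some c" by blast
    from eiso_nonzero[OF assms(3) c] obtain j where "und V j = Some c" by metis
    moreover from this have "j = Leaf c"
      using assms(2) by (auto simp: simple_eobjs_def Xobj_single Zobj_single)
    ultimately show ?thesis using c by auto
  qed
  then obtain c where c: "und U (Leaf c) = Some c" "und V (Leaf c) = Some c" by blast
  from assms(1) consider
      (X) a s where "U = single_eobj (Cs a) s" "a + a = 0"
    | (Y) b where "U = Yobj b" "b + b \<noteq> 0"
    | (Z) x s where "U = single_eobj (Xs x) s"
    by (auto simp: simple_eobjs_def Xobj_single Zobj_single)
  note U = this
  from assms(2) consider
      (X') a s where "V = single_eobj (Cs a) s" "a + a = 0"
    | (Y') b where "V = Yobj b" "b + b \<noteq> 0"
    | (Z') x s where "V = single_eobj (Xs x) s"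
    by (auto simp: simple_eobjs_def Xobj_single Zobj_single)
  note V = this
  show ?thesis
  proof (cases rule: U)
    case X
    then show ?thesis
    proof (cases rule: V)
      case (X' a' s')
      then show ?thesis
        using X c assms(3) eiso_single[of "Cs a" s s'] by (simp add: eq_neg_iff_add_eq_0[symmetric])
    qed (use X c in \<open>auto simp: add_eq_0_iff\<close>)
  next
    case (Y b)
    then show ?thesis
      using c by (cases rule: V) (auto simp: Yobj_uminus add_eq_0_iff)
  next
    case (Z x s)
    then show ?thesis
    proof (cases rule: V)
      case (Z' x' s')
      then show ?thesis using Z c assms(3) eiso_single[of "Xs x" s s'] by simp
    qed (use Z c in auto)
  qed
qed

context crossed begin

section \<open>The double braiding and its trace\<close>

text \<open>Applying the tensor structure twice gives the square of a sign, because \<omega> ignores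
  negation of its first argument and is symmetric in the other two. It expresses that the action
  composes strictly.\<close>

lemma tau_coeff_gsim:
  "t \<in> fuse D a b \<Longrightarrow> tau_coeff D (gsim a) (gsim b) (gsim t) * tau_coeff D a b t = 1"
proof -
  have 1: "omf D a b (- b) * omf D a (- b) b = 1" for a b
    using om_sq[of a b "- b"] by (simp add: om_commute)
  have 2: "omb D x b (- b) * omb D x (- b) b = 1" for x b
    using omb_sq[of x b "- b"] by (simp add: omb_commute)
  assume "t \<in> fuse D a b"
  then show ?thesis
    using 1 2 by (cases a; cases b) (auto simp: mult.commute)
qed

text \<open>The entries of \<open>S\<close> are traces on tensor products, so the trace formula must
  apply to these. After the signs of the tensor structure cancel, the sum factors into the
  involutions of the two factors.\<close>

lemma is_eobj_etens:
  assumes U: "is_eobj U" and V: "is_eobj V"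
  shows "is_eobj (etens D U V)"
proof (rule is_eobjI)
  note phU = eobj_phi_hom[OF U] and phV = eobj_phi_hom[OF V]
    and finU = eobj_finite[OF U] and finV = eobj_finite[OF V]
  show ph: "phi (etens D U V) \<in> hom (gobj (und (etens D U V))) (und (etens D U V))"
    using phi_etens_hom[OF phU phV] by simp
  show "finite (dom (und (etens D U V)))" using finU finV by simp
  fix l l' t assume "und (etens D U V) l = Some t" "und (etens D U V) l' = Some t"
  then obtain i j a b i' j' where l: "l = Node i j t" "und U i = Some a" "und V j = Some b" "t \<in> fuse D a b"
    and l': "l' = Node i' j' t"
    by (auto simp: otens_eq_Some_iff)
  have "(\<Sum>m\<in>dom (und (etens D U V)). mat (phi (etens D U V)) l' m * mat (phi (etens D U V)) m l)
    = (\<Sum>i1\<in>dom (und U). \<Sum>j1\<in>dom (und V). \<Sum>s\<in>fuse D (the (und U i1)) (the (und V j1)).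
        mat (phi (etens D U V)) l' (Node i1 j1 s) * mat (phi (etens D U V)) (Node i1 j1 s) l)"
    unfolding und_etens by (rule sum_dom_otens[OF finU finV])
  also have "\<dots> = (\<Sum>i1\<in>dom (und U). \<Sum>j1\<in>dom (und V).
      (mat (phi U) i' i1 * mat (phi U) i1 i) * (mat (phi V) j' j1 * mat (phi V) j1 j))"
  proof (intro sum.cong refl)
    fix i1 j1 assume "i1 \<in> dom (und U)" "j1 \<in> dom (und V)"
    then obtain a1 b1 where 1: "und U i1 = Some a1" "und V j1 = Some b1" by auto
    let ?f = "\<lambda>s. mat (phi (etens D U V)) l' (Node i1 j1 s) * mat (phi (etens D U V)) (Node i1 j1 s) l"
    have m: "mat (phi (etens D U V)) (Node i1 j1 s) l =
      (if s = gsim t then tau_coeff D a b t * mat (phi U) i1 i * mat (phi V) j1 j else 0)" for s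
      unfolding l(1) by (rule mat_phi_etens[OF phU phV finU finV l(2-4)])
    show "(\<Sum>s\<in>fuse D (the (und U i1)) (the (und V j1)). ?f s) =
      (mat (phi U) i' i1 * mat (phi U) i1 i) * (mat (phi V) j' j1 * mat (phi V) j1 j)"
    proof (cases "mat (phi U) i1 i = 0 \<or> mat (phi V) j1 j = 0")
      case True
      then have "(\<Sum>s\<in>fuse D (the (und U i1)) (the (und V j1)). ?f s) = 0"
        by (intro sum.neutral) (auto simp: m)
      then show ?thesis using True by auto
    next
      case False
      then have a1: "a1 = gsim a" and b1: "b1 = gsim b"
        using phi_nonzero[OF phU, of i1 i a] phi_nonzero[OF phV, of j1 j b] 1 l(2,3) by simp_all
      have gt: "gsim t \<in> fuse D a1 b1" using l(4) a1 b1 gsim_fuse_iff by blast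
      have "(\<Sum>s\<in>fuse D (the (und U i1)) (the (und V j1)). ?f s) = ?f (gsim t)"
        using gt 1 by (subst sum.remove[of _ "gsim t"]) (auto simp: m)
      also have "\<dots> = (tau_coeff D (gsim a) (gsim b) (gsim t) * tau_coeff D a b t) *
          ((mat (phi U) i' i1 * mat (phi U) i1 i) * (mat (phi V) j' j1 * mat (phi V) j1 j))"
        unfolding m l' mat_phi_etens[OF phU phV finU finV 1 gt] a1 b1 by (simp add: mult_ac)
      finally show ?thesis by (simp add: tau_coeff_gsim[OF l(4)])
    qed
  qed
  also have "\<dots> = (\<Sum>i1\<in>dom (und U). mat (phi U) i' i1 * mat (phi U) i1 i) *
      (\<Sum>j1\<in>dom (und V). mat (phi V) j' j1 * mat (phi V) j1 j)"
    by (simp add: sum_product)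
  also have "\<dots> = (if l' = l then 1 else 0)"
  proof -
    have idom: "i \<in> dom (und U)" and jdom: "j \<in> dom (und V)" using l by auto
    show ?thesis
      unfolding eobj_phi_sq[OF U idom] eobj_phi_sq[OF V jdom] l(1) l' by simp
  qed
  finally show "(\<Sum>m\<in>dom (und (etens D U V)). mat (phi (etens D U V)) l' m * mat (phi (etens D U V)) m l)
    = (if l' = l then 1 else 0)" .
qed

text \<open>Each of the two braidings applies \<phi> of one factor, in the degree of the other
  factor. On the diagonal only the diagonal entries of these maps count, and the two scalars on the
  summand \<open>t\<close> multiply.\<close>

theorem S_entry_eq:
  assumes U: "is_eobj U" and V: "is_eobj V"
  shows "S_entry D U V = (\<Sum>i\<in>dom (und U). \<Sum>j\<in>dom (und V).
    mat (phi_at (grade (the (und U i))) V) j j * mat (phi_at (grade (the (und V j))) U) i i *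
    (\<Sum>t\<in>fuse D (the (und U i)) (the (und V j)). qdim D t *
      (braid_coeff D (the (und U i)) (the (und V j)) t * braid_coeff D (the (und V j)) (the (und U i)) t)))"
proof -
  note phU = eobj_phi_hom[OF U] and phV = eobj_phi_hom[OF V]
    and finU = eobj_finite[OF U] and finV = eobj_finite[OF V]
  have c1: "ebraid D U V \<in> hom (und U \<boxtimes>\<^bsub>D\<^esub> und V) (und V \<boxtimes>\<^bsub>D\<^esub> und U)"
    and c2: "ebraid D V U \<in> hom (und V \<boxtimes>\<^bsub>D\<^esub> und U) (und U \<boxtimes>\<^bsub>D\<^esub> und V)"
    by (rule ebraid_hom[OF phV], rule ebraid_hom[OF phU])
  have entry: "mat (ebraid D V U \<cdot> ebraid D U V) (Node i j t) (Node i j t) =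
      braid_coeff D b a t * mat (phi_at (grade b) U) i i * (braid_coeff D a b t * mat (phi_at (grade a) V) j j)"
    if i: "und U i = Some a" and j: "und V j = Some b" and t: "t \<in> fuse D a b" for i j t a b
  proof -
    note e1 = mat_ebraid[OF phV finU finV i j t]
    have t': "t \<in> fuse D b a" using t by (simp add: fuse_commute)
    have e2: "mat (ebraid D V U) (Node i j t) (Node j1 i t) =
      (if j = j1 then braid_coeff D b1 a t * mat (phi_at (grade b1) U) i i else 0)"
      if "und V j1 = Some b1" "t \<in> fuse D b1 a" for j1 b1
      using mat_ebraid[OF phU finV finU that(1) i that(2)] by simp
    \<comment> \<open>The second braiding leaves the label of \<open>V\<close> untouched, so a path
      back to \<open>Node i j t\<close> must already have the label \<open>j\<close> after the first
      one.\<close>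
    have "mat (ebraid D V U \<cdot> ebraid D U V) (Node i j t) (Node i j t) =
      mat (ebraid D V U) (Node i j t) (Node j i t) * mat (ebraid D U V) (Node j i t) (Node i j t)"
    proof (rule mat_comp_single[OF c1])
      fix m assume m: "mat (ebraid D V U) (Node i j t) m \<noteq> 0" "mat (ebraid D U V) m (Node i j t) \<noteq> 0"
      obtain s where "(und V \<boxtimes>\<^bsub>D\<^esub> und U) m = Some s" using hom_nonzeroD[OF c1 m(2)] by metis
      then obtain j1 i1 b1 a1 where 1: "m = Node j1 i1 s" "und V j1 = Some b1" "und U i1 = Some a1" "s \<in> fuse D b1 a1"
        by (auto simp: otens_eq_Some_iff)
      have 2: "i1 = i" "s = t" using m(2) unfolding 1(1) e1 by (auto split: if_splits)
      then have "a1 = a" using 1 i by simp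
      then have "j = j1" using m(1) e2[OF 1(2)] 1(4) 2 unfolding 1(1) by (auto split: if_splits)
      then show "m = Node j i t" using 1 2 by simp
    qed (use finU finV in auto)
    then show ?thesis by (simp add: e1 e2[OF j t'])
  qed
  have "S_entry D U V = (\<Sum>l\<in>dom (und U \<boxtimes>\<^bsub>D\<^esub> und V).
      qdim D (the ((und U \<boxtimes>\<^bsub>D\<^esub> und V) l)) * mat (ebraid D V U \<cdot> ebraid D U V) l l)"
    unfolding S_entry_def
    using rtrace_eq[OF is_eobj_etens[OF U V], of "ebraid D V U \<cdot> ebraid D U V"] comp_hom[OF c1 c2] by simp
  also have "\<dots> = (\<Sum>i\<in>dom (und U). \<Sum>j\<in>dom (und V). \<Sum>t\<in>fuse D (the (und U i)) (the (und V j)).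
      qdim D (the ((und U \<boxtimes>\<^bsub>D\<^esub> und V) (Node i j t))) * mat (ebraid D V U \<cdot> ebraid D U V) (Node i j t) (Node i j t))"
    by (rule sum_dom_otens[OF finU finV])
  also have "\<dots> = (\<Sum>i\<in>dom (und U). \<Sum>j\<in>dom (und V).
    mat (phi_at (grade (the (und U i))) V) j j * mat (phi_at (grade (the (und V j))) U) i i *
    (\<Sum>t\<in>fuse D (the (und U i)) (the (und V j)). qdim D t *
      (braid_coeff D (the (und U i)) (the (und V j)) t * braid_coeff D (the (und V j)) (the (und U i)) t)))"
    unfolding sum_distrib_left
  proof (intro sum.cong refl)
    fix i j t assume "i \<in> dom (und U)" "j \<in> dom (und V)" and t: "t \<in> fuse D (the (und U i)) (the (und V j))"
    then obtain a b where ab: "und U i = Some a" "und V j = Some b" by auto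
    then have t': "t \<in> fuse D a b" using t by simp
    show "qdim D (the ((und U \<boxtimes>\<^bsub>D\<^esub> und V) (Node i j t))) * mat (ebraid D V U \<cdot> ebraid D U V) (Node i j t) (Node i j t) =
      mat (phi_at (grade (the (und U i))) V) j j * mat (phi_at (grade (the (und V j))) U) i i *
      (qdim D t * (braid_coeff D (the (und U i)) (the (und V j)) t * braid_coeff D (the (und V j)) (the (und U i)) t))"
      using entry[OF ab t'] ab t' by (simp add: otens_Node[where A = "und U" and B = "und V", OF ab] mult_ac)
  qed
  finally show ?thesis .
qed

end

lemma osum_Leaf [simp]: "osum S (Leaf c) = (if c \<in> S then Some c else None)"
  by (simp add: osum_def)

context crossed begin

section \<open>The entries of the two matrices\<close>

lemma T_entry_eq:
  assumes "is_eobj U" "dom (und U) \<noteq> {}"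
    and "\<And>i j a. und U i = Some a \<Longrightarrow> und U j = Some a \<Longrightarrow>
      twist_coeff D a * mat (phi_at (grade a) U) j i = (if j = i then z else 0)"
  shows "T_entry D U U = inverse z"
proof -
  have "twist_scalar D U = z" by (rule etwist_scalar[OF assms(1,2)]) (rule assms(3))
  then show ?thesis by (simp only: T_entry_def eiso_refl[OF assms(1)] if_True)
qed

lemma T_Xobj: "a + a = 0 \<Longrightarrow> s \<in> {1, -1} \<Longrightarrow> T_entry D (Xobj a s) (Xobj a s) = inverse (Qf D a)"
  unfolding Xobj_single
  by (rule T_entry_eq) (auto simp: is_eobj_single sg_diag add_eq_0_iff)

lemma T_Yobj: "a + a \<noteq> 0 \<Longrightarrow> T_entry D (Yobj a) (Yobj a) = inverse (Qf D a)"
  by (rule T_entry_eq) (auto simp: is_eobj_Yobj sg_diag)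

lemma T_Zobj:
  assumes "s \<in> {1, -1}"
  shows "T_entry D (Zobj x s) (Zobj x s) = s * inverse (bet D)"
proof -
  have "T_entry D (Zobj x s) (Zobj x s) = inverse (bet D * s)"
    unfolding Zobj_single using assms
    by (intro T_entry_eq) (auto simp: is_eobj_single mat_phi_single)
  then show ?thesis using assms by auto
qed

lemma B_double_zero: "a + a = 0 \<Longrightarrow> bilin (Qf D) x a * bilin (Qf D) x a = 1"
  using B_add_right[of x a a] by simp

text \<open>Two representatives differ by some \<open>2c\<close>, and \<open>B(2c, a)\<close> is the
  square of a sign when \<open>2a = 0\<close>.\<close>

lemma bilin2_cls: "a + a = 0 \<Longrightarrow> bilin2 (Qf D) (cls x) a = bilin (Qf D) x a"
proof -
  assume a: "a + a = 0"
  obtain c where "rep (cls x) = x + (c + c)"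
    using cls_eq_iff[of "rep (cls x)" x] by auto
  then show ?thesis
    using B_double_zero[OF a, of c] by (simp add: bilin2_def B_add_left)
qed

lemma S_Xobj_Xobj:
  assumes "a + a = 0" "s \<in> {1, -1}" "b + b = 0" "t \<in> {1, -1}"
  shows "S_entry D (Xobj a s) (Xobj b t) = bilin (Qf D) a b"
proof -
  have "is_eobj (Xobj a s)" "is_eobj (Xobj b t)"
    using assms by (auto simp: Xobj_single add_eq_0_iff intro!: is_eobj_single)
  from S_entry_eq[OF this] show ?thesis
    by (simp add: Xobj_single qdim_def sg_sym[of b a] sg_sq)
qed

text \<open>The summands \<open>b\<close> and \<open>-b\<close> contribute \<open>B(a,b)\<close> and
  its inverse, and these coincide because \<open>2a = 0\<close>.\<close>

lemma S_Xobj_Yobj: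
  assumes "a + a = 0" "s \<in> {1, -1}" "b + b \<noteq> 0"
  shows "S_entry D (Xobj a s) (Yobj b) = 2 * bilin (Qf D) a b"
proof -
  have "is_eobj (Xobj a s)" "is_eobj (Yobj b)"
    using assms by (auto simp: Xobj_single add_eq_0_iff intro!: is_eobj_single is_eobj_Yobj)
  moreover have "inverse (bilin (Qf D) a b) = bilin (Qf D) a b"
    using B_double_zero[OF assms(1), of b] by (metis B_sym inverse_unique)
  ultimately show ?thesis using assms(3)
    by (simp add: S_entry_eq Xobj_single qdim_def sg_sym[of _ a] sg_sq double_neq_iff)
qed

lemma S_Yobj_Yobj:
  assumes "b + b \<noteq> 0" "c + c \<noteq> 0"
  shows "S_entry D (Yobj b) (Yobj c) = 2 * (bilin (Qf D) b c + inverse (bilin (Qf D) b c))"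
proof -
  have "is_eobj (Yobj b)" "is_eobj (Yobj c)"
    using assms by (auto intro!: is_eobj_Yobj)
  then show ?thesis using assms
    by (simp add: S_entry_eq qdim_def sg_sym[of c] sg_sym[of "- c"] sg_sq double_neq_iff)
qed

text \<open>An object of degree g brings in \<phi> of Y, the interchange of two distinct summands,
  which has zero diagonal.\<close>

lemma S_Yobj_Zobj:
  assumes "a + a \<noteq> 0" "r \<in> {1, -1}"
  shows "S_entry D (Yobj a) (Zobj x r) = 0"
proof -
  have "is_eobj (Yobj a)" "is_eobj (Zobj x r)"
    using assms by (auto simp: Zobj_single intro!: is_eobj_single is_eobj_Yobj)
  then show ?thesis using assms(1)
    by (simp add: S_entry_eq Zobj_single mat_phi_Yobj double_neq_iff)
qed

text \<open>Degree g of Z brings in the scalar \<open>s\<close> of X, while degree 1 of X brings in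
  the identity on Z. The braidings give \<open>q(a)^(-2)\<close> times a sign \<omega> that equals
  \<open>B(x,a) Q(a)^2\<close>, and \<epsilon>\<alpha>\<beta> stems from the weight of the one
  summand of degree g.\<close>

lemma S_Xobj_Zobj:
  assumes a: "a + a = 0" and "s \<in> {1, -1}" "r \<in> {1, -1}"
  shows "S_entry D (Xobj a s) (Zobj x r) =
    eps D * alp D * bet D * (s * root2 TYPE('a) * bilin2 (Qf D) x a * Qf D a)"
proof -
  obtain y where x: "x = cls y" by (metis obtain_cls)
  have na: "- a = a" using a by (simp add: add_eq_0_iff)
  have e: "is_eobj (Xobj a s)" "is_eobj (Zobj x r)"
    using assms by (auto simp: Xobj_single Zobj_single add_eq_0_iff intro!: is_eobj_single)
  \<comment> \<open>\<open>Q(a)^4 = Q(2a) = 1\<close>; this makes \<open>B(y,a) Q(a)^2\<close> its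
    own inverse below.\<close>
  have Q4: "Qf D a * Qf D a * Qf D a * Qf D a = 1"
    using Q_double[of a] a by (simp add: power4_eq_xxxx)
  \<comment> \<open>Since \<open>-a = a\<close>, this \<omega> is the inverse of
    \<open>\<sigma>(y+a,a)^2 = B(y+a,a)\<close>, and \<open>B(a,a) = Q(a)^2\<close>.\<close>
  have "omb D (x + cls a) a (- a) = inverse (bilin (Qf D) y a * (Qf D a * Qf D a))"
    using sg_uminus_om[of "y + a" a]
    by (simp add: x na sg_sq B_add_left B_diag power2_eq_square flip: cls_add)
  also have "\<dots> = bilin (Qf D) y a * (Qf D a * Qf D a)"
  proof (rule inverse_unique)
    have "bilin (Qf D) y a * (Qf D a * Qf D a) * (bilin (Qf D) y a * (Qf D a * Qf D a))
        = (bilin (Qf D) y a * bilin (Qf D) y a) * (Qf D a * Qf D a * Qf D a * Qf D a)"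
      by (simp only: mult_ac)
    then show "bilin (Qf D) y a * (Qf D a * Qf D a) * (bilin (Qf D) y a * (Qf D a * Qf D a)) = 1"
      by (simp add: Q4 B_double_zero[OF a])
  qed
  finally have om: "omb D (x + cls a) a (- a) = bilin2 (Qf D) x a * (Qf D a * Qf D a)"
    by (simp add: x bilin2_cls[OF a])
  have q: "inverse (qf D a) * inverse (qf D a) = inverse (Qf D a)"
    by (simp flip: q_sq add: power2_eq_square)
  have "S_entry D (Xobj a s) (Zobj x r) = s * (eps D * alp D * bet D * root2 TYPE('a) *
      (inverse (qf D a) * (inverse (qf D a) * omb D (x + cls a) a (- a))))"
    unfolding S_entry_eq[OF e] using na by (simp add: Xobj_single Zobj_single mat_phi_single qdim_def)
  also have "\<dots> = s * (eps D * alp D * bet D * root2 TYPE('a) *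
      (inverse (Qf D a) * (bilin2 (Qf D) x a * (Qf D a * Qf D a))))"
    unfolding om q[symmetric] by (simp only: mult_ac)
  finally show ?thesis by (simp add: field_simps)
qed

text \<open>The summands of the product have degree 1 and weight 1, and the double braiding on the
  summand \<open>t\<close> is \<open>\<alpha>^2 q(t)^2 = \<alpha>^2 Q(t)\<close>. One Gauss sum
  comes from \<alpha>^2, the other from the sum over \<open>t\<close>, whose normalisation explains
  the factor \<open>root2\<close>.\<close>

lemma S_Zobj_Zobj:
  assumes "r \<in> {1, -1}" "s \<in> {1, -1}"
  shows "S_entry D (Zobj x r) (Zobj y s) =
    eps D * r * s * root2 TYPE('a) * gauss (dlt D) (\<lambda>a. inverse (qf D a)) * gauss (dlt D + x + y) (Qf D)"
proof -
  have e: "is_eobj (Zobj x r)" "is_eobj (Zobj y s)"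
    using assms by (auto simp: Zobj_single intro!: is_eobj_single)
  have set: "{Cs t | t. cls t = dlt D + x + y} = Cs ` {t. cls t = dlt D + x + y}" by auto
  have "S_entry D (Zobj x r) (Zobj y s) = s * r * (\<Sum>t | cls t = dlt D + x + y. alp D ^ 2 * Qf D t)"
    unfolding S_entry_eq[OF e]
    by (simp add: Zobj_single mat_phi_single set sum.reindex inj_on_def qdim_def
      power2_eq_square mult_ac flip: q_sq)
  also have "\<dots> = s * r * alp D ^ 2 * (\<Sum>t | cls t = dlt D + x + y. Qf D t)"
    by (simp add: sum_distrib_left mult.assoc)
  finally show ?thesis
    unfolding alp_sq by (simp add: gauss_def[of "dlt D + x + y"])
qed

end

theorem proposition5p18:
  fixes D :: "'a::{finite,ab_group_add} crossed_data"
  assumes "is_crossed_data D"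
  shows
    "(\<forall>a s. a + a = 0 \<and> s \<in> {1, -1} \<longrightarrow>
        T_entry D (Xobj a s) (Xobj a s) = inverse (Qf D a)) \<and>
     (\<forall>a. a + a \<noteq> 0 \<longrightarrow>
        T_entry D (Yobj a) (Yobj a) = inverse (Qf D a)) \<and>
     (\<forall>x s. s \<in> {1, -1} \<longrightarrow>
        T_entry D (Zobj x s) (Zobj x s) = s * inverse (bet D)) \<and>
     (\<forall>U\<in>simple_eobjs. \<forall>V\<in>simple_eobjs. U \<noteq> V \<longrightarrow> T_entry D U V = 0) \<and>
     (\<forall>a s b t. a + a = 0 \<and> s \<in> {1, -1} \<and> b + b = 0 \<and> t \<in> {1, -1} \<longrightarrow>
        S_entry D (Xobj a s) (Xobj b t) = bilin (Qf D) a b) \<and>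
     (\<forall>a s b. a + a = 0 \<and> s \<in> {1, -1} \<and> b + b \<noteq> 0 \<longrightarrow>
        S_entry D (Xobj a s) (Yobj b) = 2 * bilin (Qf D) a b) \<and>
     (\<forall>a s x r. a + a = 0 \<and> s \<in> {1, -1} \<and> r \<in> {1, -1} \<longrightarrow>
        (bet D = eps D / alp D \<longrightarrow>
           S_entry D (Xobj a s) (Zobj x r) = s * root2 TYPE('a) * bilin2 (Qf D) x a * Qf D a) \<and>
        (bet D = - (eps D / alp D) \<longrightarrow>
           S_entry D (Xobj a s) (Zobj x r) = - (s * root2 TYPE('a) * bilin2 (Qf D) x a * Qf D a))) \<and>
     (\<forall>a x r. a + a \<noteq> 0 \<and> r \<in> {1, -1} \<longrightarrow>
        S_entry D (Yobj a) (Zobj x r) = 0) \<and>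
     (\<forall>b c. b + b \<noteq> 0 \<and> c + c \<noteq> 0 \<longrightarrow>
        S_entry D (Yobj b) (Yobj c) = 2 * (bilin (Qf D) b c + inverse (bilin (Qf D) b c))) \<and>
     (\<forall>x r y s. r \<in> {1, -1} \<and> s \<in> {1, -1} \<longrightarrow>
        S_entry D (Zobj x r) (Zobj y s) =
          eps D * r * s * root2 TYPE('a) * gauss (dlt D) (\<lambda>a. inverse (qf D a))
            * gauss (dlt D + x + y) (Qf D))"
proof -
  interpret crossed D by (rule crossed.intro) (rule assms)
  \<comment> \<open>With this choice of \<beta> the prefactor \<epsilon>\<alpha>\<beta> is
    \<epsilon> squared, hence 1; the opposite choice gives -1. Cancelling \<alpha> requires that it
    is nonzero.\<close>
  have XZ: "S_entry D (Xobj a s) (Zobj x r) = s * root2 TYPE('a) * bilin2 (Qf D) x a * Qf D a"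
    if "a + a = 0" "s \<in> {1, -1}" "r \<in> {1, -1}" "bet D = eps D / alp D" for a s x r
    using S_Xobj_Zobj[OF that(1-3)] alp_nonzero that(4) by simp
  have XZ': "S_entry D (Xobj a s) (Zobj x r) = - (s * root2 TYPE('a) * bilin2 (Qf D) x a * Qf D a)"
    if "a + a = 0" "s \<in> {1, -1}" "r \<in> {1, -1}" "bet D = - (eps D / alp D)" for a s x r
    using S_Xobj_Zobj[OF that(1-3)] alp_nonzero that(4) by simp
  have "T_entry D U V = 0" if "U \<in> simple_eobjs" "V \<in> simple_eobjs" "U \<noteq> V" for U V
    using eiso_simple_eobjs[OF that(1,2)] that(3) by (auto simp: T_entry_def)
  then show ?thesis
    by (intro conjI allI ballI impI; (elim conjE)?)
      (simp_all only: T_Xobj T_Yobj T_Zobj S_Xobj_Xobj S_Xobj_Yobj S_Yobj_Yobj S_Yobj_Zobj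
        XZ XZ' S_Zobj_Zobj not_False_eq_True)
qed

end
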